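(* Let $a,b\ge0$ be fixed with $\lambda=(a-b)/\sqrt{2(a+b)}\ge0$, $d=(a+b)/2$, $G\sim\mathsf{G}(n,a/n,b/n)$, $\mathbf{A}^{\mathrm{cen}}_G=\mathbf{A}_G-(d/n)\mathbf{1}\mathbf{1}^{\mathsf T}$, and $\mathbf{B}(\lambda)=\frac\lambda n\mathbf{1}\mathbf{1}^{\mathsf T}+\mathbf{W}$ with $\mathbf{W}\sim\mathrm{GOE}(n)$. Then there exists $C=C(\lambda)$ such that, for all $n\ge n_0(a,b)$, with probability at least $1-Ce^{-n/C}$, $$\Big|\tfrac1{n\sqrt d}\mathrm{SDP}(\mathbf{A}^{\mathrm{cen}}_G)-\tfrac1n\mathrm{SDP}(\mathbf{B}(\lambda))\Big|\le\frac{C\log d}{d^{1/10}},\qquad \Big|\tfrac1{n\sqrt d}\mathrm{SDP}(-\mathbf{A}^{\mathrm{cen}}_G)-\tfrac1n\mathrm{SDP}(-\mathbf{B}(\lambda))\Big|\le\frac{C\log d}{d^{1/10}}.$$ Further, $C(\lambda)$ is bounded over compact intervals $\lambda\in[0,\lambda_{\max}]$.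
   Context: $\mathsf{G}(n,a/n,b/n)$ ($n$ even): $[n]$ partitioned uniformly at random into two sets of size $n/2$; conditional on it, edges independent with probability $a/n$ inside a part, $b/n$ across. $\mathbf{W}\sim\mathrm{GOE}(n)$: symmetric, $\{W_{ij}\}_{i\le j}$ independent, $W_{ii}\sim\mathsf{N}(0,2/n)$, $W_{ij}\sim\mathsf{N}(0,1/n)$ ($i<j$). $\mathrm{SDP}(\mathbf{M})=\max\{\mathrm{Tr}(\mathbf{M}\mathbf{X}):\ \mathbf{X}\succeq0,\ X_{ii}=1\ \forall i\}$.
   Formalization: Proved for d ≥ d₀ with any fixed d₀ > 1, C depending on λ and d₀ (for d ≤ 1 the bound is ≤ 0), and with probability at least 1 − C exp(−n min(1, ε²)/C), ε = log d/d^{1/10}, as the rate n/C uniform in d is false for independent G, W. *)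

theory Defs
  imports "HOL-Probability.Probability"
begin

text \<open>
  The size \<open>n\<close> is quantified inside the theorem, so an \<open>n \<times> n\<close> matrix is a function
  \<open>nat \<Rightarrow> nat \<Rightarrow> real\<close> of which only the entries with both indices below \<open>n\<close> matter.
\<close>

definition trace_prod :: "nat \<Rightarrow> (nat \<Rightarrow> nat \<Rightarrow> real) \<Rightarrow> (nat \<Rightarrow> nat \<Rightarrow> real) \<Rightarrow> real" where
  "trace_prod n M X = (\<Sum>i<n. \<Sum>j<n. M i j * X j i)"

definition pos_semidef :: "nat \<Rightarrow> (nat \<Rightarrow> nat \<Rightarrow> real) \<Rightarrow> bool" where
  "pos_semidef n X \<longleftrightarrow>
     (\<forall>i<n. \<forall>j<n. X i j = X j i) \<and>
     (\<forall>v :: nat \<Rightarrow> real. (\<Sum>i<n. \<Sum>j<n. v i * X i j * v j) \<ge> 0)"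

definition elliptope :: "nat \<Rightarrow> (nat \<Rightarrow> nat \<Rightarrow> real) set" where
  "elliptope n = {X. pos_semidef n X \<and> (\<forall>i<n. X i i = 1)}"

text \<open>The supremum is a maximum: see \<open>sdp_attained\<close> and \<open>sdp_upper\<close> below.\<close>

definition sdp :: "nat \<Rightarrow> (nat \<Rightarrow> nat \<Rightarrow> real) \<Rightarrow> real" where
  "sdp n M = (SUP X\<in>elliptope n. trace_prod n M X)"

text \<open>The symmetric matrix with given entries \<open>u (i, j)\<close>, \<open>i \<le> j\<close>.\<close>

definition sym_matrix :: "(nat \<times> nat \<Rightarrow> 'a) \<Rightarrow> nat \<Rightarrow> nat \<Rightarrow> 'a" where
  "sym_matrix u i j = u (min i j, max i j)"

text \<open>
  A random graph on \<open>{..<n}\<close> is represented by the indicator \<open>g (i, j)\<close>, \<open>i < j < n\<close>, of its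
  edges; \<open>g\<close> is \<open>False\<close> at all other pairs, in particular on the diagonal.
  The set \<open>S\<close> is one part of the balanced partition, the other one being \<open>{..<n} - S\<close>.
\<close>

definition sbm :: "nat \<Rightarrow> real \<Rightarrow> real \<Rightarrow> (nat \<times> nat \<Rightarrow> bool) pmf" where
  "sbm n p q =
     bind_pmf (pmf_of_set {S. S \<subseteq> {..<n} \<and> card S = n div 2})
       (\<lambda>S. Pi_pmf {(i, j). i < j \<and> j < n} False
              (\<lambda>(i, j). bernoulli_pmf (if i \<in> S \<longleftrightarrow> j \<in> S then p else q)))"

definition adjacency :: "(nat \<times> nat \<Rightarrow> bool) \<Rightarrow> nat \<Rightarrow> nat \<Rightarrow> real" where
  "adjacency g i j = of_bool (sym_matrix g i j)"

definition centered_adjacency ::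
    "nat \<Rightarrow> real \<Rightarrow> (nat \<times> nat \<Rightarrow> bool) \<Rightarrow> nat \<Rightarrow> nat \<Rightarrow> real" where
  "centered_adjacency n d g i j = adjacency g i j - d / real n"

text \<open>
  The law of the entries on and above the diagonal of a GOE matrix; the matrix itself is
  \<open>sym_matrix w\<close>. The second argument of \<open>normal_density\<close> is the standard deviation.
\<close>

definition goe :: "nat \<Rightarrow> (nat \<times> nat \<Rightarrow> real) measure" where
  "goe n = PiM {(i, j). i \<le> j \<and> j < n}
     (\<lambda>(i, j). density lborel
        (normal_density 0 (sqrt (if i = j then 2 / real n else 1 / real n))))"

definition spiked_goe :: "nat \<Rightarrow> real \<Rightarrow> (nat \<times> nat \<Rightarrow> real) \<Rightarrow> nat \<Rightarrow> nat \<Rightarrow> real" where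
  "spiked_goe n l w i j = l / real n + sym_matrix w i j"

text \<open>All joint laws of a pair of random elements with laws \<open>M\<close> and \<open>N\<close>.\<close>

definition couplings :: "'a measure \<Rightarrow> 'b measure \<Rightarrow> ('a \<times> 'b) measure set" where
  "couplings M N =
     {P. sets P = sets (M \<Otimes>\<^sub>M N) \<and> prob_space P \<and> distr P M fst = M \<and> distr P N snd = N}"

definition avg_degree :: "real \<Rightarrow> real \<Rightarrow> real" where
  "avg_degree a b = (a + b) / 2"

definition snr :: "real \<Rightarrow> real \<Rightarrow> real" where
  "snr a b = (a - b) / sqrt (2 * (a + b))"

text \<open>
  Meaningful for \<open>d > 1\<close> only: the value is \<open>\<le> 0\<close> for \<open>0 \<le> d \<le> 1\<close> and tends to \<open>0\<close> as \<open>d\<close>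
  decreases to \<open>1\<close>. For a large spike, \<open>sdp n (spiked_goe n l w) / n\<close> leaves any fixed window
  of width of order \<open>e\<close> with probability at least \<open>exp (- c * n * e\<^sup>2)\<close>, so an error \<open>C * e\<close>
  with \<open>e = sdp_error d\<close> goes with a rate of order \<open>n * e\<^sup>2\<close> when \<open>e\<close> is small.
\<close>

definition sdp_error :: "real \<Rightarrow> real" where
  "sdp_error d = ln d / d powr (1 / 10)"


lemma elliptope_nonempty: "(\<lambda>i j. of_bool (i = j)) \<in> elliptope n"
proof -
  have "(\<Sum>i<n. \<Sum>j<n. v i * of_bool (i = j) * v j) \<ge> 0" for v :: "nat \<Rightarrow> real"
  proof (intro sum_nonneg)
    fix i j show "v i * of_bool (i = j) * v j \<ge> 0" by (cases "i = j") auto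
  qed
  then show ?thesis by (auto simp: elliptope_def pos_semidef_def)
qed

lemma sum_pair_support:
  fixes f :: "nat \<Rightarrow> real"
  assumes "i < n" "j < n" "i \<noteq> j" "\<And>k. k \<noteq> i \<Longrightarrow> k \<noteq> j \<Longrightarrow> f k = 0"
  shows "(\<Sum>k<n. f k) = f i + f j"
proof -
  have "(\<Sum>k<n. f k) = (\<Sum>k\<in>{i, j}. f k)"
    by (rule sum.mono_neutral_right) (use assms in auto)
  then show ?thesis using assms by simp
qed

lemma elliptope_entry_bound:
  assumes X: "X \<in> elliptope n" and ij: "i < n" "j < n"
  shows "\<bar>X i j\<bar> \<le> 1"
proof (cases "i = j")
  case True
  then show ?thesis using X ij by (auto simp: elliptope_def)
next
  case False
  have q: "0 \<le> 2 + 2 * s * X i j" if "s * s = 1" for s :: real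
  proof -
    define v where "v = (\<lambda>k. if k = i then 1 else if k = j then s else (0::real))"
    have "0 \<le> (\<Sum>k<n. \<Sum>l<n. v k * X k l * v l)"
      using X by (simp add: elliptope_def pos_semidef_def)
    also have "\<dots> = (\<Sum>l<n. v i * X i l * v l) + (\<Sum>l<n. v j * X j l * v l)"
      by (rule sum_pair_support) (use ij False in \<open>auto simp: v_def\<close>)
    also have "(\<Sum>l<n. v i * X i l * v l) = v i * X i i * v i + v i * X i j * v j"
      by (rule sum_pair_support) (use ij False in \<open>auto simp: v_def\<close>)
    also have "(\<Sum>l<n. v j * X j l * v l) = v j * X j i * v i + v j * X j j * v j"
      by (rule sum_pair_support) (use ij False in \<open>auto simp: v_def\<close>)
    finally have "0 \<le> X i i + X i j * s + (s * X j i + s * X j j * s)"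
      using False by (simp add: v_def)
    moreover have "X i i = 1" "X j j = 1" "X j i = X i j"
      using X ij unfolding elliptope_def pos_semidef_def by blast+
    ultimately show ?thesis using that by simp
  qed
  have "0 \<le> 2 + 2 * X i j" "0 \<le> 2 - 2 * X i j"
    using q[of 1] q[of "-1"] by simp_all
  then show ?thesis by (simp add: abs_le_iff)
qed

lemma bdd_above_trace_prod: "bdd_above (trace_prod n M ` elliptope n)"
proof (rule bdd_aboveI2)
  fix X assume X: "X \<in> elliptope n"
  have "M i j * X j i \<le> \<bar>M i j\<bar>" if "i < n" "j < n" for i j
  proof -
    have "\<bar>M i j * X j i\<bar> \<le> \<bar>M i j\<bar> * 1"
      unfolding abs_mult using elliptope_entry_bound[OF X that(2,1)] by (intro mult_left_mono) auto
    then show ?thesis by simp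
  qed
  then show "trace_prod n M X \<le> (\<Sum>i<n. \<Sum>j<n. \<bar>M i j\<bar>)"
    unfolding trace_prod_def by (intro sum_mono) auto
qed

lemma sdp_upper: "X \<in> elliptope n \<Longrightarrow> trace_prod n M X \<le> sdp n M"
  unfolding sdp_def by (rule cSUP_upper[OF _ bdd_above_trace_prod])

lemma compact_Pi_UNIV:
  fixes S :: "'i \<Rightarrow> ('a :: topological_space) set"
  assumes "\<And>i. compact (S i)"
  shows "compact {f. \<forall>i. f i \<in> S i}"
proof -
  have "compactin (product_topology (\<lambda>i. euclidean) UNIV) (PiE UNIV S)"
    using assms by (simp add: compactin_PiE)
  moreover have "PiE UNIV S = {f. \<forall>i. f i \<in> S i}"
    by (auto simp: PiE_iff extensional_def)
  ultimately show ?thesis by (simp add: euclidean_product_topology)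
qed

lemma continuous_on_entry [continuous_intros]:
  "continuous_on A (\<lambda>X :: nat \<Rightarrow> nat \<Rightarrow> real. X i j)"
proof -
  have "continuous_on A (\<lambda>X :: nat \<Rightarrow> nat \<Rightarrow> real. X i)"
    by (rule continuous_on_product_then_coordinatewise[OF continuous_on_id])
  then show ?thesis by (rule continuous_on_product_then_coordinatewise)
qed

lemma sdp_attained: "\<exists>X\<in>elliptope n. sdp n M = trace_prod n M X"
proof -
  define K :: "(nat \<Rightarrow> nat \<Rightarrow> real) set" where "K = {X. \<forall>i. X i \<in> {f. \<forall>j. f j \<in> {-1..1}}}"
  have K: "compact K"
    unfolding K_def by (intro compact_Pi_UNIV) auto
  have "elliptope n =
      (\<Inter>i\<in>{..<n}. \<Inter>j\<in>{..<n}. {X. X i j = X j i}) \<inter>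
      (\<Inter>v. {X. 0 \<le> (\<Sum>i<n. \<Sum>j<n. v i * X i j * v j)}) \<inter>
      (\<Inter>i\<in>{..<n}. {X. X i i = 1})"
    by (auto simp: elliptope_def pos_semidef_def)
  moreover have "closed \<dots>"
    by (intro closed_Int closed_INT ballI closed_Collect_eq closed_Collect_le continuous_intros)
  ultimately have "closed (elliptope n)" by simp
  then have comp: "compact (K \<inter> elliptope n)"
    by (rule compact_Int_closed[OF K])
  have ne: "K \<inter> elliptope n \<noteq> {}"
  proof -
    have "(\<lambda>i j. of_bool (i = j)) \<in> K" by (simp add: K_def)
    then show ?thesis using elliptope_nonempty[of n] by blast
  qed
  have "continuous_on (K \<inter> elliptope n) (trace_prod n M)"
    unfolding trace_prod_def by (intro continuous_intros)
  from continuous_attains_sup[OF comp ne this]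
  obtain X where X: "X \<in> K \<inter> elliptope n"
    and mx: "\<And>Y. Y \<in> K \<inter> elliptope n \<Longrightarrow> trace_prod n M Y \<le> trace_prod n M X" by blast
  have "trace_prod n M Y \<le> trace_prod n M X" if Y: "Y \<in> elliptope n" for Y
  proof -
    define Z where "Z = (\<lambda>i j. if i < n \<and> j < n then Y i j else 0)"
    have "(\<Sum>i<n. \<Sum>j<n. v i * Z i j * v j) = (\<Sum>i<n. \<Sum>j<n. v i * Y i j * v j)" for v
      by (intro sum.cong) (auto simp: Z_def)
    then have "Z \<in> elliptope n"
      using Y by (auto simp: elliptope_def pos_semidef_def Z_def)
    moreover have "Z i j \<in> {-1..1}" for i j
      using elliptope_entry_bound[OF Y, of i j] by (auto simp: Z_def)
    then have "Z \<in> K" by (simp add: K_def)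
    moreover have "trace_prod n M Z = trace_prod n M Y"
      unfolding trace_prod_def by (intro sum.cong) (auto simp: Z_def)
    ultimately show ?thesis using mx[of Z] by simp
  qed
  then have "sdp n M \<le> trace_prod n M X"
    unfolding sdp_def using elliptope_nonempty by (intro cSUP_least) auto
  moreover have "trace_prod n M X \<le> sdp n M"
    using X by (intro sdp_upper) auto
  ultimately show ?thesis using X by (intro bexI[of _ X]) auto
qed

end

(*
  The graph matrix divided by sqrt d, after flipping signs according to the partition, and the
  spiked GOE matrix both have independent entries of mean l/n and variance about 1/n above the
  diagonal.

  The semidefinite program is replaced by the maximum over Gram matrices of unit vectors from a
  finite set T of at most (5k)^k vectors in R^k. If X is optimal and y_1, ..., y_n are Gaussian
  vectors in R^k with covariance X, let z_i be the point of T obtained by rounding y_i. Since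
  E<y_i, f(y_j)> is proportional to X_ij, the matrix E<z_i, z_j> equals (1 - delta) X + D, where D
  is the Gram matrix of the rounding errors y_i / sqrt k - z_i, with constant diagonal
  delta = O(1/k). Hence the loss is delta (SDP(M) + SDP(-M)) = O(n/k), and not O(n / sqrt k).

  The maximum is smoothed to a log-partition function at inverse temperature beta, at a cost of
  n k log(5k) / beta. It is 2-Lipschitz in every entry with third derivatives O(beta^2), so
  that a martingale argument gives concentration and Lindeberg's replacement of one entry at a
  time changes its mean by O(n beta^2 / sqrt d). With k = d^(1/10) and beta = d^(1/5) all errors
  are O(log d / d^(1/10)).
*)
theory Submission
  imports Defs
begin

section \<open>Positive semidefinite matrices and the semidefinite program\<close>

text \<open>The exponent 1/10 is where three losses per vertex balance: 1/k from rounding, k log k /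
  beta from smoothing and beta^2 / sqrt d from exchanging the laws are all d^(-1/10), up to the
  logarithm. The rounding loss is proportional to SDP(M) + SDP(-M), so an a priori bound O(n) on
  this sum is needed. It comes from the same rounding with k a constant: the loss is then absorbed
  into the left-hand side, and only a union bound over exp(O(n)) linear forms remains. Sparsity
  shapes the concentration argument. A graph entry jumps by 1 / sqrt d but has variance about 1/n,
  so bounded differences give no decay in n, and no variance proxy of order 1/n is valid for all
  exponential moments. The entries are therefore only asked to satisfy a quadratic bound for
  arguments in [-1, 1], which Bernoulli and normal laws share. Both programs are compared with one
  deterministic number, the mean of the smoothed program under the GOE law. It is the same for every
  partition, and the comparison uses the two marginal laws only, so it holds under every
  coupling.\<close>

definition gram :: "nat \<Rightarrow> (nat \<Rightarrow> nat \<Rightarrow> real) \<Rightarrow> nat \<Rightarrow> nat \<Rightarrow> real" where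
  "gram k U i j = (\<Sum>m<k. U i m * U j m)"

lemma gram_quadratic_form:
  "(\<Sum>i<n. \<Sum>j<n. v i * gram k U i j * v j) = (\<Sum>m<k. (\<Sum>i<n. v i * U i m)\<^sup>2)"
proof -
  have "(\<Sum>i<n. \<Sum>j<n. v i * gram k U i j * v j) =
      (\<Sum>i<n. \<Sum>j<n. \<Sum>m<k. (v i * U i m) * (v j * U j m))"
    by (simp add: gram_def sum_distrib_left sum_distrib_right mult_ac)
  also have "\<dots> = (\<Sum>i<n. \<Sum>m<k. \<Sum>j<n. (v i * U i m) * (v j * U j m))"
    by (intro sum.cong refl sum.swap)
  also have "\<dots> = (\<Sum>m<k. \<Sum>i<n. \<Sum>j<n. (v i * U i m) * (v j * U j m))"
    by (rule sum.swap)
  finally show ?thesis by (simp add: power2_eq_square sum_product)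
qed

lemma pos_semidef_gram: "pos_semidef n (gram k U)"
  unfolding pos_semidef_def gram_quadratic_form
  by (auto simp: gram_def mult.commute intro!: sum_nonneg)

lemma gram_in_elliptope:
  assumes "\<And>i. i < n \<Longrightarrow> (\<Sum>m<k. (U i m)\<^sup>2) = 1"
  shows "gram k U \<in> elliptope n"
  using assms by (auto simp: elliptope_def pos_semidef_gram gram_def power2_eq_square)

lemma pos_semidef_scale:
  assumes "pos_semidef n X" "c \<ge> 0"
  shows "pos_semidef n (\<lambda>i j. c * X i j)"
proof -
  have "(\<Sum>i<n. \<Sum>j<n. v i * (c * X i j) * v j) = c * (\<Sum>i<n. \<Sum>j<n. v i * X i j * v j)" for v
    by (simp add: sum_distrib_left mult_ac)
  then show ?thesis using assms by (auto simp: pos_semidef_def)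
qed

text \<open>As a function of \<open>v n\<close> the form is a quadratic polynomial. Minimizing it
  over \<open>v n\<close> is the Schur complement step of the factorization below.\<close>

lemma quadratic_form_Suc:
  fixes v :: "nat \<Rightarrow> real"
  assumes "\<And>i. i < n \<Longrightarrow> X i n = X n i"
  shows "(\<Sum>i<Suc n. \<Sum>j<Suc n. v i * X i j * v j) =
    (\<Sum>i<n. \<Sum>j<n. v i * X i j * v j) + 2 * v n * (\<Sum>i<n. v i * X n i) + X n n * (v n)\<^sup>2"
proof -
  have "(\<Sum>i<n. v i * X i n * v n) = (\<Sum>i<n. v i * X n i) * v n"
    unfolding sum_distrib_right by (intro sum.cong) (auto simp: assms)
  moreover have "(\<Sum>i<n. v n * X n i * v i) = v n * (\<Sum>i<n. v i * X n i)"
    unfolding sum_distrib_left by (intro sum.cong) (auto simp: mult_ac)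
  ultimately show ?thesis
    by (simp add: sum.distrib power2_eq_square algebra_simps)
qed

text \<open>When \<open>X i i = 0\<close>, the form at s e_i + e_j is affine in s, so it can stay
  nonnegative for all s only with slope zero. This keeps zero pivots harmless in the
  factorization.\<close>

lemma pos_semidef_zero_diagonal:
  assumes X: "pos_semidef n X" and ij: "i < n" "j < n" and 0: "X i i = 0"
  shows "X i j = 0"
proof (cases "i = j")
  case False
  have q: "0 \<le> X j j + 2 * s * X i j" for s :: real
  proof -
    define v where "v = (\<lambda>k. if k = i then s else if k = j then 1 else (0::real))"
    have "0 \<le> (\<Sum>k<n. \<Sum>l<n. v k * X k l * v l)"
      using X by (simp add: pos_semidef_def)
    also have "\<dots> = (\<Sum>l<n. v i * X i l * v l) + (\<Sum>l<n. v j * X j l * v l)"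
      by (rule sum_pair_support) (use ij False in \<open>auto simp: v_def\<close>)
    also have "(\<Sum>l<n. v i * X i l * v l) = v i * X i i * v i + v i * X i j * v j"
      by (rule sum_pair_support) (use ij False in \<open>auto simp: v_def\<close>)
    also have "(\<Sum>l<n. v j * X j l * v l) = v j * X j i * v i + v j * X j j * v j"
      by (rule sum_pair_support) (use ij False in \<open>auto simp: v_def\<close>)
    finally have "0 \<le> s * X i j + (X j i * s + X j j)"
      using False 0 by (simp add: v_def)
    moreover have "X j i = X i j" using X ij by (simp add: pos_semidef_def)
    ultimately show ?thesis by (simp add: algebra_simps)
  qed
  show ?thesis
  proof (rule ccontr)
    assume ne: "X i j \<noteq> 0"
    \<comment> \<open>At this value of \<open>s\<close> the affine function equals -1.\<close>
    show False using q[of "- (X j j + 1) / (2 * X i j)"] ne by (simp add: field_simps)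
  qed
qed (use 0 in simp)

text \<open>Cholesky factorization by induction on the size, with the last index as pivot: the Schur
  complement \<open>Y\<close> is again positive semidefinite and factors with one column
  fewer.\<close>

lemma pos_semidef_imp_gram:
  "pos_semidef n X \<Longrightarrow> \<exists>U. \<forall>i<n. \<forall>j<n. X i j = gram n U i j"
proof (induction n arbitrary: X)
  case (Suc n)
  define p where "p = X n n"
  define w where "w i = X n i / sqrt p" for i
  have sym: "X i j = X j i" if "i < Suc n" "j < Suc n" for i j
    using Suc.prems that unfolding pos_semidef_def by blast
  have psd: "0 \<le> (\<Sum>i<Suc n. \<Sum>j<Suc n. v i * X i j * v j)" for v
    using Suc.prems unfolding pos_semidef_def by blast
  have p0: "p \<ge> 0"
  proof -
    have z: "(\<Sum>i<n. \<Sum>j<n. (if i = n then 1 else 0) * X i j * (if j = n then 1 else 0)) = (0::real)"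
      "(\<Sum>i<n. (if i = n then 1 else 0) * X n i) = 0"
      by (auto intro!: sum.neutral)
    show ?thesis
      using psd[of "\<lambda>i. if i = n then 1 else 0"]
      by (subst (asm) quadratic_form_Suc) (use sym z in \<open>auto simp: p_def\<close>)
  qed
  \<comment> \<open>Also true for \<open>p = 0\<close>: division by zero makes \<open>w\<close>
    vanish, and the last row of \<open>X\<close> vanishes together with its diagonal entry.\<close>
  have w: "w i * sqrt p = X n i" if "i \<le> n" for i
    using pos_semidef_zero_diagonal[OF Suc.prems, of n i] that p0
    by (auto simp: w_def p_def)
  define Y where "Y i j = X i j - w i * w j" for i j
  have "pos_semidef n Y"
    unfolding pos_semidef_def
  proof (intro conjI allI impI)
    show "Y i j = Y j i" if "i < n" "j < n" for i j
      using sym[of i j] that by (simp add: Y_def)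
    fix v :: "nat \<Rightarrow> real"
    define S where "S = (\<Sum>i<n. v i * w i)"
    \<comment> \<open>A minimizer of the form over the last coordinate; the minimum is the form of
      \<open>Y\<close> at \<open>v\<close>.\<close>
    define t where "t = (if p = 0 then 0 else - S / sqrt p)"
    define v' where "v' = v(n := t)"
    have Xs: "(\<Sum>i<n. v i * X n i) = S * sqrt p"
      unfolding S_def sum_distrib_right by (intro sum.cong) (auto simp flip: w)
    have "0 \<le> (\<Sum>i<Suc n. \<Sum>j<Suc n. v' i * X i j * v' j)" by (rule psd)
    also have "\<dots> = (\<Sum>i<n. \<Sum>j<n. v' i * X i j * v' j) + 2 * v' n * (\<Sum>i<n. v' i * X n i) + X n n * (v' n)\<^sup>2"
      by (rule quadratic_form_Suc) (simp add: sym)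
    also have "\<dots> = (\<Sum>i<n. \<Sum>j<n. v i * X i j * v j) + 2 * t * (S * sqrt p) + p * t\<^sup>2"
      unfolding Xs[symmetric] by (simp add: v'_def p_def)
    also have "\<dots> = (\<Sum>i<n. \<Sum>j<n. v i * X i j * v j) - S\<^sup>2"
    proof (cases "p = 0")
      case True
      then have "S = 0" by (simp add: S_def w_def)
      then show ?thesis using True by (simp add: t_def)
    next
      case False
      then show ?thesis using p0 by (simp add: t_def power_divide power2_eq_square)
    qed
    also have "S\<^sup>2 = (\<Sum>i<n. \<Sum>j<n. v i * (w i * w j) * v j)"
      by (simp add: S_def power2_eq_square sum_product mult_ac)
    finally show "0 \<le> (\<Sum>i<n. \<Sum>j<n. v i * Y i j * v j)"
      by (simp add: Y_def algebra_simps sum_subtractf)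
  qed
  then obtain U where U: "\<And>i j. i < n \<Longrightarrow> j < n \<Longrightarrow> Y i j = gram n U i j"
    using Suc.IH by blast
  \<comment> \<open>The column \<open>w\<close> is appended. The last row is zero in the old
    columns, so its product with any row is a product of entries of \<open>w\<close>.\<close>
  define V where "V i m = (if m = n then w i else if i = n then 0 else U i m)" for i m
  have wn: "w n = sqrt p" using p0 by (simp add: w_def real_div_sqrt flip: p_def)
  have "X i j = gram (Suc n) V i j" if "i < Suc n" "j < Suc n" for i j
  proof (cases "i = n \<or> j = n")
    case True
    then have "(\<Sum>m<n. V i m * V j m) = 0" by (auto simp: V_def intro!: sum.neutral)
    moreover have "X i j = w i * w j"
      using True that w[of i] w[of j] wn sym[of i j] by (auto simp: mult_ac)
    ultimately show ?thesis by (simp add: gram_def) (simp add: V_def)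
  next
    case False
    then have "i < n" "j < n" using that by auto
    then have "(\<Sum>m<n. V i m * V j m) = Y i j" by (auto simp: U gram_def V_def)
    then show ?thesis by (simp add: gram_def) (simp add: V_def Y_def)
  qed
  then show ?case by blast
qed simp

lemma trace_prod_scale_right: "trace_prod n M (\<lambda>i j. c * X i j) = c * trace_prod n M X"
  by (simp add: trace_prod_def sum_distrib_left mult_ac)

lemma trace_prod_uminus_left: "trace_prod n (\<lambda>i j. - M i j) X = - trace_prod n M X"
  by (simp add: trace_prod_def sum_negf)

text \<open>The identity is feasible in both programs, with opposite objective values. The sum is
  the scale of the rounding loss, and its sign allows a loss factor to be replaced by an upper
  bound.\<close>

lemma sdp_uminus_lower: "0 \<le> sdp n M + sdp n (\<lambda>i j. - M i j)"
  using sdp_upper[OF elliptope_nonempty, of n M]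
    sdp_upper[OF elliptope_nonempty, of n "\<lambda>i j. - M i j"]
  by (simp add: trace_prod_uminus_left)

lemma sdp_scale:
  assumes "c \<ge> 0"
  shows "sdp n (\<lambda>i j. c * M i j) = c * sdp n M"
proof -
  have tr: "trace_prod n (\<lambda>i j. c * M i j) X = c * trace_prod n M X" for X
    by (simp add: trace_prod_def sum_distrib_left mult_ac)
  obtain X where X: "X \<in> elliptope n" "sdp n M = trace_prod n M X" using sdp_attained by blast
  obtain Y where Y: "Y \<in> elliptope n"
    "sdp n (\<lambda>i j. c * M i j) = trace_prod n (\<lambda>i j. c * M i j) Y" using sdp_attained by blast
  have "sdp n (\<lambda>i j. c * M i j) \<le> c * sdp n M"
    unfolding Y(2) tr using assms sdp_upper[OF Y(1)] by (intro mult_left_mono)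
  moreover have "c * sdp n M \<le> sdp n (\<lambda>i j. c * M i j)"
    unfolding X(2) using sdp_upper[OF X(1), of "\<lambda>i j. c * M i j"] by (simp add: tr)
  ultimately show ?thesis by simp
qed

text \<open>Dividing \<open>D\<close> by \<delta> puts it in the elliptope; for \<delta> = 0 the
  zero diagonal forces all entries to vanish. Applied to the negated matrix, this pays for the Gram
  matrix of the rounding errors.\<close>

lemma trace_prod_constant_diagonal_le:
  assumes D: "pos_semidef n D" and diag: "\<And>i. i < n \<Longrightarrow> D i i = \<delta>" and "\<delta> \<ge> 0"
  shows "trace_prod n M D \<le> \<delta> * sdp n M"
proof (cases "\<delta> = 0")
  case True
  have "D i j = 0" if "i < n" "j < n" for i j
    using pos_semidef_zero_diagonal[OF D] that diag True by simp
  then have "trace_prod n M D = 0" by (simp add: trace_prod_def)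
  then show ?thesis using True by simp
next
  case False
  have "(\<lambda>i j. inverse \<delta> * D i j) \<in> elliptope n"
    using pos_semidef_scale[OF D, of "inverse \<delta>"] diag assms(3) False by (simp add: elliptope_def)
  from mult_left_mono[OF sdp_upper[OF this, of M] assms(3)] show ?thesis
    unfolding trace_prod_scale_right using False by (simp flip: mult.assoc)
qed

lemma sdp_le_of_entries:
  "sdp n M \<le> sdp n M' + (\<Sum>i<n. \<Sum>j<n. \<bar>M i j - M' i j\<bar>)"
proof -
  obtain X where X: "X \<in> elliptope n" "sdp n M = trace_prod n M X" using sdp_attained by blast
  have "trace_prod n M X - trace_prod n M' X = (\<Sum>i<n. \<Sum>j<n. (M i j - M' i j) * X j i)"
    by (simp add: trace_prod_def algebra_simps sum_subtractf)
  also have "\<dots> \<le> (\<Sum>i<n. \<Sum>j<n. \<bar>M i j - M' i j\<bar>)"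
  proof (intro sum_mono)
    fix i j assume "i \<in> {..<n}" "j \<in> {..<n}"
    then have "\<bar>X j i\<bar> \<le> 1" using elliptope_entry_bound[OF X(1)] by simp
    then have "\<bar>M i j - M' i j\<bar> * \<bar>X j i\<bar> \<le> \<bar>M i j - M' i j\<bar> * 1" by (intro mult_left_mono) auto
    then show "(M i j - M' i j) * X j i \<le> \<bar>M i j - M' i j\<bar>"
      by (simp flip: abs_mult)
  qed
  finally show ?thesis using sdp_upper[OF X(1), of M'] X(2) by simp
qed

lemma sdp_cong: "(\<And>i j. i < n \<Longrightarrow> j < n \<Longrightarrow> M i j = M' i j) \<Longrightarrow> sdp n M = sdp n M'"
  using sdp_le_of_entries[of n M M'] sdp_le_of_entries[of n M' M] by simp

lemma elliptope_sign_flip: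
  fixes s :: "nat \<Rightarrow> real"
  assumes X: "X \<in> elliptope n" and s: "\<And>i. s i * s i = 1"
  shows "(\<lambda>i j. s i * s j * X i j) \<in> elliptope n"
proof -
  have "0 \<le> (\<Sum>i<n. \<Sum>j<n. v i * (s i * s j * X i j) * v j)" for v
  proof -
    have "\<forall>v. 0 \<le> (\<Sum>i<n. \<Sum>j<n. v i * X i j * v j)"
      using X unfolding elliptope_def pos_semidef_def by blast
    from this[THEN spec, of "\<lambda>i. v i * s i"] show ?thesis by (simp add: mult_ac)
  qed
  then show ?thesis using X s by (auto simp: elliptope_def pos_semidef_def mult_ac)
qed

text \<open>Conjugation with a diagonal sign matrix is an involution of the elliptope, so one
  inequality gives both. It later removes the hidden partition from the graph matrix.\<close>

lemma sdp_sign_flip: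
  fixes s :: "nat \<Rightarrow> real"
  assumes s: "\<And>i. s i * s i = 1"
  shows "sdp n (\<lambda>i j. s i * s j * M i j) = sdp n M"
proof -
  have le: "sdp n (\<lambda>i j. s i * s j * M i j) \<le> sdp n M" for M
  proof -
    obtain X where X: "X \<in> elliptope n"
      "sdp n (\<lambda>i j. s i * s j * M i j) = trace_prod n (\<lambda>i j. s i * s j * M i j) X"
      using sdp_attained by blast
    have "trace_prod n (\<lambda>i j. s i * s j * M i j) X = trace_prod n M (\<lambda>i j. s i * s j * X i j)"
      by (simp add: trace_prod_def mult_ac)
    then show ?thesis using sdp_upper[OF elliptope_sign_flip[OF X(1) s], of M] X(2) by simp
  qed
  have eq: "(\<lambda>i j. s i * s j * (s i * s j * M i j)) = M"
  proof (intro ext)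
    fix i j
    have "s i * s j * (s i * s j * M i j) = (s i * s i) * (s j * s j) * M i j" by (simp only: mult_ac)
    then show "s i * s j * (s i * s j * M i j) = M i j" by (simp add: s)
  qed
  show ?thesis using le[of M] le[of "\<lambda>i j. s i * s j * M i j"] by (simp add: eq)
qed

section \<open>Traces as linear forms in the entries on and above the diagonal\<close>

definition upper_pairs :: "nat \<Rightarrow> (nat \<times> nat) set" where
  "upper_pairs n = {(i, j). i \<le> j \<and> j < n}"

lemma finite_upper_pairs [simp]: "finite (upper_pairs n)"
  by (rule finite_subset[of _ "{..<n} \<times> {..<n}"]) (auto simp: upper_pairs_def)

lemma card_upper_pairs_le: "real (card (upper_pairs n)) \<le> (real n)\<^sup>2"
proof -
  have "card (upper_pairs n) \<le> card ({..<n} \<times> {..<n})"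
    by (rule card_mono) (auto simp: upper_pairs_def)
  then show ?thesis by (simp add: power2_eq_square flip: of_nat_mult)
qed

text \<open>An entry off the diagonal occurs twice in a symmetric matrix. The trace becomes a linear
  form in the independent entries with coefficients at most 2 on the elliptope; this 2 is the
  Lipschitz constant used from here on.\<close>

definition pair_coeff :: "(nat \<Rightarrow> nat \<Rightarrow> real) \<Rightarrow> nat \<times> nat \<Rightarrow> real" where
  "pair_coeff X = (\<lambda>(i, j). (if i = j then 1 else 2) * X i j)"

lemma trace_prod_sym_matrix:
  assumes "\<And>i j. i < n \<Longrightarrow> j < n \<Longrightarrow> X i j = X j i"
  shows "trace_prod n (sym_matrix x) X = (\<Sum>e\<in>upper_pairs n. pair_coeff X e * x e)"
  using assms
proof (induction n)
  case (Suc n)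
  have split: "upper_pairs (Suc n) = upper_pairs n \<union> (\<lambda>i. (i, n)) ` {..<n} \<union> {(n, n)}"
    by (auto simp: upper_pairs_def less_Suc_eq image_def le_less)
  have "(\<Sum>e\<in>upper_pairs (Suc n). pair_coeff X e * x e) =
      (\<Sum>e\<in>upper_pairs n. pair_coeff X e * x e) + (\<Sum>i<n. pair_coeff X (i, n) * x (i, n))
      + pair_coeff X (n, n) * x (n, n)"
    unfolding split
    by (subst sum.union_disjoint, simp, simp, force simp: upper_pairs_def)
       (subst sum.union_disjoint, simp, simp, force simp: upper_pairs_def,
        simp add: sum.reindex inj_on_def)
  moreover have "trace_prod (Suc n) (sym_matrix x) X = trace_prod n (sym_matrix x) X +
      (\<Sum>i<n. sym_matrix x i n * X n i) + (\<Sum>i<n. sym_matrix x n i * X i n) + x (n, n) * X n n"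
    by (simp add: trace_prod_def sum.distrib sym_matrix_def)
  moreover have "(\<Sum>i<n. sym_matrix x i n * X n i) + (\<Sum>i<n. sym_matrix x n i * X i n)
      = (\<Sum>i<n. pair_coeff X (i, n) * x (i, n))"
    unfolding sum.distrib[symmetric]
    by (intro sum.cong) (auto simp: sym_matrix_def pair_coeff_def Suc.prems[of n] min_def max_def)
  ultimately show ?case using Suc by (simp add: pair_coeff_def)
qed (simp add: trace_prod_def upper_pairs_def)

lemma trace_prod_sym_matrix_elliptope:
  "X \<in> elliptope n \<Longrightarrow>
    trace_prod n (sym_matrix x) X = (\<Sum>e\<in>upper_pairs n. pair_coeff X e * x e)"
  by (rule trace_prod_sym_matrix) (auto simp: elliptope_def pos_semidef_def)

lemma pair_coeff_bound:
  "X \<in> elliptope n \<Longrightarrow> e \<in> upper_pairs n \<Longrightarrow> \<bar>pair_coeff X e\<bar> \<le> 2"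
  using elliptope_entry_bound[of X n "fst e" "snd e"]
  by (auto simp: upper_pairs_def pair_coeff_def abs_mult)

section \<open>The smoothed maximum\<close>

text \<open>The free energy (log-sum-exp) of a finite set of linear forms, each given by its
  coefficients.\<close>

definition lse :: "real \<Rightarrow> ('e \<Rightarrow> real) set \<Rightarrow> 'e set \<Rightarrow> ('e \<Rightarrow> real) \<Rightarrow> real" where
  "lse \<beta> C E x = ln (\<Sum>c\<in>C. exp (\<beta> * (\<Sum>e\<in>E. c e * x e))) / \<beta>"

lemma lse_upper:
  assumes "finite C" "c \<in> C" "\<beta> > 0"
  shows "(\<Sum>e\<in>E. c e * x e) \<le> lse \<beta> C E x"
proof -
  have "exp (\<beta> * (\<Sum>e\<in>E. c e * x e)) \<le> (\<Sum>c\<in>C. exp (\<beta> * (\<Sum>e\<in>E. c e * x e)))"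
    using assms by (intro member_le_sum) auto
  then have "\<beta> * (\<Sum>e\<in>E. c e * x e) \<le> ln (\<Sum>c\<in>C. exp (\<beta> * (\<Sum>e\<in>E. c e * x e)))"
    by (subst ln_ge_iff) (auto intro: less_le_trans[OF exp_gt_zero])
  then show ?thesis using assms(3) by (simp add: lse_def field_simps)
qed

lemma lse_le:
  assumes C: "finite C" "C \<noteq> {}" and "\<beta> > 0"
    and A: "\<And>c. c \<in> C \<Longrightarrow> (\<Sum>e\<in>E. c e * x e) \<le> A"
  shows "lse \<beta> C E x \<le> A + ln (card C) / \<beta>"
proof -
  have "(\<Sum>c\<in>C. exp (\<beta> * (\<Sum>e\<in>E. c e * x e))) \<le> (\<Sum>c\<in>C. exp (\<beta> * A))"
    using A assms(3) by (intro sum_mono) simp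
  then have "ln (\<Sum>c\<in>C. exp (\<beta> * (\<Sum>e\<in>E. c e * x e))) \<le> ln (real (card C) * exp (\<beta> * A))"
    using C by (intro ln_mono) (auto intro!: sum_pos)
  also have "\<dots> = ln (card C) + \<beta> * A"
    using C by (subst ln_mult) (auto simp: card_gt_0_iff)
  finally show ?thesis using assms(3) by (simp add: lse_def field_simps)
qed

text \<open>All other coordinates are frozen into positive weights. What is left, up to \<beta>, is
  the logarithm of the exponential moment of the single coefficient \<open>c e\<close> under these
  weights.\<close>

lemma lse_coordinate:
  assumes "finite E" "e \<in> E"
  shows "lse \<beta> C E (x(e := s)) =
    ln (\<Sum>c\<in>C. exp (\<beta> * (\<Sum>e'\<in>E - {e}. c e' * x e')) * exp (\<beta> * s * c e)) / \<beta>"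
proof -
  have "(\<Sum>e'\<in>E. c e' * (x(e := s)) e') = (\<Sum>e'\<in>E - {e}. c e' * x e') + c e * s" for c
    using assms by (subst sum.remove[of _ e]) auto
  then show ?thesis by (simp add: lse_def exp_add[symmetric] algebra_simps)
qed

text \<open>Changing one coordinate multiplies every summand by at most
  \<open>exp (\<beta> * (B * \<bar>s - t\<bar>))\<close>. The factor \<beta> cancels in the end, so
  that concentration does not deteriorate at low temperature.\<close>

lemma lse_Lipschitz:
  assumes C: "finite C" "C \<noteq> {}" and E: "finite E" "e \<in> E" and "\<beta> > 0"
    and b: "\<And>c. c \<in> C \<Longrightarrow> \<bar>c e\<bar> \<le> B"
  shows "\<bar>lse \<beta> C E (x(e := s)) - lse \<beta> C E (x(e := t))\<bar> \<le> B * \<bar>s - t\<bar>"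
proof -
  define p where "p c = exp (\<beta> * (\<Sum>e'\<in>E - {e}. c e' * x e'))" for c
  have pos: "(\<Sum>c\<in>C. p c * exp (\<beta> * s * c e)) > 0" for s
    using C by (intro sum_pos) (auto simp: p_def)
  have le: "lse \<beta> C E (x(e := s)) \<le> lse \<beta> C E (x(e := t)) + B * \<bar>s - t\<bar>" for s t
  proof -
    have "(\<Sum>c\<in>C. p c * exp (\<beta> * s * c e)) \<le>
        (\<Sum>c\<in>C. p c * exp (\<beta> * t * c e) * exp (\<beta> * (B * \<bar>s - t\<bar>)))"
    proof (intro sum_mono)
      fix c assume "c \<in> C"
      have "c e * (s - t) \<le> \<bar>c e\<bar> * \<bar>s - t\<bar>" by (simp flip: abs_mult)
      also have "\<dots> \<le> B * \<bar>s - t\<bar>" using b[OF \<open>c \<in> C\<close>] by (intro mult_right_mono) auto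
      finally have "\<beta> * (c e * (s - t)) \<le> \<beta> * (B * \<bar>s - t\<bar>)" using \<open>\<beta> > 0\<close> by simp
      then have "exp (\<beta> * s * c e) \<le> exp (\<beta> * t * c e) * exp (\<beta> * (B * \<bar>s - t\<bar>))"
        by (simp add: exp_add[symmetric] algebra_simps)
      then show "p c * exp (\<beta> * s * c e) \<le> p c * exp (\<beta> * t * c e) * exp (\<beta> * (B * \<bar>s - t\<bar>))"
        by (simp add: p_def mult.assoc)
    qed
    then have "ln (\<Sum>c\<in>C. p c * exp (\<beta> * s * c e)) \<le>
        ln ((\<Sum>c\<in>C. p c * exp (\<beta> * t * c e)) * exp (\<beta> * (B * \<bar>s - t\<bar>)))"
      using pos by (intro ln_mono) (auto simp: sum_distrib_right)
    also have "\<dots> = ln (\<Sum>c\<in>C. p c * exp (\<beta> * t * c e)) + \<beta> * (B * \<bar>s - t\<bar>)"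
      using pos[of t] by (subst ln_mult) auto
    finally show ?thesis using \<open>\<beta> > 0\<close>
      unfolding lse_coordinate[OF E] p_def[symmetric] by (simp add: field_simps)
  qed
  show ?thesis using le[of s t] le[of t s] by (simp add: abs_le_iff abs_minus_commute)
qed

text \<open>The derivatives are the cumulants of \<open>a\<close> under the tilted weights. The
  third one is at most \<open>6 * B ^ 3\<close> in size, and the 6 cancels against 3!. The
  coefficients \<open>A1\<close> and \<open>A2\<close> depend on the base point only, so two laws
  with the same mean share one expansion.\<close>

lemma log_partition_Taylor:
  fixes p a :: "'c \<Rightarrow> real"
  assumes C: "finite C" "C \<noteq> {}" and p: "\<And>c. c \<in> C \<Longrightarrow> p c > 0"
    and a: "\<And>c. c \<in> C \<Longrightarrow> \<bar>a c\<bar> \<le> B"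
  shows "\<exists>A1 A2. \<bar>A2\<bar> \<le> B\<^sup>2 \<and>
    (\<forall>h. \<bar>ln (\<Sum>c\<in>C. p c * exp ((u + h) * a c)) - ln (\<Sum>c\<in>C. p c * exp (u * a c))
      - A1 * h - A2 * h\<^sup>2\<bar> \<le> B ^ 3 * \<bar>h\<bar> ^ 3)"
proof -
  \<comment> \<open>Tilted moments before normalization: differentiation just raises the index
    \<open>j\<close>.\<close>
  define Z where "Z j s = (\<Sum>c\<in>C. p c * a c ^ j * exp (s * a c))" for j s
  have B0: "B \<ge> 0" using C a by (meson abs_ge_zero ex_in_conv order_trans)
  have Z0: "Z 0 s > 0" for s
    unfolding Z_def using C p by (intro sum_pos) auto
  have dZ [derivative_intros]: "(Z j has_real_derivative Z (Suc j) s) (at s)" for j s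
    unfolding Z_def by (auto intro!: derivative_eq_intros sum.cong simp: mult_ac)
  have bZ: "\<bar>Z j s\<bar> \<le> B ^ j * Z 0 s" for j s
  proof -
    have "\<bar>Z j s\<bar> \<le> (\<Sum>c\<in>C. \<bar>p c * a c ^ j * exp (s * a c)\<bar>)"
      unfolding Z_def by (rule sum_abs)
    also have "\<dots> \<le> (\<Sum>c\<in>C. B ^ j * (p c * a c ^ 0 * exp (s * a c)))"
    proof (intro sum_mono)
      fix c assume c: "c \<in> C"
      have "\<bar>a c\<bar> ^ j \<le> B ^ j" using a[OF c] by (intro power_mono) auto
      then have "\<bar>a c\<bar> ^ j * (p c * exp (s * a c)) \<le> B ^ j * (p c * exp (s * a c))"
        using p[OF c] by (intro mult_right_mono) auto
      then show "\<bar>p c * a c ^ j * exp (s * a c)\<bar> \<le> B ^ j * (p c * a c ^ 0 * exp (s * a c))"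
        using p[OF c] by (simp add: abs_mult power_abs mult_ac)
    qed
    finally show ?thesis by (simp add: Z_def sum_distrib_left)
  qed
  define r where "r j s = Z j s / Z 0 s" for j s
  have r: "\<bar>r j s\<bar> \<le> B ^ j" for j s
    using bZ[of j s] Z0[of s] by (simp add: r_def field_simps)
  have dr: "(r j has_real_derivative r (Suc j) s - r j s * r 1 s) (at s)" for j s
    unfolding r_def using Z0[of s]
    by (auto intro!: derivative_eq_intros simp: field_simps)
  \<comment> \<open>The logarithm and its first three cumulants, written in normalized moments; the
    last branch stands for index 3, the order of the remainder.\<close>
  define diff where "diff m s = (if m = 0 then ln (Z 0 s) else if m = 1 then r 1 s
      else if m = 2 then r 2 s - (r 1 s)\<^sup>2 else r 3 s - 3 * r 1 s * r 2 s + 2 * r 1 s ^ 3)" for m :: nat and s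
  have deriv: "(diff m has_real_derivative diff (Suc m) t) (at t)" if m3: "m < 3" for m t
  proof -
    consider "m = 0" | "m = 1" | "m = 2" using m3 by linarith
    then show ?thesis
    proof cases
      case 1
      have "((\<lambda>s. ln (Z 0 s)) has_real_derivative r 1 t) (at t)"
        using Z0[of t] by (auto intro!: derivative_eq_intros simp: r_def)
      then show ?thesis using 1 by (simp add: diff_def[abs_def])
    next
      case 2
      have "(r 1 has_real_derivative r 2 t - (r 1 t)\<^sup>2) (at t)"
        using dr[of 1 t] by (simp add: power2_eq_square numeral_2_eq_2)
      then show ?thesis using 2 by (simp add: diff_def[abs_def])
    next
      case 3
      have "((\<lambda>s. r 2 s - (r 1 s)\<^sup>2) has_real_derivative
          r 3 t - 3 * r 1 t * r 2 t + 2 * r 1 t ^ 3) (at t)"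
        by (rule derivative_eq_intros dr refl)+
           (simp add: algebra_simps power2_eq_square power3_eq_cube numeral_2_eq_2 numeral_3_eq_3)
      then show ?thesis using 3 by (simp add: diff_def[abs_def])
    qed
  qed
  have b2: "\<bar>diff 2 s\<bar> \<le> 2 * B\<^sup>2" for s
  proof -
    have "\<bar>r 1 s\<bar>\<^sup>2 \<le> B\<^sup>2" using r[of 1 s] by (intro power_mono) auto
    then have "(r 1 s)\<^sup>2 \<le> B\<^sup>2" by simp
    then show ?thesis
      using r[of 2 s] abs_triangle_ineq4[of "r 2 s" "(r 1 s)\<^sup>2"] by (simp add: diff_def)
  qed
  have b3: "\<bar>diff 3 s\<bar> \<le> 6 * B ^ 3" for s
  proof -
    have "\<bar>r 1 s\<bar> ^ 3 \<le> B ^ 3" using r[of 1 s] by (intro power_mono) auto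
    moreover have "\<bar>r 1 s\<bar> * \<bar>r 2 s\<bar> \<le> B ^ 1 * B ^ 2" using r[of 1 s] r[of 2 s] B0 by (intro mult_mono) auto
    then have "\<bar>r 1 s * r 2 s\<bar> \<le> B ^ 3" by (simp add: abs_mult eval_nat_numeral)
    moreover have "\<bar>x - 3 * y + 2 * z\<bar> \<le> 6 * K" if "\<bar>x\<bar> \<le> K" "\<bar>y\<bar> \<le> K" "\<bar>z\<bar> \<le> K" for x y z K :: real
      using that by linarith
    ultimately show ?thesis using r[of 3 s]
      by (simp add: diff_def mult.assoc power_abs del: One_nat_def)
  qed
  show ?thesis
  proof (intro exI conjI allI)
    show "\<bar>diff 2 u / 2\<bar> \<le> B\<^sup>2" using b2[of u] by simp
    fix h
    show "\<bar>ln (\<Sum>c\<in>C. p c * exp ((u + h) * a c)) - ln (\<Sum>c\<in>C. p c * exp (u * a c))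
      - diff 1 u * h - diff 2 u / 2 * h\<^sup>2\<bar> \<le> B ^ 3 * \<bar>h\<bar> ^ 3"
    proof (cases "h = 0")
      case False
      have "\<exists>t. (if u + h < u then u + h < t \<and> t < u else u < t \<and> t < u + h) \<and>
         ln (Z 0 (u + h)) = (\<Sum>m<3. diff m u / fact m * (u + h - u) ^ m) +
           diff 3 t / fact 3 * (u + h - u) ^ 3"
        by (rule Taylor[of 3 diff "\<lambda>s. ln (Z 0 s)" "min u (u + h)" "max u (u + h)" u "u + h"])
           (use False deriv in \<open>auto simp: diff_def\<close>)
      then obtain t where t: "ln (Z 0 (u + h)) = (\<Sum>m<3. diff m u / fact m * h ^ m) + diff 3 t / fact 3 * h ^ 3"
        by auto
      have "(\<Sum>m<3. diff m u / fact m * h ^ m) = ln (Z 0 u) + diff 1 u * h + diff 2 u / 2 * h\<^sup>2"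
        by (simp add: eval_nat_numeral) (simp add: diff_def)
      with t have "ln (Z 0 (u + h)) - ln (Z 0 u) - diff 1 u * h - diff 2 u / 2 * h\<^sup>2 = diff 3 t / 6 * h ^ 3"
        by (simp add: fact_numeral)
      moreover have "\<bar>diff 3 t / 6 * h ^ 3\<bar> \<le> B ^ 3 * \<bar>h\<bar> ^ 3"
        using mult_right_mono[OF b3[of t], of "\<bar>h\<bar> ^ 3"] by (simp add: abs_mult power_abs)
      ultimately have "\<bar>ln (Z 0 (u + h)) - ln (Z 0 u) - diff 1 u * h - diff 2 u / 2 * h\<^sup>2\<bar> \<le> B ^ 3 * \<bar>h\<bar> ^ 3"
        by (simp only:)
      then show ?thesis by (simp add: Z_def)
    qed (use B0 in simp)
  qed
qed

text \<open>A rescaling of \<open>log_partition_Taylor\<close>: the coordinate is multiplied by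
  \<beta> inside and the result divided by \<beta>. Hence the second-order coefficient gains one
  factor \<beta> and the remainder two.\<close>

lemma lse_Taylor:
  assumes C: "finite C" "C \<noteq> {}" and E: "finite E" "e \<in> E" and \<beta>: "\<beta> > 0"
    and b: "\<And>c. c \<in> C \<Longrightarrow> \<bar>c e\<bar> \<le> B"
  shows "\<exists>A1 A2. \<bar>A2\<bar> \<le> \<beta> * B\<^sup>2 \<and>
    (\<forall>h. \<bar>lse \<beta> C E (x(e := m + h)) - lse \<beta> C E (x(e := m)) - A1 * h - A2 * h\<^sup>2\<bar>
       \<le> \<beta>\<^sup>2 * B ^ 3 * \<bar>h\<bar> ^ 3)"
proof -
  define p where "p c = exp (\<beta> * (\<Sum>e'\<in>E - {e}. c e' * x e'))" for c
  define L where "L s = ln (\<Sum>c\<in>C. p c * exp (s * c e))" for s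
  obtain A1 A2 where A2: "\<bar>A2\<bar> \<le> B\<^sup>2"
    and A: "\<And>h. \<bar>L (\<beta> * m + h) - L (\<beta> * m) - A1 * h - A2 * h\<^sup>2\<bar> \<le> B ^ 3 * \<bar>h\<bar> ^ 3"
    using log_partition_Taylor[OF C, of p "\<lambda>c. c e" B "\<beta> * m"] b
    unfolding L_def p_def by auto
  show ?thesis
  proof (intro exI conjI allI)
    show "\<bar>\<beta> * A2\<bar> \<le> \<beta> * B\<^sup>2" using A2 \<beta> by (simp add: abs_mult)
    fix h
    define R where "R = L (\<beta> * (m + h)) - L (\<beta> * m) - A1 * (\<beta> * h) - A2 * (\<beta> * h)\<^sup>2"
    have "\<bar>R\<bar> \<le> B ^ 3 * \<bar>\<beta> * h\<bar> ^ 3"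
      using A[of "\<beta> * h"] by (simp add: R_def distrib_left)
    also have "\<dots> = (\<beta>\<^sup>2 * B ^ 3 * \<bar>h\<bar> ^ 3) * \<beta>"
      using \<beta> by (simp add: abs_mult power_mult_distrib eval_nat_numeral)
    finally have "\<bar>R / \<beta>\<bar> \<le> \<beta>\<^sup>2 * B ^ 3 * \<bar>h\<bar> ^ 3"
      using \<beta> by (simp add: field_simps)
    moreover have "R / \<beta> = L (\<beta> * (m + h)) / \<beta> - L (\<beta> * m) / \<beta> - A1 * h - \<beta> * A2 * h\<^sup>2"
      using \<beta> by (simp add: R_def field_simps power2_eq_square)
    moreover have "lse \<beta> C E (x(e := s)) = L (\<beta> * s) / \<beta>" for s
      unfolding lse_coordinate[OF E] by (simp add: L_def p_def)
    ultimately show "\<bar>lse \<beta> C E (x(e := m + h)) - lse \<beta> C E (x(e := m)) - A1 * h - \<beta> * A2 * h\<^sup>2\<bar>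
       \<le> \<beta>\<^sup>2 * B ^ 3 * \<bar>h\<bar> ^ 3" by simp
  qed
qed

section \<open>Functions of independent real random variables\<close>

lemma ennreal_integral_le_nn_integral:
  fixes f :: "'a \<Rightarrow> real"
  assumes f: "integrable M f"
  shows "ennreal (\<integral>x. f x \<partial>M) \<le> (\<integral>\<^sup>+x. ennreal (f x) \<partial>M)"
proof -
  have "ennreal (\<integral>x. f x \<partial>M) \<le> ennreal (\<integral>x. max 0 (f x) \<partial>M)"
    using f by (intro ennreal_leI integral_mono) auto
  also have "\<dots> = (\<integral>\<^sup>+x. ennreal (max 0 (f x)) \<partial>M)"
    using f by (intro nn_integral_eq_integral[symmetric]) auto
  also have "\<dots> = (\<integral>\<^sup>+x. ennreal (f x) \<partial>M)"
    by (intro nn_integral_cong) (simp add: max_def ennreal_neg)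
  finally show ?thesis .
qed

text \<open>Jensen's inequality from the tangent of exp at the mean. The right-hand side may be
  infinite, so integrability of the exponential is no issue.\<close>

lemma (in prob_space) exp_integral_le:
  assumes f: "integrable M f"
  shows "ennreal (exp (\<integral>x. f x \<partial>M)) \<le> (\<integral>\<^sup>+x. ennreal (exp (f x)) \<partial>M)"
proof -
  define e where "e = (\<integral>x. f x \<partial>M)"
  have "ennreal (exp e) = ennreal (\<integral>x. exp e * (1 + (f x - e)) \<partial>M)"
    using f by (simp add: e_def prob_space)
  also have "\<dots> \<le> (\<integral>\<^sup>+x. ennreal (exp e * (1 + (f x - e))) \<partial>M)"
    using f by (intro ennreal_integral_le_nn_integral) auto
  also have "\<dots> \<le> (\<integral>\<^sup>+x. ennreal (exp (f x)) \<partial>M)"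
  proof (intro nn_integral_mono ennreal_leI)
    fix x
    have "exp e * (1 + (f x - e)) \<le> exp e * exp (f x - e)"
      by (intro mult_left_mono exp_ge_add_one_self) auto
    then show "exp e * (1 + (f x - e)) \<le> exp (f x)" by (simp flip: exp_add)
  qed
  finally show ?thesis by (simp add: e_def)
qed

definition real_Lipschitz :: "real \<Rightarrow> (real \<Rightarrow> real) \<Rightarrow> bool" where
  "real_Lipschitz L g \<longleftrightarrow> (\<forall>s t. \<bar>g s - g t\<bar> \<le> L * \<bar>s - t\<bar>)"

lemma real_Lipschitz_measurable:
  assumes "real_Lipschitz L g"
  shows "g \<in> borel_measurable borel"
proof -
  have "(\<bar>L\<bar>)-lipschitz_on UNIV g"
  proof (rule lipschitz_onI)
    fix s t show "dist (g s) (g t) \<le> \<bar>L\<bar> * dist s t"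
      using assms abs_ge_self[of L] mult_right_mono[of L "\<bar>L\<bar>" "\<bar>s - t\<bar>"]
      unfolding real_Lipschitz_def dist_real_def by (meson abs_ge_zero order_trans)
  qed simp
  then show ?thesis
    by (intro borel_measurable_continuous_onI lipschitz_on_continuous_on)
qed

text \<open>The restriction to arguments of size at most 1 matters: a graph entry jumps by
  \<open>1 / sqrt d\<close> with probability of order \<open>d / n\<close>, so with \<open>v\<close>
  of order \<open>1 / n\<close> the bound cannot hold for all \<open>t\<close> when \<open>n\<close>
  is large.\<close>

definition subexponential_law :: "real measure \<Rightarrow> real \<Rightarrow> real \<Rightarrow> bool" where
  "subexponential_law M m v \<longleftrightarrow>
     (\<forall>t. \<bar>t\<bar> \<le> 1 \<longrightarrow> (\<integral>\<^sup>+x. ennreal (exp (t * (x - m))) \<partial>M) \<le> ennreal (exp (v * t\<^sup>2)))"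

locale real_law = prob_space M for M :: "real measure" +
  assumes sets_eq_borel [measurable_cong, simp]: "sets M = sets borel"
    and integrable_id [simp]: "integrable M (\<lambda>x. x)"
begin

lemma space_eq_UNIV [simp]: "space M = UNIV"
  using sets_eq_imp_space_eq[OF sets_eq_borel] by simp

lemma prob_UNIV [simp]: "prob UNIV = 1"
  using prob_space by simp

lemma real_Lipschitz_integrable:
  assumes g: "real_Lipschitz L g"
  shows "integrable M g"
proof (rule Bochner_Integration.integrable_bound)
  show "integrable M (\<lambda>x. \<bar>g 0\<bar> + L * \<bar>x\<bar>)" by auto
  show "g \<in> borel_measurable M" using real_Lipschitz_measurable[OF g] by simp
  show "AE x in M. norm (g x) \<le> norm (\<bar>g 0\<bar> + L * \<bar>x\<bar>)"
  proof (intro AE_I2)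
    fix x
    have "\<bar>g x - g 0\<bar> \<le> L * \<bar>x - 0\<bar>" using g unfolding real_Lipschitz_def by blast
    then show "norm (g x) \<le> norm (\<bar>g 0\<bar> + L * \<bar>x\<bar>)" by simp
  qed
qed

(* Jensen replaces the mean by an independent copy of x; symmetrizing turns the exponential into
   cosh, which is monotone in the absolute value, so that g may be replaced by L times the identity. *)
lemma real_Lipschitz_mgf:
  assumes g: "real_Lipschitz L g" and v: "subexponential_law M m v" and \<theta>: "\<bar>\<theta> * L\<bar> \<le> 1"
  shows "(\<integral>\<^sup>+x. ennreal (exp (\<theta> * (g x - (\<integral>y. g y \<partial>M)))) \<partial>M) \<le> ennreal (exp (2 * v * (\<theta> * L)\<^sup>2))"
proof -
  interpret pair_sigma_finite M M ..
  have [measurable]: "g \<in> borel_measurable borel" by (rule real_Lipschitz_measurable[OF g])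
  have int: "integrable M g" by (rule real_Lipschitz_integrable[OF g])
  define e where "e = (\<integral>y. g y \<partial>M)"
  define I where "I = (\<integral>\<^sup>+x. \<integral>\<^sup>+y. ennreal (exp (\<theta> * (g x - g y))) \<partial>M \<partial>M)"
  define J where "J = (\<integral>\<^sup>+x. \<integral>\<^sup>+y. ennreal (exp (\<theta> * L * (x - y))) \<partial>M \<partial>M)"
  have "(\<integral>\<^sup>+x. ennreal (exp (\<theta> * (g x - e))) \<partial>M) \<le> I"
    unfolding I_def
  proof (intro nn_integral_mono)
    fix x
    have A: "(\<integral>y. \<theta> * (g x - g y) \<partial>M) = \<theta> * (g x - e)"
      using int by (simp add: e_def prob_space)
    show "ennreal (exp (\<theta> * (g x - e))) \<le> (\<integral>\<^sup>+y. ennreal (exp (\<theta> * (g x - g y))) \<partial>M)"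
      using exp_integral_le[of "\<lambda>y. \<theta> * (g x - g y)", unfolded A] int by simp
  qed
  moreover have "I + I \<le> J + J"
  proof -
    have I': "I = (\<integral>\<^sup>+x. \<integral>\<^sup>+y. ennreal (exp (- (\<theta> * (g x - g y)))) \<partial>M \<partial>M)"
    proof -
      have "I = (\<integral>\<^sup>+y. \<integral>\<^sup>+x. ennreal (exp (\<theta> * (g x - g y))) \<partial>M \<partial>M)"
        unfolding I_def
        by (rule Fubini'[of "\<lambda>x y. ennreal (exp (\<theta> * (g x - g y)))", simplified, symmetric]) measurable
      then show ?thesis by (simp add: algebra_simps)
    qed
    have J': "J = (\<integral>\<^sup>+x. \<integral>\<^sup>+y. ennreal (exp (- (\<theta> * L * (x - y)))) \<partial>M \<partial>M)"
    proof -
      have "J = (\<integral>\<^sup>+y. \<integral>\<^sup>+x. ennreal (exp (\<theta> * L * (x - y))) \<partial>M \<partial>M)"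
        unfolding J_def
        by (rule Fubini'[of "\<lambda>x y. ennreal (exp (\<theta> * L * (x - y)))", simplified, symmetric]) measurable
      then show ?thesis by (simp add: algebra_simps)
    qed
    have "I + I = (\<integral>\<^sup>+x. \<integral>\<^sup>+y. ennreal (exp (\<theta> * (g x - g y)) + exp (- (\<theta> * (g x - g y)))) \<partial>M \<partial>M)"
      by (subst (2) I', unfold I_def) (simp add: nn_integral_add)
    also have "\<dots> \<le> (\<integral>\<^sup>+x. \<integral>\<^sup>+y. ennreal (exp (\<theta> * L * (x - y)) + exp (- (\<theta> * L * (x - y)))) \<partial>M \<partial>M)"
    proof (intro nn_integral_mono ennreal_leI)
      fix x y
      have "\<bar>g x - g y\<bar> \<le> L * \<bar>x - y\<bar>" using g unfolding real_Lipschitz_def by blast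
      then have "\<bar>\<theta>\<bar> * \<bar>g x - g y\<bar> \<le> \<bar>\<theta>\<bar> * (\<bar>L\<bar> * \<bar>x - y\<bar>)"
        using abs_ge_self[of L] mult_right_mono[of L "\<bar>L\<bar>" "\<bar>x - y\<bar>"] by (intro mult_left_mono) auto
      then have "cosh \<bar>\<theta> * (g x - g y)\<bar> \<le> cosh \<bar>\<theta> * L * (x - y)\<bar>"
        by (subst cosh_real_nonneg_le_iff) (auto simp: abs_mult mult_ac)
      then have "cosh (\<theta> * (g x - g y)) \<le> cosh (\<theta> * L * (x - y))"
        by (simp only: cosh_real_abs)
      then show "exp (\<theta> * (g x - g y)) + exp (- (\<theta> * (g x - g y))) \<le>
          exp (\<theta> * L * (x - y)) + exp (- (\<theta> * L * (x - y)))"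
        by (simp add: cosh_field_def)
    qed
    also have "\<dots> = J + J"
      by (subst (2) J', unfold J_def) (simp add: nn_integral_add)
    finally show ?thesis .
  qed
  then have "2 * I \<le> 2 * J" by (simp only: mult_2)
  then have "I \<le> J" by (subst (asm) ennreal_mult_le_mult_iff) auto
  moreover have "J \<le> ennreal (exp (2 * v * (\<theta> * L)\<^sup>2))"
  proof -
    \<comment> \<open>The double integral factors over the two independent copies. Each contributes
      \<open>v\<close>, whence the 2 in the exponent.\<close>
    have "J = (\<integral>\<^sup>+x. \<integral>\<^sup>+y. ennreal (exp (\<theta> * L * (x - m))) * ennreal (exp (- (\<theta> * L) * (y - m))) \<partial>M \<partial>M)"
      unfolding J_def
      by (intro nn_integral_cong) (simp add: ennreal_mult[symmetric] exp_add[symmetric] algebra_simps)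
    also have "\<dots> = (\<integral>\<^sup>+x. ennreal (exp (\<theta> * L * (x - m))) \<partial>M) * (\<integral>\<^sup>+y. ennreal (exp (- (\<theta> * L) * (y - m))) \<partial>M)"
      by (simp add: nn_integral_cmult nn_integral_multc)
    also have "\<dots> \<le> ennreal (exp (v * (\<theta> * L)\<^sup>2)) * ennreal (exp (v * (- (\<theta> * L))\<^sup>2))"
      using v[unfolded subexponential_law_def, rule_format, of "\<theta> * L"]
        v[unfolded subexponential_law_def, rule_format, of "- (\<theta> * L)"] \<theta>
      by (intro mult_mono) (simp_all del: mult_minus_left)
    also have "\<dots> = ennreal (exp (2 * v * (\<theta> * L)\<^sup>2))"
      by (simp add: ennreal_mult[symmetric] exp_add[symmetric])
    finally show ?thesis .
  qed
  ultimately show ?thesis unfolding e_def by order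
qed

end

section \<open>Functions that are Lipschitz in each of several independent coordinates\<close>

definition coord_Lipschitz :: "real \<Rightarrow> 'e set \<Rightarrow> (('e \<Rightarrow> real) \<Rightarrow> real) \<Rightarrow> bool" where
  "coord_Lipschitz L E f \<longleftrightarrow> (\<forall>e\<in>E. \<forall>x. real_Lipschitz L (\<lambda>t. f (x(e := t))))"

text \<open>Coordinates are moved away from 0 one at a time. The linear growth makes such functions
  integrable under every product of laws with a first moment.\<close>

lemma coord_Lipschitz_growth:
  assumes E: "finite E" and f: "coord_Lipschitz L E f" and x: "x \<in> extensional E"
  shows "\<bar>f x\<bar> \<le> \<bar>f (\<lambda>e\<in>E. 0)\<bar> + L * (\<Sum>e\<in>E. \<bar>x e\<bar>)"
proof -
  have "\<bar>f (\<lambda>e\<in>E. if e \<in> A then x e else 0)\<bar> \<le> \<bar>f (\<lambda>e\<in>E. 0)\<bar> + L * (\<Sum>e\<in>A. \<bar>x e\<bar>)"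
    if "finite A" "A \<subseteq> E" for A
    using that
  proof (induction A)
    case (insert a A)
    define y where "y = (\<lambda>e\<in>E. if e \<in> A then x e else 0)"
    have eq: "(\<lambda>e\<in>E. if e \<in> insert a A then x e else 0) = y(a := x a)" "y = y(a := 0)"
      using insert by (auto simp: y_def)
    have "\<bar>f (y(a := x a)) - f (y(a := 0))\<bar> \<le> L * \<bar>x a - 0\<bar>"
      using f insert.prems unfolding coord_Lipschitz_def real_Lipschitz_def by blast
    then have "\<bar>f (y(a := x a))\<bar> \<le> \<bar>f y\<bar> + L * \<bar>x a\<bar>" using eq(2) by simp
    also have "\<bar>f y\<bar> \<le> \<bar>f (\<lambda>e\<in>E. 0)\<bar> + L * (\<Sum>e\<in>A. \<bar>x e\<bar>)"
      unfolding y_def using insert by blast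
    finally have "\<bar>f (y(a := x a))\<bar> \<le> \<bar>f (\<lambda>e\<in>E. 0)\<bar> + L * (\<Sum>e\<in>insert a A. \<bar>x e\<bar>)"
      using insert.hyps by (simp add: distrib_left)
    then show ?case by (simp only: eq(1))
  qed simp
  note * = this[OF E subset_refl]
  have "(\<lambda>e\<in>E. if e \<in> E then x e else 0) = x"
    using x by (auto simp: restrict_def extensional_def)
  with * show ?thesis by (simp only:)
qed

locale real_laws =
  fixes M :: "'e \<Rightarrow> real measure"
  assumes real_law: "\<And>e. real_law (M e)"
begin

sublocale law: real_law "M e" for e by (rule real_law)

sublocale product_sigma_finite M ..

lemma prob_space_PiM_real: "prob_space (PiM E M)"
  by (rule prob_space_PiM) (rule law.prob_space_axioms)

lemma space_PiM_real [simp]: "space (PiM E M) = extensional E"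
  by (simp add: space_PiM PiE_def)

lemma sets_PiM_real [measurable_cong]: "sets (PiM E M) = sets (PiM E (\<lambda>_. borel))"
  by (intro sets_PiM_cong) auto

lemma coord_Lipschitz_integrable:
  assumes E: "finite E" and f: "coord_Lipschitz L E f" and m: "f \<in> borel_measurable (PiM E M)"
  shows "integrable (PiM E M) f"
proof (rule Bochner_Integration.integrable_bound[OF _ m])
  interpret P: prob_space "PiM E M" by (rule prob_space_PiM_real)
  have "integrable (PiM E M) (\<lambda>x. x e)" if "e \<in> E" for e
  proof -
    have "distr (PiM E M) (M e) (\<lambda>x. x e) = M e"
      by (rule distr_PiM_component) (use that law.prob_space_axioms in auto)
    then have "integrable (distr (PiM E M) (M e) (\<lambda>x. x e)) (\<lambda>x. x)" by simp
    then show ?thesis using that by (subst (asm) integrable_distr_eq) auto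
  qed
  then show "integrable (PiM E M) (\<lambda>x. \<bar>f (\<lambda>e\<in>E. 0)\<bar> + L * (\<Sum>e\<in>E. \<bar>x e\<bar>))"
    by auto
  show "AE x in PiM E M. norm (f x) \<le> norm (\<bar>f (\<lambda>e\<in>E. 0)\<bar> + L * (\<Sum>e\<in>E. \<bar>x e\<bar>))"
    using coord_Lipschitz_growth[OF E f] by (intro AE_I2) fastforce
qed

lemma prob_extensional [simp]: "measure (PiM E M) (extensional E) = 1"
  using prob_space.prob_space[OF prob_space_PiM_real[of E]] by simp

lemma partial_integral_measurable [measurable]:
  fixes f :: "_ \<Rightarrow> real"
  assumes "e \<notin> E" and m: "f \<in> borel_measurable (PiM (insert e E) M)"
  shows "(\<lambda>x. \<integral>t. f (x(e := t)) \<partial>M e) \<in> borel_measurable (PiM E M)"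
proof -
  have "(\<lambda>(x, t). x(e := t)) \<in> measurable (PiM E M \<Otimes>\<^sub>M M e) (PiM (insert e E) M)"
    by (rule measurable_add_dim)
  from measurable_compose[OF this m]
  have *: "case_prod (\<lambda>x t. f (x(e := t))) \<in> borel_measurable (PiM E M \<Otimes>\<^sub>M M e)"
    by (simp add: case_prod_unfold)
  show ?thesis
    by (rule sigma_finite_measure.borel_measurable_lebesgue_integral[OF law.sigma_finite_measure_axioms *])
qed

text \<open>Keeps the hypothesis of the concentration induction intact when one coordinate is
  integrated out.\<close>

lemma partial_integral_Lipschitz:
  assumes "e \<notin> E" and f: "coord_Lipschitz L (insert e E) f"
  shows "coord_Lipschitz L E (\<lambda>x. \<integral>t. f (x(e := t)) \<partial>M e)"
  unfolding coord_Lipschitz_def real_Lipschitz_def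
proof (intro ballI allI)
  fix a x s t assume a: "a \<in> E"
  then have ne: "a \<noteq> e" using assms(1) by auto
  have i: "integrable (M e) (\<lambda>u. f (x(e := u)))" for x
    by (rule law.real_Lipschitz_integrable[of L]) (use f in \<open>auto simp: coord_Lipschitz_def\<close>)
  have "\<bar>(\<integral>u. f (x(a := s, e := u)) \<partial>M e) - (\<integral>u. f (x(a := t, e := u)) \<partial>M e)\<bar> =
      \<bar>\<integral>u. f (x(a := s, e := u)) - f (x(a := t, e := u)) \<partial>M e\<bar>"
    by (subst Bochner_Integration.integral_diff) (auto intro: i)
  also have "\<dots> \<le> (\<integral>u. \<bar>f (x(a := s, e := u)) - f (x(a := t, e := u))\<bar> \<partial>M e)"
    by (rule integral_abs_bound)
  also have "\<dots> \<le> (\<integral>u. L * \<bar>s - t\<bar> \<partial>M e)"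
  proof (intro integral_mono)
    show "integrable (M e) (\<lambda>u. \<bar>f (x(a := s, e := u)) - f (x(a := t, e := u))\<bar>)"
      by (intro integrable_abs Bochner_Integration.integrable_diff i)
    fix u
    have "real_Lipschitz L (\<lambda>s. f ((x(e := u))(a := s)))"
      using f a unfolding coord_Lipschitz_def by blast
    then show "\<bar>f (x(a := s, e := u)) - f (x(a := t, e := u))\<bar> \<le> L * \<bar>s - t\<bar>"
      unfolding real_Lipschitz_def fun_upd_twist[OF ne] by blast
  qed auto
  finally show "\<bar>(\<integral>u. f (x(a := s, e := u)) \<partial>M e) - (\<integral>u. f (x(a := t, e := u)) \<partial>M e)\<bar> \<le> L * \<bar>s - t\<bar>"
    by simp
qed

text \<open>The martingale argument as an induction on \<open>E\<close>. With the coordinates in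
  \<open>E\<close> fixed, \<open>f\<close> is a Lipschitz function of the new coordinate with mean
  \<open>g x\<close>, which costs one factor \<open>exp c\<close> uniformly in \<open>x\<close>; the
  induction hypothesis deals with \<open>g\<close>.\<close>

lemma concentration_mgf:
  fixes L v \<theta> :: real
  assumes "finite E" "f \<in> borel_measurable (PiM E M)" "coord_Lipschitz L E f"
    and v: "\<And>e. e \<in> E \<Longrightarrow> subexponential_law (M e) (m e) v" and \<theta>: "\<bar>\<theta> * L\<bar> \<le> 1"
  shows "(\<integral>\<^sup>+x. ennreal (exp (\<theta> * (f x - (\<integral>y. f y \<partial>PiM E M)))) \<partial>PiM E M)
     \<le> ennreal (exp (card E * (2 * v * (\<theta> * L)\<^sup>2)))"
  using assms(1-4)
proof (induction E arbitrary: f)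
  case empty
  then show ?case by (simp add: PiM_empty lebesgue_integral_count_space_finite nn_integral_count_space_finite)
next
  case (insert e E)
  define g where "g x = (\<integral>t. f (x(e := t)) \<partial>M e)" for x
  define c where "c = 2 * v * (\<theta> * L)\<^sup>2"
  have Lip: "real_Lipschitz L (\<lambda>t. f (x(e := t)))" for x
    using insert.prems(2) unfolding coord_Lipschitz_def by blast
  have [measurable]: "f \<in> borel_measurable (PiM (insert e E) M)" by fact
  have gm [measurable]: "g \<in> borel_measurable (PiM E M)"
    unfolding g_def using insert.hyps(2) insert.prems(1) by (rule partial_integral_measurable)
  have gL: "coord_Lipschitz L E g"
    unfolding g_def using insert.hyps(2) insert.prems(2) by (rule partial_integral_Lipschitz)
  have eq: "(\<integral>y. f y \<partial>PiM (insert e E) M) = (\<integral>y. g y \<partial>PiM E M)"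
    unfolding g_def using insert.hyps insert.prems
    by (intro product_integral_insert coord_Lipschitz_integrable) auto
  define r where "r = (\<integral>y. g y \<partial>PiM E M)"
  have "(\<integral>\<^sup>+x. ennreal (exp (\<theta> * (f x - r))) \<partial>PiM (insert e E) M) =
      (\<integral>\<^sup>+x. \<integral>\<^sup>+t. ennreal (exp (\<theta> * (f (x(e := t)) - r))) \<partial>M e \<partial>PiM E M)"
    using insert.hyps by (subst product_nn_integral_insert) auto
  also have "\<dots> = (\<integral>\<^sup>+x. ennreal (exp (\<theta> * (g x - r))) *
      (\<integral>\<^sup>+t. ennreal (exp (\<theta> * (f (x(e := t)) - g x))) \<partial>M e) \<partial>PiM E M)"
  proof (intro nn_integral_cong)
    fix x
    have "(\<lambda>t. f (x(e := t))) \<in> borel_measurable borel"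
      by (rule real_Lipschitz_measurable[OF Lip])
    then have "(\<lambda>t. f (x(e := t))) \<in> borel_measurable (M e)" by simp
    then have "ennreal (exp (\<theta> * (g x - r))) * (\<integral>\<^sup>+t. ennreal (exp (\<theta> * (f (x(e := t)) - g x))) \<partial>M e)
       = (\<integral>\<^sup>+t. ennreal (exp (\<theta> * (g x - r))) * ennreal (exp (\<theta> * (f (x(e := t)) - g x))) \<partial>M e)"
      by (subst nn_integral_cmult) auto
    also have "\<dots> = (\<integral>\<^sup>+t. ennreal (exp (\<theta> * (f (x(e := t)) - r))) \<partial>M e)"
      by (intro nn_integral_cong) (simp add: ennreal_mult[symmetric] exp_add[symmetric] algebra_simps)
    finally show "(\<integral>\<^sup>+t. ennreal (exp (\<theta> * (f (x(e := t)) - r))) \<partial>M e) =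
      ennreal (exp (\<theta> * (g x - r))) * (\<integral>\<^sup>+t. ennreal (exp (\<theta> * (f (x(e := t)) - g x))) \<partial>M e)" ..
  qed
  also have "\<dots> \<le> (\<integral>\<^sup>+x. ennreal (exp (\<theta> * (g x - r))) * ennreal (exp c) \<partial>PiM E M)"
    unfolding c_def g_def using insert.prems
    by (intro nn_integral_mono mult_left_mono law.real_Lipschitz_mgf[OF Lip _ \<theta>, of _ "m e"]) auto
  also have "\<dots> = (\<integral>\<^sup>+x. ennreal (exp (\<theta> * (g x - r))) \<partial>PiM E M) * ennreal (exp c)"
    by (subst nn_integral_multc) auto
  also have "\<dots> \<le> ennreal (exp (card E * c)) * ennreal (exp c)"
    unfolding c_def r_def using insert.IH[OF gm gL] insert.prems
    by (intro mult_right_mono) auto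
  also have "\<dots> = ennreal (exp (card (insert e E) * c))"
    using insert.hyps by (simp add: ennreal_mult[symmetric] exp_add[symmetric] algebra_simps)
  finally show ?case unfolding eq r_def c_def .
qed

text \<open>Markov's inequality for the exponential. The parameter \<theta> stays free because the
  constraint on \<open>\<theta> * L\<close> rules out the optimal value for large
  deviations.\<close>

lemma concentration_upper:
  fixes L v \<theta> a :: real
  assumes E: "finite E" and [measurable]: "f \<in> borel_measurable (PiM E M)"
    and f: "coord_Lipschitz L E f"
    and v: "\<And>e. e \<in> E \<Longrightarrow> subexponential_law (M e) (m e) v" and \<theta>: "0 \<le> \<theta>" "\<bar>\<theta> * L\<bar> \<le> 1"
  shows "measure (PiM E M) {x \<in> extensional E. a \<le> f x - (\<integral>y. f y \<partial>PiM E M)}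
     \<le> exp (card E * (2 * v * (\<theta> * L)\<^sup>2) - \<theta> * a)"
proof -
  interpret P: prob_space "PiM E M" by (rule prob_space_PiM_real)
  define r where "r = (\<integral>y. f y \<partial>PiM E M)"
  have "emeasure (PiM E M) {x \<in> space (PiM E M). a \<le> f x - r} =
      (\<integral>\<^sup>+x. indicator {x \<in> space (PiM E M). a \<le> f x - r} x \<partial>PiM E M)"
    by (rule nn_integral_indicator[symmetric]) measurable
  also have "\<dots> \<le> (\<integral>\<^sup>+x. ennreal (exp (- (\<theta> * a))) * ennreal (exp (\<theta> * (f x - r))) \<partial>PiM E M)"
  proof (intro nn_integral_mono)
    fix x
    have "1 \<le> ennreal (exp (- (\<theta> * a) + \<theta> * (f x - r)))" if "a \<le> f x - r"
      using mult_left_mono[OF that \<theta>(1)] by simp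
    then show "indicator {x \<in> space (PiM E M). a \<le> f x - r} x
        \<le> ennreal (exp (- (\<theta> * a))) * ennreal (exp (\<theta> * (f x - r)))"
      by (auto simp: indicator_def ennreal_mult[symmetric] exp_add[symmetric])
  qed
  also have "\<dots> = ennreal (exp (- (\<theta> * a))) * (\<integral>\<^sup>+x. ennreal (exp (\<theta> * (f x - r))) \<partial>PiM E M)"
    by (rule nn_integral_cmult) measurable
  also have "\<dots> \<le> ennreal (exp (- (\<theta> * a))) * ennreal (exp (card E * (2 * v * (\<theta> * L)\<^sup>2)))"
    unfolding r_def using assms by (intro mult_left_mono concentration_mgf) auto
  also have "\<dots> = ennreal (exp (card E * (2 * v * (\<theta> * L)\<^sup>2) - \<theta> * a))"
    by (simp add: ennreal_mult[symmetric] exp_add[symmetric])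
  finally show ?thesis by (simp add: P.emeasure_eq_measure r_def)
qed

lemma coord_Lipschitz_uminus: "coord_Lipschitz L E f \<Longrightarrow> coord_Lipschitz L E (\<lambda>x. - f x)"
  by (auto simp: coord_Lipschitz_def real_Lipschitz_def abs_minus_commute)

lemma concentration:
  fixes L v \<theta> a :: real
  assumes E: "finite E" and fm [measurable]: "f \<in> borel_measurable (PiM E M)"
    and f: "coord_Lipschitz L E f"
    and v: "\<And>e. e \<in> E \<Longrightarrow> subexponential_law (M e) (m e) v" and \<theta>: "0 \<le> \<theta>" "\<bar>\<theta> * L\<bar> \<le> 1"
  shows "measure (PiM E M) {x \<in> extensional E. a \<le> \<bar>f x - (\<integral>y. f y \<partial>PiM E M)\<bar>}
     \<le> 2 * exp (card E * (2 * v * (\<theta> * L)\<^sup>2) - \<theta> * a)"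
proof -
  interpret P: prob_space "PiM E M" by (rule prob_space_PiM_real)
  define r where "r = (\<integral>y. f y \<partial>PiM E M)"
  have S: "{x \<in> space (PiM E M). a \<le> f x - r} \<in> sets (PiM E M)"
    "{x \<in> space (PiM E M). a \<le> - f x + r} \<in> sets (PiM E M)" by measurable
  have "{x \<in> extensional E. a \<le> \<bar>f x - r\<bar>} \<subseteq>
      {x \<in> space (PiM E M). a \<le> f x - r} \<union> {x \<in> space (PiM E M). a \<le> - f x + r}" by auto
  then have "measure (PiM E M) {x \<in> extensional E. a \<le> \<bar>f x - r\<bar>} \<le>
      measure (PiM E M) ({x \<in> space (PiM E M). a \<le> f x - r} \<union> {x \<in> space (PiM E M). a \<le> - f x + r})"
    using S by (intro P.finite_measure_mono) auto
  also have "\<dots> \<le> measure (PiM E M) {x \<in> extensional E. a \<le> f x - r} +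
      measure (PiM E M) {x \<in> extensional E. a \<le> - f x - (- r)}"
    using measure_Un_le[OF S] by simp
  also have "\<dots> \<le> exp (card E * (2 * v * (\<theta> * L)\<^sup>2) - \<theta> * a) + exp (card E * (2 * v * (\<theta> * L)\<^sup>2) - \<theta> * a)"
    using concentration_upper[OF E fm f v \<theta>, of a]
      concentration_upper[OF E _ coord_Lipschitz_uminus[OF f] v \<theta>, of a]
    by (intro add_mono) (auto simp: r_def)
  finally show ?thesis by (simp add: r_def)
qed

text \<open>Chernoff's bound with parameter 1/2 and a union bound over \<open>C\<close>.
  Coefficients of size at most 2 then give arguments in [-1, 1], exactly the range in which the
  exponential moments are controlled.\<close>

lemma linear_max_bound:
  fixes v a :: real
  assumes E: "finite E" and C: "finite C" and c: "\<And>c e. c \<in> C \<Longrightarrow> e \<in> E \<Longrightarrow> \<bar>c e\<bar> \<le> 2"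
    and v: "\<And>e. e \<in> E \<Longrightarrow> subexponential_law (M e) (m e) v" and v0: "v \<ge> 0"
  shows "measure (PiM E M) {x \<in> extensional E. \<exists>c\<in>C. a \<le> (\<Sum>e\<in>E. c e * x e)}
     \<le> card C * exp ((\<Sum>e\<in>E. \<bar>m e\<bar> + v) - a / 2)"
proof -
  interpret P: prob_space "PiM E M" by (rule prob_space_PiM_real)
  define A where "A c = {x \<in> space (PiM E M). a \<le> (\<Sum>e\<in>E. c e * x e)}" for c
  have A [measurable]: "A c \<in> sets (PiM E M)" for c unfolding A_def by measurable
  have one: "emeasure (PiM E M) (A c) \<le> ennreal (exp ((\<Sum>e\<in>E. \<bar>m e\<bar> + v) - a / 2))" if "c \<in> C" for c
  proof -
    have "emeasure (PiM E M) (A c) = (\<integral>\<^sup>+x. indicator (A c) x \<partial>PiM E M)"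
      by (rule nn_integral_indicator[symmetric]) measurable
    also have "\<dots> \<le> (\<integral>\<^sup>+x. ennreal (exp (- a / 2)) * (\<Prod>e\<in>E. ennreal (exp (c e / 2 * x e))) \<partial>PiM E M)"
    proof (intro nn_integral_mono)
      fix x
      have "(\<Prod>e\<in>E. ennreal (exp (c e / 2 * x e))) = ennreal (exp ((\<Sum>e\<in>E. c e * x e) / 2))"
        using E by (simp add: prod_ennreal exp_sum[symmetric] sum_divide_distrib)
      then have "ennreal (exp (- a / 2)) * (\<Prod>e\<in>E. ennreal (exp (c e / 2 * x e))) =
          ennreal (exp (((\<Sum>e\<in>E. c e * x e) - a) / 2))"
        by (simp add: ennreal_mult[symmetric] exp_add[symmetric] diff_divide_distrib)
      moreover have "1 \<le> ennreal (exp (((\<Sum>e\<in>E. c e * x e) - a) / 2))" if "x \<in> A c"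
        using that by (simp add: A_def)
      ultimately show "indicator (A c) x \<le>
          ennreal (exp (- a / 2)) * (\<Prod>e\<in>E. ennreal (exp (c e / 2 * x e)))"
        by (simp add: indicator_def)
    qed
    also have "\<dots> = ennreal (exp (- a / 2)) * (\<integral>\<^sup>+x. (\<Prod>e\<in>E. ennreal (exp (c e / 2 * x e))) \<partial>PiM E M)"
      by (rule nn_integral_cmult) measurable
    also have "(\<integral>\<^sup>+x. (\<Prod>e\<in>E. ennreal (exp (c e / 2 * x e))) \<partial>PiM E M) =
        (\<Prod>e\<in>E. \<integral>\<^sup>+t. ennreal (exp (c e / 2 * t)) \<partial>M e)"
      using E by (intro product_nn_integral_prod) auto
    also have "\<dots> \<le> (\<Prod>e\<in>E. ennreal (exp (\<bar>m e\<bar> + v)))"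
    proof (intro prod_mono_ennreal)
      fix e assume e: "e \<in> E"
      define t where "t = c e / 2"
      have t: "\<bar>t\<bar> \<le> 1" using c[OF that e] by (simp add: t_def)
      have "(\<integral>\<^sup>+x. ennreal (exp (t * x)) \<partial>M e) =
          (\<integral>\<^sup>+x. ennreal (exp (t * m e)) * ennreal (exp (t * (x - m e))) \<partial>M e)"
        by (intro nn_integral_cong) (simp add: ennreal_mult[symmetric] exp_add[symmetric] algebra_simps)
      also have "\<dots> = ennreal (exp (t * m e)) * (\<integral>\<^sup>+x. ennreal (exp (t * (x - m e))) \<partial>M e)"
        by (rule nn_integral_cmult) measurable
      also have "\<dots> \<le> ennreal (exp (t * m e)) * ennreal (exp (v * t\<^sup>2))"
        using v[OF e] t unfolding subexponential_law_def by (intro mult_left_mono) auto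
      also have "\<dots> \<le> ennreal (exp (\<bar>m e\<bar> + v))"
      proof -
        have "t * m e \<le> \<bar>m e\<bar>"
          using t mult_right_mono[of "\<bar>t\<bar>" 1 "\<bar>m e\<bar>"] by (simp add: abs_mult[symmetric])
        moreover have "v * t\<^sup>2 \<le> v"
          using t v0 by (simp add: mult_left_le abs_square_le_1)
        ultimately show ?thesis by (simp add: ennreal_mult[symmetric] exp_add[symmetric])
      qed
      finally show "(\<integral>\<^sup>+x. ennreal (exp (c e / 2 * x)) \<partial>M e) \<le> ennreal (exp (\<bar>m e\<bar> + v))"
        by (simp add: t_def)
    qed
    also have "(\<Prod>e\<in>E. ennreal (exp (\<bar>m e\<bar> + v))) = ennreal (exp (\<Sum>e\<in>E. \<bar>m e\<bar> + v))"
      using E by (simp add: prod_ennreal exp_sum)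
    also have "ennreal (exp (- a / 2)) * \<dots> = ennreal (exp ((\<Sum>e\<in>E. \<bar>m e\<bar> + v) - a / 2))"
      by (simp add: ennreal_mult[symmetric] exp_add[symmetric])
    finally show ?thesis by (simp add: mult_left_mono)
  qed
  have "{x \<in> extensional E. \<exists>c\<in>C. a \<le> (\<Sum>e\<in>E. c e * x e)} = (\<Union>c\<in>C. A c)"
    by (auto simp: A_def)
  also have "measure (PiM E M) \<dots> \<le> (\<Sum>c\<in>C. measure (PiM E M) (A c))"
    using C by (intro measure_UNION_le) auto
  also have "\<dots> \<le> (\<Sum>c\<in>C. exp ((\<Sum>e\<in>E. \<bar>m e\<bar> + v) - a / 2))"
    using one by (intro sum_mono) (simp add: P.emeasure_eq_measure)
  finally show ?thesis by simp
qed

lemma integral_coordinate: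
  assumes "finite E" "e \<in> E" "coord_Lipschitz L E f" "f \<in> borel_measurable (PiM E M)"
  shows "(\<integral>x. f x \<partial>PiM E M) = (\<integral>x. \<integral>t. f (x(e := t)) \<partial>M e \<partial>PiM (E - {e}) M)"
    and "integrable (PiM (E - {e}) M) (\<lambda>x. \<integral>t. f (x(e := t)) \<partial>M e)"
proof -
  have E: "insert e (E - {e}) = E" using assms by auto
  have i: "integrable (PiM (insert e (E - {e})) M) f"
    unfolding E using assms by (intro coord_Lipschitz_integrable) auto
  show "(\<integral>x. f x \<partial>PiM E M) = (\<integral>x. \<integral>t. f (x(e := t)) \<partial>M e \<partial>PiM (E - {e}) M)"
    using product_integral_insert[OF _ _ i] assms(1) unfolding E by simp
  show "integrable (PiM (E - {e}) M) (\<lambda>x. \<integral>t. f (x(e := t)) \<partial>M e)"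
    using assms(1,3,4) E
    by (intro coord_Lipschitz_integrable[of _ L] partial_integral_Lipschitz partial_integral_measurable) auto
qed

end

text \<open>Telescoping over hybrid measures: \<open>H A\<close> uses \<open>M\<close> on
  \<open>A\<close> and \<open>N\<close> elsewhere. Consecutive hybrids differ in one factor, and the
  error of that factor is bounded uniformly in the other coordinates, so it survives integration
  over them.\<close>

lemma Lindeberg_swap:
  assumes M: "real_laws M" and N: "real_laws N" and E: "finite E"
    and f: "coord_Lipschitz L E f" and fm: "f \<in> borel_measurable (PiM E (\<lambda>_. borel))"
    and err: "\<And>e x. e \<in> E \<Longrightarrow> \<bar>(\<integral>t. f (x(e := t)) \<partial>M e) - (\<integral>t. f (x(e := t)) \<partial>N e)\<bar> \<le> \<epsilon> e"
  shows "\<bar>(\<integral>x. f x \<partial>PiM E M) - (\<integral>x. f x \<partial>PiM E N)\<bar> \<le> (\<Sum>e\<in>E. \<epsilon> e)"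
proof -
  define H where "H A = (\<lambda>e. if e \<in> A then M e else N e)" for A
  have H: "real_laws (H A)" for A
    using M N by (auto simp: real_laws_def H_def)
  have "\<bar>(\<integral>x. f x \<partial>PiM E (H A)) - (\<integral>x. f x \<partial>PiM E (H {}))\<bar> \<le> (\<Sum>e\<in>A. \<epsilon> e)"
    if "finite A" "A \<subseteq> E" for A
    using that
  proof (induction A)
    case (insert a A)
    interpret A: real_laws "H A" by (rule H)
    interpret A': real_laws "H (insert a A)" by (rule H)
    have a: "a \<in> E" using insert by auto
    have same: "PiM (E - {a}) (H (insert a A)) = PiM (E - {a}) (H A)"
      by (rule PiM_cong) (auto simp: H_def)
    have at: "H (insert a A) a = M a" "H A a = N a" using insert by (auto simp: H_def)
    have fm1: "f \<in> borel_measurable (PiM E (H A))" "f \<in> borel_measurable (PiM E (H (insert a A)))"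
      using fm by (simp_all add: measurable_cong_sets[OF A.sets_PiM_real refl]
          measurable_cong_sets[OF A'.sets_PiM_real refl])
    note c = A.integral_coordinate[OF E a f fm1(1)] A'.integral_coordinate[OF E a f fm1(2)]
    interpret P: prob_space "PiM (E - {a}) (H A)" by (rule A.prob_space_PiM_real)
    have "\<bar>(\<integral>x. f x \<partial>PiM E (H (insert a A))) - (\<integral>x. f x \<partial>PiM E (H A))\<bar> =
       \<bar>\<integral>x. (\<integral>t. f (x(a := t)) \<partial>M a) - (\<integral>t. f (x(a := t)) \<partial>N a) \<partial>PiM (E - {a}) (H A)\<bar>"
      using c(2,4) unfolding c(1,3) same at
      by (subst Bochner_Integration.integral_diff) auto
    also have "\<dots> \<le> (\<integral>x. \<bar>(\<integral>t. f (x(a := t)) \<partial>M a) - (\<integral>t. f (x(a := t)) \<partial>N a)\<bar> \<partial>PiM (E - {a}) (H A))"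
      by (rule integral_abs_bound)
    also have "\<dots> \<le> (\<integral>x. \<epsilon> a \<partial>PiM (E - {a}) (H A))"
      using c(2,4) a err unfolding same at
      by (intro integral_mono integrable_abs Bochner_Integration.integrable_diff) auto
    also have "\<dots> = \<epsilon> a" by (simp add: P.prob_space)
    finally show ?case using insert by auto
  qed simp
  from this[OF E subset_refl]
  show ?thesis
    by (simp add: H_def cong: PiM_cong)
qed

section \<open>Gaussian vectors\<close>

definition std_gauss :: "real measure" where
  "std_gauss = density lborel (\<lambda>x. ennreal (std_normal_density x))"

lemma sets_std_gauss [simp, measurable_cong]: "sets std_gauss = sets borel"
  by (simp add: std_gauss_def)

lemma space_std_gauss [simp]: "space std_gauss = UNIV"
  by (simp add: std_gauss_def)

interpretation std_gauss: prob_space std_gauss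
  unfolding std_gauss_def by (rule prob_space_normal_density) simp

abbreviation gauss_pair :: "(real \<times> real) measure" where
  "gauss_pair \<equiv> std_gauss \<Otimes>\<^sub>M std_gauss"

lemma nn_integral_std_gauss:
  assumes [measurable]: "f \<in> borel_measurable borel"
  shows "(\<integral>\<^sup>+x. f x \<partial>std_gauss) = (\<integral>\<^sup>+x. ennreal (std_normal_density x) * f x \<partial>lborel)"
  by (simp add: std_gauss_def nn_integral_density)

lemma integrable_std_gauss_power: "integrable std_gauss (\<lambda>x. x ^ k)"
  unfolding std_gauss_def
  by (subst integrable_density) (auto simp: integrable_std_normal_moment)

lemma integral_std_gauss:
  fixes f :: "real \<Rightarrow> real"
  assumes "f \<in> borel_measurable borel"
  shows "(\<integral>x. f x \<partial>std_gauss) = (\<integral>x. std_normal_density x * f x \<partial>lborel)"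
  unfolding std_gauss_def using assms by (subst integral_density) auto

lemma std_gauss_moments:
  "(\<integral>x. x \<partial>std_gauss) = 0" "(\<integral>x. x\<^sup>2 \<partial>std_gauss) = 1" "(\<integral>x. x ^ 4 \<partial>std_gauss) = 3"
  using integral_std_normal_moment_odd[of 0] integral_std_normal_moment_even[of 1]
    integral_std_normal_moment_even[of 2]
  by (simp_all add: integral_std_gauss fact_numeral)

(* The map is a reflection, which is its own inverse; this lets the next results return from the
   rotated coordinates by the same formula. *)
lemma std_gauss_rotation:
  assumes st: "s\<^sup>2 + t\<^sup>2 = 1"
  shows "distr gauss_pair gauss_pair
      (\<lambda>(g, h). (s * g + t * h, t * g - s * h)) = gauss_pair"
proof (rule measure_eqI)
  interpret pair_prob_space std_gauss std_gauss ..
  let ?n = "\<lambda>x. ennreal (std_normal_density x)"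
  show "sets (distr gauss_pair gauss_pair
      (\<lambda>(g, h). (s * g + t * h, t * g - s * h))) = sets gauss_pair" by simp
  fix A assume "A \<in> sets (distr gauss_pair gauss_pair
      (\<lambda>(g, h). (s * g + t * h, t * g - s * h)))"
  then have A: "A \<in> sets gauss_pair" by simp
  have A' [measurable]: "A \<in> sets (borel \<Otimes>\<^sub>M borel)" using A
    by (metis sets_pair_measure_cong sets_std_gauss)
  define f :: "real \<Rightarrow> real \<Rightarrow> ennreal" where "f x w = indicator A (x, w)" for x w
  have f [measurable]: "(\<lambda>(x, w). f x w) \<in> borel_measurable (borel \<Otimes>\<^sub>M borel)"
    unfolding f_def by measurable
  have f' [measurable]: "(\<lambda>z. f (p z) (q z)) \<in> borel_measurable N"
    if [measurable]: "p \<in> borel_measurable N" "q \<in> borel_measurable N" for p q :: "'z \<Rightarrow> real" and N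
    unfolding f_def by measurable
  have n [simp]: "?n x * ?n w = ennreal (exp (- (x\<^sup>2 + w\<^sup>2) / 2) / (2 * pi))" for x w
    by (simp add: std_normal_density_def ennreal_mult[symmetric] mult_exp_exp add_divide_distrib)
  have base: "(\<integral>\<^sup>+x. \<integral>\<^sup>+w. F x w \<partial>std_gauss \<partial>std_gauss) =
     (\<integral>\<^sup>+x. \<integral>\<^sup>+w. ennreal (exp (- (x\<^sup>2 + w\<^sup>2) / 2) / (2 * pi)) * F x w \<partial>lborel \<partial>lborel)"
    if [measurable]: "(\<lambda>(x, w). F x w) \<in> borel_measurable (borel \<Otimes>\<^sub>M borel)" for F
  proof -
    have "(\<integral>\<^sup>+x. \<integral>\<^sup>+w. F x w \<partial>std_gauss \<partial>std_gauss) =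
        (\<integral>\<^sup>+x. ?n x * (\<integral>\<^sup>+w. ?n w * F x w \<partial>lborel) \<partial>lborel)"
      by (simp add: nn_integral_std_gauss)
    also have "\<dots> = (\<integral>\<^sup>+x. \<integral>\<^sup>+w. ?n x * (?n w * F x w) \<partial>lborel \<partial>lborel)"
      by (intro nn_integral_cong nn_integral_cmult[symmetric]) measurable
    finally show ?thesis by (simp only: mult.assoc[symmetric] n)
  qed
  define e where "e x w = ennreal (exp (- (x\<^sup>2 + w\<^sup>2) / 2) / (2 * pi))" for x w :: real
  have em [measurable]: "(\<lambda>z. e (p z) (q z)) \<in> borel_measurable N"
    if [measurable]: "p \<in> borel_measurable N" "q \<in> borel_measurable N" for p q :: "'z \<Rightarrow> real" and N
    unfolding e_def by measurable
  have rot: "e (s * x + t * w) (t * x - s * w) = e x w" for x w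
  proof -
    have "(s * x + t * w)\<^sup>2 + (t * x - s * w)\<^sup>2 = (s\<^sup>2 + t\<^sup>2) * (x\<^sup>2 + w\<^sup>2)"
      by (simp add: power2_eq_square algebra_simps)
    then show ?thesis by (simp add: e_def st)
  qed
  have "emeasure (distr gauss_pair gauss_pair
      (\<lambda>(g, h). (s * g + t * h, t * g - s * h))) A =
      (\<integral>\<^sup>+z. f (s * fst z + t * snd z) (t * fst z - s * snd z) \<partial>gauss_pair)"
    using A by (subst nn_integral_indicator[symmetric], simp, subst nn_integral_distr)
      (auto simp: f_def case_prod_unfold)
  also have "\<dots> = (\<integral>\<^sup>+g. \<integral>\<^sup>+h. f (s * g + t * h) (t * g - s * h) \<partial>std_gauss \<partial>std_gauss)"
    by (subst std_gauss.nn_integral_fst[symmetric]) auto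
  also have "\<dots> = (\<integral>\<^sup>+g. \<integral>\<^sup>+h. e g h * f (s * g + t * h) (t * g - s * h) \<partial>lborel \<partial>lborel)"
    unfolding e_def by (rule base) measurable
  also have "\<dots> = (\<integral>\<^sup>+x. \<integral>\<^sup>+w. e x w * f x w \<partial>lborel \<partial>lborel)"
  proof (cases "t = 0")
    case True
    \<comment> \<open>Here the map only changes signs; the substitutions of the other case divide by
      \<open>t\<close>.\<close>
    then have "s = 1 \<or> s = - 1" using st by (simp add: power2_eq_1_iff)
    then have s: "\<bar>s\<bar> = 1" "s * s = 1" "s \<noteq> 0" by auto
    have se: "e x (- s * h) = e x h" "e (s * x) h = e x h" for x h
      using st True by (simp_all add: e_def power_mult_distrib)
    have ss: "s * (s * x) = x" for x using s(2) by (simp add: mult.assoc[symmetric])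
    have "(\<integral>\<^sup>+x. \<integral>\<^sup>+w. e x w * f x w \<partial>lborel \<partial>lborel) = (\<integral>\<^sup>+x. \<integral>\<^sup>+h. e x h * f x (- s * h) \<partial>lborel \<partial>lborel)"
    proof (rule nn_integral_cong)
      fix x
      show "(\<integral>\<^sup>+w. e x w * f x w \<partial>lborel) = (\<integral>\<^sup>+h. e x h * f x (- s * h) \<partial>lborel)"
        using nn_integral_real_affine[of "\<lambda>w. e x w * f x w" "- s" 0] s se(1) by simp
    qed
    also have "\<dots> = (\<integral>\<^sup>+g. \<integral>\<^sup>+h. e g h * f (s * g) (- s * h) \<partial>lborel \<partial>lborel)"
      using nn_integral_real_affine[of "\<lambda>x. \<integral>\<^sup>+h. e x h * f x (- s * h) \<partial>lborel" s 0] s se(2) by simp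
    finally show ?thesis using True by simp
  next
    case False
    \<comment> \<open>Two affine substitutions in one variable suffice: \<open>h\<close> is replaced
      by \<open>x = s * g + t * h\<close> with \<open>g\<close> fixed and then, after Fubini,
      \<open>g\<close> by \<open>w = (g - s * x) / t\<close> with \<open>x\<close> fixed. Their
      factors \<open>1 / \<bar>t\<bar>\<close> and \<open>\<bar>t\<bar>\<close> cancel.\<close>
    have t2: "1 - s\<^sup>2 = t\<^sup>2" using st by simp
    have "(\<integral>\<^sup>+g. \<integral>\<^sup>+h. e g h * f (s * g + t * h) (t * g - s * h) \<partial>lborel \<partial>lborel)
      = (\<integral>\<^sup>+g. \<integral>\<^sup>+x. ennreal (1 / \<bar>t\<bar>) * (e g ((x - s * g) / t) * f x ((g - s * x) / t)) \<partial>lborel \<partial>lborel)"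
    proof (rule nn_integral_cong)
      fix g
      have "(\<integral>\<^sup>+h. e g h * f (s * g + t * h) (t * g - s * h) \<partial>lborel) =
        ennreal \<bar>1 / t\<bar> * (\<integral>\<^sup>+x. e g (- (s * g / t) + 1 / t * x) *
          f (s * g + t * (- (s * g / t) + 1 / t * x)) (t * g - s * (- (s * g / t) + 1 / t * x)) \<partial>lborel)"
        using False by (intro nn_integral_real_affine) auto
      also have "(\<lambda>x. s * g + t * (- (s * g / t) + 1 / t * x)) = (\<lambda>x. x)"
        using False by (auto simp: field_simps)
      also have "(\<lambda>x. t * g - s * (- (s * g / t) + 1 / t * x)) = (\<lambda>x. (g - s * x) / t)"
      proof
        fix x
        have "t * g + s * s * g / t = (t\<^sup>2 + s\<^sup>2) * g / t"
          using False by (simp add: field_simps power2_eq_square)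
        then show "t * g - s * (- (s * g / t) + 1 / t * x) = (g - s * x) / t"
          using st by (simp add: algebra_simps diff_divide_distrib)
      qed
      also have "(\<lambda>x. - (s * g / t) + 1 / t * x) = (\<lambda>x. (x - s * g) / t)"
        by (auto simp: diff_divide_distrib)
      finally show "(\<integral>\<^sup>+h. e g h * f (s * g + t * h) (t * g - s * h) \<partial>lborel) =
         (\<integral>\<^sup>+x. ennreal (1 / \<bar>t\<bar>) * (e g ((x - s * g) / t) * f x ((g - s * x) / t)) \<partial>lborel)"
        by (subst nn_integral_cmult) auto
    qed
    also have "\<dots> = (\<integral>\<^sup>+x. \<integral>\<^sup>+g. ennreal (1 / \<bar>t\<bar>) * (e g ((x - s * g) / t) * f x ((g - s * x) / t)) \<partial>lborel \<partial>lborel)"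
      by (rule lborel_pair.Fubini') measurable
    also have "\<dots> = (\<integral>\<^sup>+x. \<integral>\<^sup>+w. e x w * f x w \<partial>lborel \<partial>lborel)"
    proof (rule nn_integral_cong)
      fix x
      have "(\<integral>\<^sup>+g. ennreal (1 / \<bar>t\<bar>) * (e g ((x - s * g) / t) * f x ((g - s * x) / t)) \<partial>lborel) =
          ennreal \<bar>t\<bar> * (\<integral>\<^sup>+w. ennreal (1 / \<bar>t\<bar>) * (e (s * x + t * w) ((x - s * (s * x + t * w)) / t) *
             f x ((s * x + t * w - s * x) / t)) \<partial>lborel)"
        using False by (intro nn_integral_real_affine) auto
      also have "\<dots> = (\<integral>\<^sup>+w. ennreal \<bar>t\<bar> * (ennreal (1 / \<bar>t\<bar>) * (e (s * x + t * w) ((x - s * (s * x + t * w)) / t) *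
             f x ((s * x + t * w - s * x) / t))) \<partial>lborel)"
        by (rule nn_integral_cmult[symmetric]) measurable
      also have "\<dots> = (\<integral>\<^sup>+w. e x w * f x w \<partial>lborel)"
      proof (rule nn_integral_cong)
        fix w
        have "(x - s * (s * x + t * w)) / t = (1 - s\<^sup>2) * x / t - s * w"
          using False by (simp add: field_simps power2_eq_square)
        also have "\<dots> = t * x - s * w" unfolding t2 using False by (simp add: power2_eq_square)
        finally have "e (s * x + t * w) ((x - s * (s * x + t * w)) / t) = e x w" by (simp add: rot)
        moreover have "ennreal \<bar>t\<bar> * (ennreal (1 / \<bar>t\<bar>) * z) = z" for z
          using False by (simp add: mult.assoc[symmetric] ennreal_mult[symmetric])
        ultimately show "ennreal \<bar>t\<bar> * (ennreal (1 / \<bar>t\<bar>) * (e (s * x + t * w) ((x - s * (s * x + t * w)) / t) *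
             f x ((s * x + t * w - s * x) / t))) = e x w * f x w"
          using False by simp
      qed
      finally show "(\<integral>\<^sup>+g. ennreal (1 / \<bar>t\<bar>) * (e g ((x - s * g) / t) * f x ((g - s * x) / t)) \<partial>lborel) =
        (\<integral>\<^sup>+w. e x w * f x w \<partial>lborel)" .
    qed
    finally show ?thesis .
  qed
  also have "\<dots> = (\<integral>\<^sup>+x. \<integral>\<^sup>+w. f x w \<partial>std_gauss \<partial>std_gauss)"
    unfolding e_def by (rule base[symmetric]) measurable
  also have "\<dots> = (\<integral>\<^sup>+z. f (fst z) (snd z) \<partial>gauss_pair)"
    by (subst std_gauss.nn_integral_fst[symmetric]) auto
  also have "\<dots> = emeasure gauss_pair A"
    using A by (simp add: f_def)
  finally show "emeasure (distr gauss_pair gauss_pair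
      (\<lambda>(g, h). (s * g + t * h, t * g - s * h))) A = emeasure gauss_pair A" .
qed

abbreviation gauss_vector :: "'i set \<Rightarrow> ('i \<Rightarrow> real) measure" where
  "gauss_vector I \<equiv> PiM I (\<lambda>_. std_gauss)"

interpretation gauss_vector: product_sigma_finite "\<lambda>_. std_gauss" ..

lemma prob_space_gauss_vector: "prob_space (gauss_vector I)"
  by (rule prob_space_PiM) (rule std_gauss.prob_space_axioms)

text \<open>One reflection per added coordinate: the pair of \<open>u i\<close> and
  \<open>sqrt v\<close> is \<open>w\<close> times a unit vector, and the reflection turns its
  product with two independent Gaussians into \<open>w\<close> times a single one. Stating the law
  as an image of \<open>std_gauss\<close> admits variance 0.\<close>

lemma distr_gauss_vector_linear:
  assumes "finite I"
  shows "distr (gauss_vector I) borel (\<lambda>g. \<Sum>l\<in>I. u l * g l) =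
    distr std_gauss borel (\<lambda>x. sqrt (\<Sum>l\<in>I. (u l)\<^sup>2) * x)"
  using assms
proof (induction I)
  case empty
  interpret E: prob_space "gauss_vector ({} :: 'a set)" by (rule prob_space_gauss_vector)
  have "distr (gauss_vector ({} :: 'a set)) borel (\<lambda>g. 0 :: real) = return borel 0"
    by (rule measure_eqI) (auto simp: emeasure_distr E.emeasure_space_1 indicator_def)
  moreover have "distr std_gauss borel (\<lambda>x. 0 :: real) = return borel 0"
    by (rule measure_eqI) (use std_gauss.emeasure_space_1 in \<open>auto simp: emeasure_distr indicator_def\<close>)
  ultimately show ?case by simp
next
  case (insert i I)
  interpret pair_prob_space std_gauss std_gauss ..
  define v where "v = (\<Sum>l\<in>I. (u l)\<^sup>2)"
  define w where "w = sqrt (v + (u i)\<^sup>2)"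
  have v0: "v \<ge> 0" by (simp add: v_def sum_nonneg)
  \<comment> \<open>For \<open>w = 0\<close> both \<open>u i\<close> and \<open>v\<close> vanish,
    and any unit vector serves.\<close>
  obtain s t where st: "s\<^sup>2 + t\<^sup>2 = 1" and su: "w * s = u i" and tv: "w * t = sqrt v"
  proof (cases "w = 0")
    case True
    then have "v + (u i)\<^sup>2 = 0" by (simp add: w_def)
    then have "v = 0" "u i = 0" using v0 by (auto simp: add_nonneg_eq_0_iff)
    then show ?thesis using that[of 1 0] True by simp
  next
    case False
    have w2: "w\<^sup>2 = v + (u i)\<^sup>2" using v0 by (simp add: w_def)
    show ?thesis
      by (rule that[of "u i / w" "sqrt v / w"])
         (use False v0 in \<open>auto simp: power_divide w2 add_divide_distrib[symmetric]\<close>, use w2 False in \<open>simp add: add.commute\<close>)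
  qed
  show ?case
  proof (rule measure_eqI)
    fix A :: "real set" assume "A \<in> sets (distr (gauss_vector (insert i I)) borel (\<lambda>g. \<Sum>l\<in>insert i I. u l * g l))"
    then have A [measurable]: "A \<in> sets borel" by simp
    have "emeasure (distr (gauss_vector (insert i I)) borel (\<lambda>g. \<Sum>l\<in>insert i I. u l * g l)) A =
        (\<integral>\<^sup>+g. indicator A (\<Sum>l\<in>insert i I. u l * g l) \<partial>gauss_vector (insert i I))"
      by (subst nn_integral_indicator[symmetric], simp, subst nn_integral_distr) auto
    also have "\<dots> = (\<integral>\<^sup>+g. \<integral>\<^sup>+x. indicator A (\<Sum>l\<in>insert i I. u l * (g(i := x)) l) \<partial>std_gauss \<partial>gauss_vector I)"
      using insert.hyps by (subst gauss_vector.product_nn_integral_insert) auto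
    also have "\<dots> = (\<integral>\<^sup>+g. \<integral>\<^sup>+x. indicator A ((\<Sum>l\<in>I. u l * g l) + u i * x) \<partial>std_gauss \<partial>gauss_vector I)"
    proof -
      have "(\<Sum>l\<in>insert i I. u l * (g(i := x)) l) = (\<Sum>l\<in>I. u l * g l) + u i * x" for g x
        using insert.hyps by (auto intro!: sum.cong)
      then show ?thesis by simp
    qed
    also have "\<dots> = (\<integral>\<^sup>+y. \<integral>\<^sup>+x. indicator A (y + u i * x) \<partial>std_gauss \<partial>distr (gauss_vector I) borel (\<lambda>g. \<Sum>l\<in>I. u l * g l))"
      by (subst nn_integral_distr) auto
    also have "\<dots> = (\<integral>\<^sup>+h. \<integral>\<^sup>+x. indicator A (sqrt v * h + u i * x) \<partial>std_gauss \<partial>std_gauss)"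
      unfolding insert.IH v_def[symmetric] by (subst nn_integral_distr) auto
    also have "\<dots> = (\<integral>\<^sup>+x. \<integral>\<^sup>+h. indicator A (sqrt v * h + u i * x) \<partial>std_gauss \<partial>std_gauss)"
      by (rule Fubini') measurable
    also have "\<dots> = (\<integral>\<^sup>+z. indicator A (w * (s * fst z + t * snd z)) \<partial>gauss_pair)"
      by (subst std_gauss.nn_integral_fst[symmetric]) (auto simp: su[symmetric] tv[symmetric] algebra_simps)
    also have "\<dots> = (\<integral>\<^sup>+z. indicator A (w * fst z) \<partial>(distr gauss_pair gauss_pair
      (\<lambda>(g, h). (s * g + t * h, t * g - s * h))))"
      by (subst nn_integral_distr) (auto simp: case_prod_unfold)
    also have "\<dots> = (\<integral>\<^sup>+z. indicator A (w * fst z) \<partial>gauss_pair)"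
      by (subst std_gauss_rotation[OF st]) simp
    also have "\<dots> = (\<integral>\<^sup>+x. indicator A (w * x) \<partial>std_gauss)"
      by (subst std_gauss.nn_integral_fst[symmetric]) (auto simp: std_gauss.emeasure_space_1[simplified])
    also have "\<dots> = emeasure (distr std_gauss borel (\<lambda>x. w * x)) A"
      by (subst nn_integral_indicator[symmetric], simp, subst nn_integral_distr) auto
    finally show "emeasure (distr (gauss_vector (insert i I)) borel (\<lambda>g. \<Sum>l\<in>insert i I. u l * g l)) A =
      emeasure (distr std_gauss borel (\<lambda>x. sqrt (\<Sum>l\<in>insert i I. (u l)\<^sup>2) * x)) A"
      using insert.hyps by (simp add: w_def v_def add.commute)
  qed simp
qed

lemma distr_gauss_vector_unit:
  assumes "finite I" "(\<Sum>l\<in>I. (u l)\<^sup>2) = 1"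
  shows "distr (gauss_vector I) borel (\<lambda>g. \<Sum>l\<in>I. u l * g l) = std_gauss"
proof -
  have "distr std_gauss borel (\<lambda>x. x) = std_gauss"
    by (rule distr_id2) simp
  then show ?thesis using distr_gauss_vector_linear[OF assms(1), of u] assms(2) by simp
qed

lemma integrable_pair_std_gauss:
  assumes f: "integrable std_gauss (f :: real \<Rightarrow> real)"
  shows "integrable gauss_pair (\<lambda>z. f (fst z))"
    and "integrable gauss_pair (\<lambda>z. f (snd z))"
proof -
  interpret pair_prob_space std_gauss std_gauss ..
  have m [measurable]: "f \<in> borel_measurable borel"
    using borel_measurable_integrable[OF f] unfolding measurable_cong_sets[OF sets_std_gauss refl] .
  have i: "integrable (distr gauss_pair std_gauss fst) f"
    using f by (simp add: std_gauss.distr_pair_fst)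
  show 1: "integrable gauss_pair (\<lambda>z. f (fst z))"
    using i by (subst (asm) integrable_distr_eq) auto
  show "integrable gauss_pair (\<lambda>z. f (snd z))"
    using integrable_product_swap[OF 1] by (simp add: case_prod_unfold)
qed

lemma abs_mult_affine_bound:
  fixes x z p :: real
  assumes "\<bar>p\<bar> \<le> A + B * \<bar>z\<bar>" "B \<ge> 0"
  shows "\<bar>x * p\<bar> \<le> \<bar>A\<bar> * (1 + x\<^sup>2) + B * (x\<^sup>2 + z\<^sup>2)"
proof -
  have "\<bar>x * p\<bar> \<le> \<bar>x\<bar> * (\<bar>A\<bar> + B * \<bar>z\<bar>)"
    unfolding abs_mult using assms by (intro mult_left_mono) auto
  also have "\<dots> = \<bar>A\<bar> * \<bar>x\<bar> + B * (\<bar>x\<bar> * \<bar>z\<bar>)" by (simp add: algebra_simps)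
  also have "\<dots> \<le> \<bar>A\<bar> * (1 + x\<^sup>2) + B * (x\<^sup>2 + z\<^sup>2)"
  proof (intro add_mono mult_left_mono)
    have "2 * \<bar>x\<bar> \<le> 1 + x\<^sup>2" using sum_squares_bound[of 1 "\<bar>x\<bar>"] by simp
    then show "\<bar>x\<bar> \<le> 1 + x\<^sup>2" using zero_le_power2[of x] by linarith
    have "2 * (\<bar>x\<bar> * \<bar>z\<bar>) \<le> x\<^sup>2 + z\<^sup>2" using sum_squares_bound[of "\<bar>x\<bar>" "\<bar>z\<bar>"] by (simp add: mult.assoc)
    then show "\<bar>x\<bar> * \<bar>z\<bar> \<le> x\<^sup>2 + z\<^sup>2" using mult_nonneg_nonneg[of "\<bar>x\<bar>" "\<bar>z\<bar>"] by linarith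
  qed (use assms in auto)
  finally show ?thesis .
qed

lemma integrable_gauss_vector_component:
  assumes "i \<in> I"
  shows "integrable (gauss_vector I) (\<lambda>g. (g i) ^ k)"
proof -
  have "integrable (distr (gauss_vector I) std_gauss (\<lambda>g. g i)) (\<lambda>x. x ^ k)"
    using assms
    by (subst distr_PiM_component) (auto intro: std_gauss.prob_space_axioms integrable_std_gauss_power)
  then show ?thesis using assms by (subst (asm) integrable_distr_eq) auto
qed

lemma integrable_gauss_vector_unit:
  assumes "finite I" "(\<Sum>l\<in>I. (u l)\<^sup>2) = 1"
  shows "integrable (gauss_vector I) (\<lambda>g. (\<Sum>l\<in>I. u l * g l) ^ k)"
proof -
  have "integrable (distr (gauss_vector I) borel (\<lambda>g. \<Sum>l\<in>I. u l * g l)) (\<lambda>x. x ^ k)"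
    using assms by (subst distr_gauss_vector_unit) (auto intro: integrable_std_gauss_power)
  then show ?thesis by (subst (asm) integrable_distr_eq) auto
qed

text \<open>Regression on the direction \<open>u\<close>: the part of \<open>g i\<close> orthogonal
  to \<open>u\<close> is independent of the argument of \<phi> and averages to zero. Only
  measurability and linear growth are asked of \<phi>, because the rounding map is discontinuous and
  Gaussian integration by parts does not apply to it.\<close>

lemma
  assumes I: "finite I" "i \<in> I" and u: "(\<Sum>l\<in>I. (u l)\<^sup>2) = 1"
    and \<phi> [measurable]: "\<phi> \<in> borel_measurable borel"
    and growth: "\<And>x. \<bar>\<phi> x\<bar> \<le> A + B * \<bar>x\<bar>" and B: "B \<ge> 0"
  shows integrable_gauss_regression: "integrable (gauss_vector I) (\<lambda>g. g i * \<phi> (\<Sum>l\<in>I. u l * g l))"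
    and gauss_regression:
      "(\<integral>g. g i * \<phi> (\<Sum>l\<in>I. u l * g l) \<partial>gauss_vector I) = u i * (\<integral>x. x * \<phi> x \<partial>std_gauss)"
proof -
  interpret pair_prob_space std_gauss std_gauss ..
  interpret V: prob_space "gauss_vector I" by (rule prob_space_gauss_vector)
  show int: "integrable (gauss_vector I) (\<lambda>g. g i * \<phi> (\<Sum>l\<in>I. u l * g l))"
  proof (rule Bochner_Integration.integrable_bound)
    show "integrable (gauss_vector I) (\<lambda>g. \<bar>A\<bar> * (1 + (g i)\<^sup>2) + B * ((g i)\<^sup>2 + (\<Sum>l\<in>I. u l * g l)\<^sup>2))"
      by (intro Bochner_Integration.integrable_add integrable_mult_right V.integrable_const
          integrable_gauss_vector_component integrable_gauss_vector_unit I u)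
    show "AE g in gauss_vector I. norm (g i * \<phi> (\<Sum>l\<in>I. u l * g l)) \<le>
        norm (\<bar>A\<bar> * (1 + (g i)\<^sup>2) + B * ((g i)\<^sup>2 + (\<Sum>l\<in>I. u l * g l)\<^sup>2))"
      unfolding real_norm_def
      by (intro AE_I2 order_trans[OF abs_mult_affine_bound[OF growth B] abs_ge_self])
    show "(\<lambda>g. g i * \<phi> (\<Sum>l\<in>I. u l * g l)) \<in> borel_measurable (gauss_vector I)"
      using I by measurable
  qed
  define J where "J = I - {i}"
  have IJ: "I = insert i J" "finite J" "i \<notin> J" using I by (auto simp: J_def)
  \<comment> \<open>The coordinate \<open>g i\<close> and the standardized combination of the
    remaining ones form a Gaussian pair, in which the argument of \<phi> is the product with the
    unit vector of \<open>s\<close> and \<open>t\<close>.\<close>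
  define s t where "s = u i" and "t = sqrt (\<Sum>l\<in>J. (u l)\<^sup>2)"
  have st: "s\<^sup>2 + t\<^sup>2 = 1"
    using u IJ by (simp add: s_def t_def sum_nonneg)
  have intP: "integrable gauss_pair (\<lambda>z. fst z * \<phi> (a * fst z + b * snd z))" for a b
  proof (rule Bochner_Integration.integrable_bound)
    show "integrable gauss_pair
        (\<lambda>z. \<bar>A\<bar> * (1 + (fst z)\<^sup>2) + B * ((fst z)\<^sup>2 + 2 * (a\<^sup>2 * (fst z)\<^sup>2 + b\<^sup>2 * (snd z)\<^sup>2)))"
      by (intro Bochner_Integration.integrable_add integrable_mult_right P.integrable_const
          integrable_pair_std_gauss[OF integrable_std_gauss_power])
    show "AE z in gauss_pair. norm (fst z * \<phi> (a * fst z + b * snd z)) \<le>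
        norm (\<bar>A\<bar> * (1 + (fst z)\<^sup>2) + B * ((fst z)\<^sup>2 + 2 * (a\<^sup>2 * (fst z)\<^sup>2 + b\<^sup>2 * (snd z)\<^sup>2)))"
    proof (intro AE_I2)
      fix z :: "real \<times> real"
      have "0 \<le> (a * fst z - b * snd z)\<^sup>2" by simp
      then have "(a * fst z + b * snd z)\<^sup>2 \<le> 2 * (a\<^sup>2 * (fst z)\<^sup>2 + b\<^sup>2 * (snd z)\<^sup>2)"
        by (simp add: power2_eq_square algebra_simps)
      then have "B * ((fst z)\<^sup>2 + (a * fst z + b * snd z)\<^sup>2) \<le> B * ((fst z)\<^sup>2 + 2 * (a\<^sup>2 * (fst z)\<^sup>2 + b\<^sup>2 * (snd z)\<^sup>2))"
        using B by (intro mult_left_mono) auto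
      moreover have "\<bar>fst z * \<phi> (a * fst z + b * snd z)\<bar> \<le>
          \<bar>A\<bar> * (1 + (fst z)\<^sup>2) + B * ((fst z)\<^sup>2 + (a * fst z + b * snd z)\<^sup>2)"
        by (rule abs_mult_affine_bound[OF growth B])
      ultimately have "\<bar>fst z * \<phi> (a * fst z + b * snd z)\<bar> \<le>
          \<bar>A\<bar> * (1 + (fst z)\<^sup>2) + B * ((fst z)\<^sup>2 + 2 * (a\<^sup>2 * (fst z)\<^sup>2 + b\<^sup>2 * (snd z)\<^sup>2))" by linarith
      then show "norm (fst z * \<phi> (a * fst z + b * snd z)) \<le>
        norm (\<bar>A\<bar> * (1 + (fst z)\<^sup>2) + B * ((fst z)\<^sup>2 + 2 * (a\<^sup>2 * (fst z)\<^sup>2 + b\<^sup>2 * (snd z)\<^sup>2)))"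
        unfolding real_norm_def by (rule order_trans[OF _ abs_ge_self])
    qed
  qed measurable
  have "(\<integral>g. g i * \<phi> (\<Sum>l\<in>I. u l * g l) \<partial>gauss_vector I) =
      (\<integral>g. \<integral>x. (g(i := x)) i * \<phi> (\<Sum>l\<in>I. u l * (g(i := x)) l) \<partial>std_gauss \<partial>gauss_vector J)"
    using int unfolding IJ(1) by (intro gauss_vector.product_integral_insert IJ)
  also have "\<dots> = (\<integral>g. (\<lambda>y. \<integral>x. x * \<phi> (s * x + y) \<partial>std_gauss) (\<Sum>l\<in>J. u l * g l) \<partial>gauss_vector J)"
  proof -
    have "(\<Sum>l\<in>I. u l * (g(i := x)) l) = s * x + (\<Sum>l\<in>J. u l * g l)" for g x
    proof -
      have "(\<Sum>l\<in>J. u l * (g(i := x)) l) = (\<Sum>l\<in>J. u l * g l)"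
        by (rule sum.cong) (use IJ in auto)
      then show ?thesis unfolding IJ(1) using IJ by (simp add: s_def)
    qed
    then show ?thesis by simp
  qed
  also have "\<dots> = (\<integral>y. (\<integral>x. x * \<phi> (s * x + y) \<partial>std_gauss) \<partial>distr (gauss_vector J) borel (\<lambda>g. \<Sum>l\<in>J. u l * g l))"
    by (subst integral_distr) auto
  also have "\<dots> = (\<integral>h. \<integral>x. x * \<phi> (s * x + t * h) \<partial>std_gauss \<partial>std_gauss)"
    unfolding distr_gauss_vector_linear[OF IJ(2)] t_def[symmetric] by (subst integral_distr) auto
  also have "\<dots> = (\<integral>z. fst z * \<phi> (s * fst z + t * snd z) \<partial>gauss_pair)"
    using integral_snd[of "\<lambda>x h. x * \<phi> (s * x + t * h)"] intP[of s t] by (simp add: case_prod_unfold)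
  \<comment> \<open>Invariance under the reflection: the argument of \<phi> becomes the first
    coordinate, and \<open>g i\<close> becomes \<open>s\<close> times it plus \<open>t\<close> times
    the independent second one.\<close>
  also have "\<dots> = (\<integral>z. fst z * \<phi> (s * fst z + t * snd z)
      \<partial>distr gauss_pair gauss_pair
        (\<lambda>(g, h). (s * g + t * h, t * g - s * h)))"
    by (subst std_gauss_rotation[OF st]) simp
  also have "\<dots> = (\<integral>z. (s * fst z + t * snd z) *
      \<phi> (s * (s * fst z + t * snd z) + t * (t * fst z - s * snd z)) \<partial>gauss_pair)"
    by (subst integral_distr) (auto simp: case_prod_unfold)
  also have "\<dots> = (\<integral>z. s * (fst z * \<phi> (1 * fst z + 0 * snd z)) + t * (snd z * \<phi> (fst z)) \<partial>gauss_pair)"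
  proof -
    have e: "s * (s * x + t * y) + t * (t * x - s * y) = x" for x y
    proof -
      have "s * (s * x + t * y) + t * (t * x - s * y) = (s\<^sup>2 + t\<^sup>2) * x"
        by (simp add: power2_eq_square algebra_simps)
      then show ?thesis by (simp add: st)
    qed
    show ?thesis unfolding e by (simp add: distrib_right mult.assoc)
  qed
  also have "\<dots> = s * (\<integral>z. fst z * \<phi> (1 * fst z + 0 * snd z) \<partial>gauss_pair) +
      t * (\<integral>z. snd z * \<phi> (fst z) \<partial>gauss_pair)"
  proof -
    have "integrable gauss_pair (\<lambda>z. snd z * \<phi> (fst z))"
      using integrable_product_swap[OF intP[of 0 1]] by (simp add: case_prod_unfold)
    then show ?thesis using intP[of 1 0] by simp
  qed
  also have "(\<integral>z. fst z * \<phi> (1 * fst z + 0 * snd z) \<partial>gauss_pair) = (\<integral>x. x * \<phi> x \<partial>std_gauss)"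
    using integral_fst'[OF intP[of 1 0]] by (simp add: std_gauss.prob_space[simplified])
  also have "(\<integral>z. snd z * \<phi> (fst z) \<partial>gauss_pair) = 0"
  proof -
    have "integrable gauss_pair (\<lambda>z. snd z * \<phi> (fst z))"
      using integrable_product_swap[OF intP[of 0 1]] by (simp add: case_prod_unfold)
    from integral_fst'[OF this] show ?thesis by (simp add: std_gauss_moments)
  qed
  finally show "(\<integral>g. g i * \<phi> (\<Sum>l\<in>I. u l * g l) \<partial>gauss_vector I) = u i * (\<integral>x. x * \<phi> x \<partial>std_gauss)"
    by (simp add: s_def)
qed

section \<open>Gaussian rounding\<close>

text \<open>The outer index is the coordinate in the target space of dimension \<open>k\<close>, so
  the \<open>k\<close> coordinates are the factors of the outer product and can be integrated out
  one by one.\<close>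

definition gauss_family :: "nat \<Rightarrow> nat \<Rightarrow> (nat \<Rightarrow> nat \<Rightarrow> real) measure" where
  "gauss_family k n = PiM {..<k} (\<lambda>_. gauss_vector {..<n})"

text \<open>Applied to the rows of a factor of \<open>X\<close>, this gives Gaussian vectors in
  dimension \<open>k\<close> whose inner products have mean \<open>k\<close> times the entries of
  \<open>X\<close>.\<close>

definition gauss_image :: "nat \<Rightarrow> nat \<Rightarrow> (nat \<Rightarrow> real) \<Rightarrow> (nat \<Rightarrow> nat \<Rightarrow> real) \<Rightarrow> nat \<Rightarrow> real" where
  "gauss_image k n u \<omega> = (\<lambda>m\<in>{..<k}. \<Sum>l<n. u l * \<omega> m l)"

interpretation gauss_family: product_sigma_finite "\<lambda>_. gauss_vector {..<n}" for n :: nat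
  by (intro product_sigma_finite.intro prob_space_imp_sigma_finite prob_space_gauss_vector)

lemma prob_space_gauss_family: "prob_space (gauss_family k n)"
  unfolding gauss_family_def by (rule prob_space_PiM) (rule prob_space_gauss_vector)

lemma gauss_vector_component_measurable:
  "i \<in> I \<Longrightarrow> (\<lambda>g. g i) \<in> borel_measurable (gauss_vector I)"
  using measurable_component_singleton[of i I "\<lambda>_. std_gauss"]
  unfolding measurable_cong_sets[OF refl sets_std_gauss] .

lemma gauss_image_measurable [measurable]:
  "gauss_image k n u \<in> measurable (gauss_family k n) (gauss_vector {..<k})"
  unfolding gauss_image_def
proof (rule measurable_restrict)
  fix m assume m: "m \<in> {..<k}"
  have "(\<lambda>\<omega>. \<omega> m l) \<in> borel_measurable (gauss_family k n)" if "l \<in> {..<n}" for l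
    unfolding gauss_family_def
    by (rule measurable_compose[OF measurable_component_singleton[OF m] gauss_vector_component_measurable[OF that]])
  then show "(\<lambda>\<omega>. \<Sum>l<n. u l * \<omega> m l) \<in> measurable (gauss_family k n) std_gauss"
    unfolding measurable_cong_sets[OF refl sets_std_gauss]
    by (intro borel_measurable_sum borel_measurable_times measurable_const) auto
qed

text \<open>Each rounded vector, taken alone, comes from a standard Gaussian vector. Integrals that
  involve a single index therefore do not depend on \<open>X\<close>.\<close>

lemma distr_gauss_image:
  assumes u: "(\<Sum>l<n. (u l)\<^sup>2) = 1"
  shows "distr (gauss_family k n) (gauss_vector {..<k}) (gauss_image k n u) = gauss_vector {..<k}"
proof -
  have "distr (gauss_family k n) (gauss_vector {..<k}) (compose {..<k} (\<lambda>g. \<Sum>l<n. u l * g l)) =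
      PiM {..<k} (\<lambda>_. distr (gauss_vector {..<n}) std_gauss (\<lambda>g. \<Sum>l<n. u l * g l))"
    unfolding gauss_family_def
    by (intro distr_PiM_finite_prob_space')
       (auto intro: prob_space_gauss_vector std_gauss.prob_space_axioms)
  also have "distr (gauss_vector {..<n}) std_gauss (\<lambda>g. \<Sum>l<n. u l * g l) =
      distr (gauss_vector {..<n}) borel (\<lambda>g. \<Sum>l<n. u l * g l)"
    by (rule distr_cong) auto
  also have "\<dots> = std_gauss" using u by (intro distr_gauss_vector_unit) auto
  also have "compose {..<k} (\<lambda>g. \<Sum>l<n. u l * g l) = gauss_image k n u"
    by (auto simp: compose_def gauss_image_def)
  finally show ?thesis .
qed

lemma integrable_gauss_image:
  assumes u: "(\<Sum>l<n. (u l)\<^sup>2) = 1" and h: "integrable (gauss_vector {..<k}) (h :: _ \<Rightarrow> real)"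
  shows "integrable (gauss_family k n) (\<lambda>\<omega>. h (gauss_image k n u \<omega>))"
  using h by (subst (asm) distr_gauss_image[OF u, symmetric], subst (asm) integrable_distr_eq) auto

lemma integral_gauss_image:
  assumes u: "(\<Sum>l<n. (u l)\<^sup>2) = 1" and h: "h \<in> borel_measurable (gauss_vector {..<k})"
  shows "(\<integral>\<omega>. h (gauss_image k n u \<omega>) \<partial>gauss_family k n) = (\<integral>y. (h y :: real) \<partial>gauss_vector {..<k})"
  by (subst distr_gauss_image[OF u, symmetric], subst integral_distr) (use h in auto)

text \<open>The other \<open>k - 1\<close> coordinates are frozen, and the scalar regression is
  applied in coordinate \<open>m\<close>.\<close>

lemma
  assumes m: "m < k" and u: "(\<Sum>l<n. (u l)\<^sup>2) = 1" and r: "(\<Sum>l<n. (r l)\<^sup>2) = 1"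
    and \<phi> [measurable]: "\<phi> \<in> borel_measurable (gauss_vector {..<k})"
    and growth: "\<And>y. \<bar>\<phi> y\<bar> \<le> A + B * \<bar>y m\<bar>" and B: "B \<ge> 0"
  shows integrable_gauss_image_regression:
      "integrable (gauss_family k n) (\<lambda>\<omega>. gauss_image k n r \<omega> m * \<phi> (gauss_image k n u \<omega>))"
    and gauss_image_regression:
      "(\<integral>\<omega>. gauss_image k n r \<omega> m * \<phi> (gauss_image k n u \<omega>) \<partial>gauss_family k n) =
        (\<Sum>l<n. r l * u l) * (\<integral>y. y m * \<phi> y \<partial>gauss_vector {..<k})"
proof -
  interpret F: prob_space "gauss_family k n" by (rule prob_space_gauss_family)
  have mk [simp]: "m \<in> {..<k}" using m by simp
  have integrable: "integrable (gauss_family k n) (\<lambda>\<omega>. gauss_image k n r \<omega> m * \<phi> (gauss_image k n u \<omega>))"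
    if r: "(\<Sum>l<n. (r l)\<^sup>2) = 1" for r
  proof (rule Bochner_Integration.integrable_bound)
    have "integrable (gauss_family k n) (\<lambda>\<omega>. (gauss_image k n w \<omega> m)\<^sup>2)"
      if "(\<Sum>l<n. (w l)\<^sup>2) = 1" for w
      using integrable_gauss_image[OF that integrable_gauss_vector_component[OF mk, of 2]] .
    then show "integrable (gauss_family k n) (\<lambda>\<omega>. \<bar>A\<bar> * (1 + (gauss_image k n r \<omega> m)\<^sup>2) +
        B * ((gauss_image k n r \<omega> m)\<^sup>2 + (gauss_image k n u \<omega> m)\<^sup>2))"
      using u r by (intro Bochner_Integration.integrable_add integrable_mult_right F.integrable_const) auto
    show "(\<lambda>\<omega>. gauss_image k n r \<omega> m * \<phi> (gauss_image k n u \<omega>)) \<in> borel_measurable (gauss_family k n)"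
      by (intro borel_measurable_times measurable_compose[OF gauss_image_measurable \<phi>]
          measurable_compose[OF gauss_image_measurable gauss_vector_component_measurable[OF mk]])
    show "AE \<omega> in gauss_family k n. norm (gauss_image k n r \<omega> m * \<phi> (gauss_image k n u \<omega>)) \<le>
       norm (\<bar>A\<bar> * (1 + (gauss_image k n r \<omega> m)\<^sup>2) +
        B * ((gauss_image k n r \<omega> m)\<^sup>2 + (gauss_image k n u \<omega> m)\<^sup>2))"
      unfolding real_norm_def
      by (intro AE_I2 order_trans[OF abs_mult_affine_bound[OF growth B] abs_ge_self])
  qed
  then show "integrable (gauss_family k n) (\<lambda>\<omega>. gauss_image k n r \<omega> m * \<phi> (gauss_image k n u \<omega>))"
    using r by blast
  define K where "K = {..<k} - {m}"
  have K: "{..<k} = insert m K" "finite K" "m \<notin> K" using m by (auto simp: K_def)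
  define y where "y \<omega> = (\<lambda>m'\<in>K. \<Sum>l<n. u l * \<omega> m' l)" for \<omega> :: "nat \<Rightarrow> nat \<Rightarrow> real"
  define G where "G \<omega> = (\<integral>x. x * \<phi> ((y \<omega>)(m := x)) \<partial>std_gauss)" for \<omega>
  have main: "(\<integral>\<omega>. gauss_image k n r \<omega> m * \<phi> (gauss_image k n u \<omega>) \<partial>gauss_family k n) =
      (\<Sum>l<n. r l * u l) * (\<integral>\<omega>. G \<omega> \<partial>PiM K (\<lambda>_. gauss_vector {..<n}))"
    if r: "(\<Sum>l<n. (r l)\<^sup>2) = 1" for r
  proof -
    have "(\<integral>\<omega>. gauss_image k n r \<omega> m * \<phi> (gauss_image k n u \<omega>) \<partial>gauss_family k n) =
      (\<integral>\<omega>. \<integral>g. gauss_image k n r ((\<omega>)(m := g)) m * \<phi> (gauss_image k n u ((\<omega>)(m := g)))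
         \<partial>gauss_vector {..<n} \<partial>PiM K (\<lambda>_. gauss_vector {..<n}))"
      using integrable[OF r] unfolding gauss_family_def K(1)
      by (intro gauss_family.product_integral_insert K)
    also have "\<dots> = (\<integral>\<omega>. (\<Sum>l<n. r l * u l) * G \<omega> \<partial>PiM K (\<lambda>_. gauss_vector {..<n}))"
    proof (rule Bochner_Integration.integral_cong[OF refl])
      fix \<omega> :: "nat \<Rightarrow> nat \<Rightarrow> real"
      define \<psi> where "\<psi> x = \<phi> ((y \<omega>)(m := x))" for x
      have "y \<omega> \<in> space (gauss_vector K)" by (simp add: space_PiM y_def)
      then have "(\<lambda>x. (y \<omega>)(m := x)) \<in> measurable std_gauss (gauss_vector (insert m K))"
        by (rule measurable_component_update) (fact K(3))
      then have \<psi>m: "\<psi> \<in> borel_measurable borel"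
        unfolding \<psi>_def using measurable_compose[OF _ \<phi>] unfolding K(1)[symmetric]
        by (simp add: measurable_cong_sets[OF sets_std_gauss refl])
      have \<psi>g: "\<bar>\<psi> x\<bar> \<le> A + B * \<bar>x\<bar>" for x
        using growth[of "(y \<omega>)(m := x)"] by (simp add: \<psi>_def)
      have "gauss_image k n u ((\<omega>)(m := g)) = (y \<omega>)(m := \<Sum>l<n. u l * g l)" for g
        unfolding gauss_image_def y_def using m by (auto simp: K_def restrict_def)
      then have "(\<integral>g. gauss_image k n r ((\<omega>)(m := g)) m * \<phi> (gauss_image k n u ((\<omega>)(m := g))) \<partial>gauss_vector {..<n}) =
          (\<integral>g. (\<Sum>l<n. r l * (g l * \<psi> (\<Sum>l<n. u l * g l))) \<partial>gauss_vector {..<n})"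
        using m by (simp add: gauss_image_def \<psi>_def sum_distrib_right mult.assoc)
      also have "\<dots> = (\<Sum>l<n. r l * (u l * (\<integral>x. x * \<psi> x \<partial>std_gauss)))"
        using integrable_gauss_regression[OF finite_lessThan _ u \<psi>m \<psi>g B]
          gauss_regression[OF finite_lessThan _ u \<psi>m \<psi>g B]
        by (subst Bochner_Integration.integral_sum) auto
      finally show "(\<integral>g. gauss_image k n r ((\<omega>)(m := g)) m * \<phi> (gauss_image k n u ((\<omega>)(m := g))) \<partial>gauss_vector {..<n}) =
          (\<Sum>l<n. r l * u l) * G \<omega>"
        by (simp add: G_def \<psi>_def sum_distrib_right mult.assoc)
    qed
    finally show ?thesis by simp
  qed
  \<comment> \<open>The case \<open>r = u\<close>, where the inner product is 1, identifies the
    remaining constant as an integral over one Gaussian vector.\<close>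
  have "(\<integral>\<omega>. G \<omega> \<partial>PiM K (\<lambda>_. gauss_vector {..<n})) =
      (\<integral>\<omega>. gauss_image k n u \<omega> m * \<phi> (gauss_image k n u \<omega>) \<partial>gauss_family k n)"
    using main[OF u] u by (simp add: power2_eq_square)
  also have "\<dots> = (\<integral>y. y m * \<phi> y \<partial>gauss_vector {..<k})"
    by (rule integral_gauss_image[OF u, of "\<lambda>y. y m * \<phi> y"]) (intro borel_measurable_times gauss_vector_component_measurable mk \<phi>)
  finally show "(\<integral>\<omega>. gauss_image k n r \<omega> m * \<phi> (gauss_image k n u \<omega>) \<partial>gauss_family k n) =
        (\<Sum>l<n. r l * u l) * (\<integral>y. y m * \<phi> y \<partial>gauss_vector {..<k})"
    using main[OF r] by simp
qed

lemma integral_triple_sum: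
  fixes h :: "'a \<Rightarrow> 'b \<Rightarrow> 'c \<Rightarrow> 'd \<Rightarrow> real"
  assumes h: "\<And>i j m. i \<in> A \<Longrightarrow> j \<in> B \<Longrightarrow> m \<in> C \<Longrightarrow> integrable M (h i j m)"
  shows "(\<integral>x. (\<Sum>i\<in>A. \<Sum>j\<in>B. \<Sum>m\<in>C. h i j m x) \<partial>M) =
    (\<Sum>i\<in>A. \<Sum>j\<in>B. \<Sum>m\<in>C. \<integral>x. h i j m x \<partial>M)"
proof -
  have "(\<integral>x. (\<Sum>i\<in>A. \<Sum>j\<in>B. \<Sum>m\<in>C. h i j m x) \<partial>M) =
      (\<Sum>i\<in>A. \<integral>x. (\<Sum>j\<in>B. \<Sum>m\<in>C. h i j m x) \<partial>M)"
    by (intro Bochner_Integration.integral_sum Bochner_Integration.integrable_sum h)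
  also have "\<dots> = (\<Sum>i\<in>A. \<Sum>j\<in>B. \<integral>x. (\<Sum>m\<in>C. h i j m x) \<partial>M)"
    by (intro sum.cong refl Bochner_Integration.integral_sum Bochner_Integration.integrable_sum h)
  also have "\<dots> = (\<Sum>i\<in>A. \<Sum>j\<in>B. \<Sum>m\<in>C. \<integral>x. h i j m x \<partial>M)"
    by (intro sum.cong refl Bochner_Integration.integral_sum h)
  finally show ?thesis .
qed

text \<open>With \<open>p\<close> the scaled Gaussian vector and \<open>a = p - f\<close>, every
  term of the product of two \<open>f\<close>'s other than the product of two \<open>a\<close>'s
  contains \<open>p\<close> and is proportional to \<open>X i j\<close> by regression. The factor is
  not computed: the unit diagonal forces it to be 1 - \<delta>. The best configuration in the finite
  set is at least as good as the average.\<close>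

lemma gauss_rounding:
  fixes f :: "(nat \<Rightarrow> real) \<Rightarrow> nat \<Rightarrow> real" and M :: "nat \<Rightarrow> nat \<Rightarrow> real"
  assumes k: "k > 0"
    and f [measurable]: "\<And>m. m < k \<Longrightarrow> (\<lambda>y. f y m) \<in> borel_measurable (gauss_vector {..<k})"
    and unit: "\<And>y. (\<Sum>m<k. (f y m)\<^sup>2) = 1" and T: "finite T" "\<And>y. f y \<in> T"
    and \<delta>: "\<delta> = (\<integral>y. (\<Sum>m<k. (y m / sqrt k - f y m)\<^sup>2) \<partial>gauss_vector {..<k})"
  shows "\<exists>\<tau>\<in>PiE {..<n} (\<lambda>_. T). (1 - \<delta>) * sdp n M - \<delta> * sdp n (\<lambda>i j. - M i j) \<le> trace_prod n M (gram k \<tau>)"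
proof (cases "n = 0")
  case True
  obtain X Y where "sdp n M = trace_prod n M X" "sdp n (\<lambda>i j. - M i j) = trace_prod n (\<lambda>i j. - M i j) Y"
    using sdp_attained by metis
  then show ?thesis using True by (auto simp: trace_prod_def)
next
  case False
  interpret F: prob_space "gauss_family k n" by (rule prob_space_gauss_family)
  obtain X where X: "X \<in> elliptope n" "sdp n M = trace_prod n M X" using sdp_attained by blast
  then obtain U where U: "\<And>i j. i < n \<Longrightarrow> j < n \<Longrightarrow> X i j = (\<Sum>l<n. U i l * U j l)"
    using pos_semidef_imp_gram[of n X] by (auto simp: elliptope_def gram_def)
  have U1: "(\<Sum>l<n. (U i l)\<^sup>2) = 1" if "i < n" for i
    using U[OF that that] X(1) that by (simp add: elliptope_def power2_eq_square)
  define Y where "Y i = gauss_image k n (U i)" for i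
  define a where "a m y = y m / sqrt k - f y m" for m y
  have fb: "\<bar>f y m\<bar> \<le> 1" if "m < k" for y m
  proof -
    have "(f y m)\<^sup>2 \<le> (\<Sum>m<k. (f y m)\<^sup>2)" using that by (intro member_le_sum) auto
    then show ?thesis by (simp add: unit abs_square_le_1)
  qed
  have am [measurable]: "a m \<in> borel_measurable (gauss_vector {..<k})" if "m < k" for m
    unfolding a_def using that
    by (intro borel_measurable_diff borel_measurable_divide gauss_vector_component_measurable f
        borel_measurable_const) auto
  have ab: "\<bar>a m y\<bar> \<le> 1 + 1 / sqrt k * \<bar>y m\<bar>" if "m < k" for m y
  proof -
    have "\<bar>a m y\<bar> \<le> \<bar>y m / sqrt k\<bar> + \<bar>f y m\<bar>" unfolding a_def by (rule abs_triangle_ineq4)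
    then show ?thesis using fb[OF that, of y] by simp
  qed
  define p where "p m y = y m / sqrt k" for m and y :: "nat \<Rightarrow> real"
  have pm: "p m \<in> borel_measurable (gauss_vector {..<k})" if "m < k" for m
    unfolding p_def using that
    by (intro borel_measurable_divide gauss_vector_component_measurable borel_measurable_const) auto
  have pb: "\<bar>p m y\<bar> \<le> 0 + 1 / sqrt k * \<bar>y m\<bar>" for m y by (simp add: p_def)
  have Ym [measurable]: "Y i \<in> measurable (gauss_family k n) (gauss_vector {..<k})" for i
    unfolding Y_def by measurable
  \<comment> \<open>The contribution of coordinate \<open>m\<close> to the factor of
    \<open>X i j\<close>, read off from f f = a a + p p - p a - a p.\<close>
  define \<kappa> where "\<kappa> m = ((\<integral>y. y m * p m y \<partial>gauss_vector {..<k}) - 2 * (\<integral>y. y m * a m y \<partial>gauss_vector {..<k})) / sqrt k" for m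
  define D where "D i j = (\<Sum>m<k. \<integral>\<omega>. a m (Y i \<omega>) * a m (Y j \<omega>) \<partial>gauss_family k n)" for i j
  have reg: "integrable (gauss_family k n) (\<lambda>\<omega>. p m (Y i \<omega>) * \<phi> (Y j \<omega>))"
    "(\<integral>\<omega>. p m (Y i \<omega>) * \<phi> (Y j \<omega>) \<partial>gauss_family k n) =
       X i j * (\<integral>y. y m * \<phi> y \<partial>gauss_vector {..<k}) / sqrt k"
    if "i < n" "j < n" "m < k" "\<phi> \<in> borel_measurable (gauss_vector {..<k})"
      "\<And>y. \<bar>\<phi> y\<bar> \<le> A + 1 / sqrt k * \<bar>y m\<bar>" for i j m \<phi> A
    using integrable_gauss_image_regression[OF that(3) U1[OF that(2)] U1[OF that(1)] that(4,5)]
      gauss_image_regression[OF that(3) U1[OF that(2)] U1[OF that(1)] that(4,5)] U[OF that(1,2)]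
    by (simp_all add: p_def Y_def)
  have fint: "integrable (gauss_family k n) (\<lambda>\<omega>. f (Y i \<omega>) m * f (Y j \<omega>) m)" if "m < k" for i j m
  proof (rule F.integrable_const_bound[of _ 1])
    show "AE \<omega> in gauss_family k n. norm (f (Y i \<omega>) m * f (Y j \<omega>) m) \<le> 1"
      using fb[OF that] by (intro AE_I2) (simp add: abs_mult mult_le_one)
    have "(\<lambda>\<omega>. f (Y i \<omega>) m) \<in> borel_measurable (gauss_family k n)" for i
      using measurable_compose[OF Ym f[OF that]] .
    then show "(\<lambda>\<omega>. f (Y i \<omega>) m * f (Y j \<omega>) m) \<in> borel_measurable (gauss_family k n)" by measurable
  qed
  have aint: "integrable (gauss_family k n) (\<lambda>\<omega>. a m (Y i \<omega>) * a m (Y j \<omega>))"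
    and fval: "(\<integral>\<omega>. f (Y i \<omega>) m * f (Y j \<omega>) m \<partial>gauss_family k n) =
      X i j * \<kappa> m + (\<integral>\<omega>. a m (Y i \<omega>) * a m (Y j \<omega>) \<partial>gauss_family k n)"
    if ij: "i < n" "j < n" and m: "m < k" for i j m
  proof -
    have sym: "X j i = X i j" using X(1) ij by (simp add: elliptope_def pos_semidef_def)
    note pp = reg[OF ij m pm[OF m] pb] and pa = reg[OF ij m am[OF m] ab[OF m]]
      and ap = reg[OF ij(2,1) m am[OF m] ab[OF m]]
    have eq: "a m (Y i \<omega>) * a m (Y j \<omega>) = f (Y i \<omega>) m * f (Y j \<omega>) m - p m (Y i \<omega>) * p m (Y j \<omega>)
        + p m (Y i \<omega>) * a m (Y j \<omega>) + p m (Y j \<omega>) * a m (Y i \<omega>)" for \<omega>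
      by (simp add: a_def p_def algebra_simps)
    show "integrable (gauss_family k n) (\<lambda>\<omega>. a m (Y i \<omega>) * a m (Y j \<omega>))"
      unfolding eq using fint[OF m] pp(1) pa(1) ap(1)
      by (intro Bochner_Integration.integrable_add Bochner_Integration.integrable_diff)
    have "(\<integral>\<omega>. a m (Y i \<omega>) * a m (Y j \<omega>) \<partial>gauss_family k n) =
      (\<integral>\<omega>. f (Y i \<omega>) m * f (Y j \<omega>) m \<partial>gauss_family k n) - (\<integral>\<omega>. p m (Y i \<omega>) * p m (Y j \<omega>) \<partial>gauss_family k n)
        + (\<integral>\<omega>. p m (Y i \<omega>) * a m (Y j \<omega>) \<partial>gauss_family k n) + (\<integral>\<omega>. p m (Y j \<omega>) * a m (Y i \<omega>) \<partial>gauss_family k n)"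
      unfolding eq using fint[OF m] pp(1) pa(1) ap(1) by simp
    then show "(\<integral>\<omega>. f (Y i \<omega>) m * f (Y j \<omega>) m \<partial>gauss_family k n) =
      X i j * \<kappa> m + (\<integral>\<omega>. a m (Y i \<omega>) * a m (Y j \<omega>) \<partial>gauss_family k n)"
      unfolding pp(2) pa(2) ap(2) sym by (simp add: \<kappa>_def algebra_simps diff_divide_distrib)
  qed
  have D: "pos_semidef n D"
    unfolding pos_semidef_def
  proof (intro conjI allI impI)
    show "D i j = D j i" for i j by (simp add: D_def mult.commute)
    fix v :: "nat \<Rightarrow> real"
    have "(\<Sum>i<n. \<Sum>j<n. v i * D i j * v j) =
       (\<Sum>i<n. \<Sum>j<n. \<Sum>m<k. \<integral>\<omega>. v i * v j * (a m (Y i \<omega>) * a m (Y j \<omega>)) \<partial>gauss_family k n)"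
      by (intro sum.cong refl) (simp add: D_def sum_distrib_left sum_distrib_right mult_ac)
    also have "\<dots> = (\<integral>\<omega>. (\<Sum>i<n. \<Sum>j<n. \<Sum>m<k. v i * v j * (a m (Y i \<omega>) * a m (Y j \<omega>))) \<partial>gauss_family k n)"
      by (subst integral_triple_sum) (auto intro: aint)
    also have "\<dots> = (\<integral>\<omega>. (\<Sum>i<n. \<Sum>j<n. v i * gram k (\<lambda>i m. a m (Y i \<omega>)) i j * v j) \<partial>gauss_family k n)"
      by (simp add: gram_def sum_distrib_left sum_distrib_right mult_ac)
    also have "\<dots> \<ge> 0"
      unfolding gram_quadratic_form by (intro Bochner_Integration.integral_nonneg sum_nonneg) auto
    finally show "0 \<le> (\<Sum>i<n. \<Sum>j<n. v i * D i j * v j)" .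
  qed
  have diag: "D i i = \<delta>" if "i < n" for i
  proof -
    have "D i i = (\<integral>\<omega>. (\<Sum>m<k. (a m (Y i \<omega>))\<^sup>2) \<partial>gauss_family k n)"
      unfolding D_def using aint that
      by (subst Bochner_Integration.integral_sum) (auto simp: power2_eq_square)
    also have "\<dots> = (\<integral>y. (\<Sum>m<k. (a m y)\<^sup>2) \<partial>gauss_vector {..<k})"
      unfolding Y_def by (rule integral_gauss_image[OF U1[OF that], of "\<lambda>y. \<Sum>m<k. (a m y)\<^sup>2"]) measurable
    finally show ?thesis by (simp add: \<delta> a_def)
  qed
  have \<delta>0: "\<delta> \<ge> 0" unfolding \<delta> by (intro Bochner_Integration.integral_nonneg sum_nonneg) auto
  have \<kappa>: "(\<Sum>m<k. \<kappa> m) = 1 - \<delta>"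
  proof -
    \<comment> \<open>The diagonal is evaluated at index 0, which is why \<open>n = 0\<close> was
      treated apart.\<close>
    have 0: "0 < n" using False by simp
    have "1 = (\<integral>\<omega>. (\<Sum>m<k. f (Y 0 \<omega>) m * f (Y 0 \<omega>) m) \<partial>gauss_family k n)"
      using unit by (simp add: power2_eq_square[symmetric] F.prob_space)
    also have "\<dots> = (\<Sum>m<k. X 0 0 * \<kappa> m + (\<integral>\<omega>. a m (Y 0 \<omega>) * a m (Y 0 \<omega>) \<partial>gauss_family k n))"
      using fint fval[OF 0 0] by (subst Bochner_Integration.integral_sum) auto
    also have "\<dots> = (\<Sum>m<k. \<kappa> m) + D 0 0"
      using X(1) 0 by (simp add: elliptope_def sum.distrib D_def)
    finally show ?thesis using diag[OF 0] by simp
  qed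
  define tr where "tr \<omega> = trace_prod n M (gram k (\<lambda>i\<in>{..<n}. f (Y i \<omega>)))" for \<omega>
  have "(\<integral>\<omega>. tr \<omega> \<partial>gauss_family k n) =
      (\<integral>\<omega>. (\<Sum>i<n. \<Sum>j<n. \<Sum>m<k. M i j * (f (Y j \<omega>) m * f (Y i \<omega>) m)) \<partial>gauss_family k n)"
    by (simp add: tr_def trace_prod_def gram_def sum_distrib_left)
  also have "\<dots> = (\<Sum>i<n. \<Sum>j<n. \<Sum>m<k. M i j * (\<integral>\<omega>. f (Y j \<omega>) m * f (Y i \<omega>) m \<partial>gauss_family k n))"
    by (subst integral_triple_sum) (auto intro: fint)
  also have "\<dots> = (\<Sum>i<n. \<Sum>j<n. M i j * (X j i * (\<Sum>m<k. \<kappa> m) + D j i))"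
    by (intro sum.cong refl) (simp add: fval D_def sum_distrib_left[symmetric] sum.distrib)
  also have "\<dots> = (1 - \<delta>) * sdp n M + trace_prod n M D"
    unfolding X(2) \<kappa> by (simp add: trace_prod_def distrib_left sum.distrib sum_distrib_left mult_ac)
  finally have tr: "(\<integral>\<omega>. tr \<omega> \<partial>gauss_family k n) = (1 - \<delta>) * sdp n M + trace_prod n M D" .
  have "trace_prod n M D \<ge> - (\<delta> * sdp n (\<lambda>i j. - M i j))"
    using trace_prod_constant_diagonal_le[OF D diag \<delta>0, of "\<lambda>i j. - M i j"]
    by (simp add: trace_prod_uminus_left)
  with tr have E: "(1 - \<delta>) * sdp n M - \<delta> * sdp n (\<lambda>i j. - M i j) \<le> (\<integral>\<omega>. tr \<omega> \<partial>gauss_family k n)"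
    by linarith
  have fin: "finite (PiE {..<n} (\<lambda>_. T))" using T by (intro finite_PiE) auto
  have mem: "(\<lambda>i\<in>{..<n}. f (Y i \<omega>)) \<in> PiE {..<n} (\<lambda>_. T)" for \<omega> using T by auto
  define V where "V = Max ((\<lambda>\<tau>. trace_prod n M (gram k \<tau>)) ` PiE {..<n} (\<lambda>_. T))"
  have ne: "PiE {..<n} (\<lambda>_. T) \<noteq> {}" using mem by blast
  then obtain \<tau> where \<tau>: "\<tau> \<in> PiE {..<n} (\<lambda>_. T)" "V = trace_prod n M (gram k \<tau>)"
    using Max_in[of "(\<lambda>\<tau>. trace_prod n M (gram k \<tau>)) ` PiE {..<n} (\<lambda>_. T)"] fin
    unfolding V_def by blast
  have "tr \<omega> \<le> V" for \<omega>
    unfolding tr_def V_def using mem fin by (intro Max_ge) auto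
  moreover have "integrable (gauss_family k n) tr"
  proof -
    have "tr = (\<lambda>\<omega>. \<Sum>i<n. \<Sum>j<n. \<Sum>m<k. M i j * (f (Y j \<omega>) m * f (Y i \<omega>) m))"
      by (auto simp: tr_def trace_prod_def gram_def sum_distrib_left)
    then show ?thesis using fint by (auto intro!: Bochner_Integration.integrable_sum)
  qed
  ultimately have "(\<integral>\<omega>. tr \<omega> \<partial>gauss_family k n) \<le> V"
    by (intro F.integral_le_const) auto
  with E \<tau> show ?thesis by (intro bexI[of _ \<tau>]) auto
qed

section \<open>Rounding to a finite set of unit vectors\<close>

text \<open>The variables \<open>z (y m)\<close> are independent and centred with second moment 3 -
  2 + 1 = 2, so only the \<open>k\<close> diagonal terms of the squared sum contribute.\<close>

lemma gauss_vector_norm_concentration: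
  assumes I: "finite I" "card I = k" "k > 0"
  shows "integrable (gauss_vector I) (\<lambda>y. ((\<Sum>m\<in>I. (y m)\<^sup>2) / k - 1)\<^sup>2)"
    and "(\<integral>y. ((\<Sum>m\<in>I. (y m)\<^sup>2) / k - 1)\<^sup>2 \<partial>gauss_vector I) = 2 / k"
proof -
  interpret V: prob_space "gauss_vector I" by (rule prob_space_gauss_vector)
  define z where "z x = x\<^sup>2 - 1" for x :: real
  have zz: "z x * z x = x ^ 4 - 2 * x ^ 2 + 1" for x
    by (simp add: z_def power2_eq_square power4_eq_xxxx algebra_simps)
  have iz: "integrable std_gauss z" "integrable std_gauss (\<lambda>x. z x * z x)"
    unfolding zz unfolding z_def
    by (intro Bochner_Integration.integrable_add Bochner_Integration.integrable_diff integrable_mult_right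
        integrable_std_gauss_power std_gauss.integrable_const)+
  have Ez: "(\<integral>x. z x \<partial>std_gauss) = 0" "(\<integral>x. z x * z x \<partial>std_gauss) = 2"
    unfolding zz unfolding z_def
    by (simp_all add: integrable_std_gauss_power std_gauss_moments std_gauss.prob_space[simplified])
  have pair: "integrable (gauss_vector I) (\<lambda>y. z (y m) * z (y m'))"
    "(\<integral>y. z (y m) * z (y m') \<partial>gauss_vector I) = (if m = m' then 2 else 0)"
    if m: "m \<in> I" "m' \<in> I" for m m'
  proof -
    \<comment> \<open>Writes a product of two factors, possibly at the same coordinate, as a product
      over all of \<open>I\<close>.\<close>
    define g where "g i x = (if i = m then z x else 1) * (if i = m' then z x else 1)" for i x
    have ig: "integrable std_gauss (g i)" for i
      using iz by (cases "i = m"; cases "i = m'") (simp_all add: g_def[abs_def])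
    have prod: "(\<Prod>i\<in>I. g i (y i)) = z (y m) * z (y m')" for y :: "_ \<Rightarrow> real"
      using m I by (simp add: g_def prod.distrib)
    show "integrable (gauss_vector I) (\<lambda>y. z (y m) * z (y m'))"
      using gauss_vector.product_integrable_prod[of I g, OF I(1) ig] by (simp add: prod)
    have "(\<integral>y. z (y m) * z (y m') \<partial>gauss_vector I) = (\<Prod>i\<in>I. \<integral>x. g i x \<partial>std_gauss)"
      using gauss_vector.product_integral_prod[of I g, OF I(1) ig] by (simp add: prod)
    also have "\<dots> = (if m = m' then 2 else 0)"
    proof (cases "m = m'")
      case True
      have e2: "(\<integral>x. g i x \<partial>std_gauss) = (if i = m then 2 else 1)" for i
      proof (cases "i = m")
        case True
        then have e: "g i = (\<lambda>x. z x * z x)" using \<open>m = m'\<close> by (simp add: g_def[abs_def])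
        show ?thesis unfolding e Ez(2) using True by simp
      next
        case False
        then have e: "g i = (\<lambda>x. 1)" using \<open>m = m'\<close> by (simp add: g_def[abs_def])
        show ?thesis unfolding e using False by (simp add: std_gauss.prob_space[simplified])
      qed
      then have "(\<Prod>i\<in>I. \<integral>x. g i x \<partial>std_gauss) = (\<Prod>i\<in>I. if i = m then 2 else 1)"
        by (simp only: e2)
      also have "\<dots> = 2" by (subst prod.delta[OF I(1)]) (use m in simp)
      finally show ?thesis using True by simp
    next
      case False
      then have "g m = z" by (simp add: g_def[abs_def])
      then have "(\<integral>x. g m x \<partial>std_gauss) = 0" using Ez(1) by simp
      then have "\<exists>i\<in>I. (\<integral>x. g i x \<partial>std_gauss) = 0" using m(1) by blast
      then have "(\<Prod>i\<in>I. \<integral>x. g i x \<partial>std_gauss) = 0" by (rule prod_zero[OF I(1)])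
      then show ?thesis using False by simp
    qed
    finally show "(\<integral>y. z (y m) * z (y m') \<partial>gauss_vector I) = (if m = m' then 2 else 0)" .
  qed
  have eq: "((\<Sum>m\<in>I. (y m)\<^sup>2) / k - 1)\<^sup>2 = (\<Sum>m\<in>I. \<Sum>m'\<in>I. z (y m) * z (y m')) / k\<^sup>2" for y
  proof -
    have "(\<Sum>m\<in>I. (y m)\<^sup>2) / k - 1 = (\<Sum>m\<in>I. z (y m)) / k"
      using I by (simp add: z_def sum_subtractf diff_divide_distrib)
    then show ?thesis by (simp add: power_divide power2_eq_square sum_product)
  qed
  show "integrable (gauss_vector I) (\<lambda>y. ((\<Sum>m\<in>I. (y m)\<^sup>2) / k - 1)\<^sup>2)"
    unfolding eq using pair(1) by (intro integrable_divide_zero Bochner_Integration.integrable_sum) auto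
  have "(\<integral>y. (\<Sum>m\<in>I. \<Sum>m'\<in>I. z (y m) * z (y m')) \<partial>gauss_vector I) = (\<Sum>m\<in>I. \<Sum>m'\<in>I. if m = m' then 2 else 0)"
    using pair by (simp add: Bochner_Integration.integral_sum Bochner_Integration.integrable_sum)
  also have "\<dots> = 2 * real k" using I by simp
  finally show "(\<integral>y. ((\<Sum>m\<in>I. (y m)\<^sup>2) / k - 1)\<^sup>2 \<partial>gauss_vector I) = 2 / k"
    unfolding eq using I by (simp add: power2_eq_square)
qed

text \<open>The zero vector is sent to the first basis vector, so that the result is a unit vector
  in every case with \<open>k > 0\<close>.\<close>

definition normalize_vec :: "nat \<Rightarrow> (nat \<Rightarrow> int) \<Rightarrow> nat \<Rightarrow> real" where
  "normalize_vec k t = (if \<forall>m<k. t m = 0 then (\<lambda>m. of_bool (m = 0))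
     else (\<lambda>m. real_of_int (t m) / sqrt (\<Sum>m<k. (real_of_int (t m))\<^sup>2)))"

definition sphere_net :: "nat \<Rightarrow> (nat \<Rightarrow> real) set" where
  "sphere_net k = normalize_vec k ` PiE {..<k} (\<lambda>_. {- 2 * int k..2 * int k})"

text \<open>Since \<open>sqrt k * y m\<close> is \<open>k\<close> times the scaled coordinate
  \<open>y m / sqrt k\<close>, taking floors rounds the scaled vector to a grid of mesh
  \<open>1 / k\<close>, at a distance of at most \<open>1 / sqrt k\<close>. The range
  \<open>2 * k\<close> admits scaled coordinates of size about 2; beyond it a default point of the
  net is taken.\<close>

definition sphere_round :: "nat \<Rightarrow> (nat \<Rightarrow> real) \<Rightarrow> nat \<Rightarrow> real" where
  "sphere_round k y = normalize_vec k
     (if \<forall>m<k. \<lfloor>sqrt k * y m\<rfloor> \<in> {- 2 * int k..2 * int k} then (\<lambda>m\<in>{..<k}. \<lfloor>sqrt k * y m\<rfloor>) else (\<lambda>m\<in>{..<k}. 0))"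

lemma normalize_vec_unit:
  assumes "k > 0"
  shows "(\<Sum>m<k. (normalize_vec k t m)\<^sup>2) = 1"
proof (cases "\<forall>m<k. t m = 0")
  case True
  then show ?thesis using assms by (simp add: normalize_vec_def of_bool_def if_distrib[of "\<lambda>x. x\<^sup>2"] sum.If_cases)
next
  case False
  then obtain m where "m < k" "t m \<noteq> 0" by blast
  then have "(\<Sum>m<k. (real_of_int (t m))\<^sup>2) > 0"
    by (intro sum_pos2[of _ m]) auto
  moreover have "normalize_vec k t = (\<lambda>m. real_of_int (t m) / sqrt (\<Sum>m<k. (real_of_int (t m))\<^sup>2))"
    unfolding normalize_vec_def using False by (rule if_not_P)
  ultimately show ?thesis by (simp add: power_divide sum_divide_distrib[symmetric])
qed

lemma sphere_net_unit: "k > 0 \<Longrightarrow> t \<in> sphere_net k \<Longrightarrow> (\<Sum>m<k. (t m)\<^sup>2) = 1"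
  unfolding sphere_net_def using normalize_vec_unit by blast

lemma finite_sphere_net: "finite (sphere_net k)"
  unfolding sphere_net_def by (intro finite_imageI finite_PiE) auto

lemma sphere_round_in_net: "sphere_round k y \<in> sphere_net k"
  unfolding sphere_round_def sphere_net_def
proof (rule imageI)
  show "(if \<forall>m<k. \<lfloor>sqrt k * y m\<rfloor> \<in> {- 2 * int k..2 * int k} then (\<lambda>m\<in>{..<k}. \<lfloor>sqrt k * y m\<rfloor>) else (\<lambda>m\<in>{..<k}. 0))
      \<in> PiE {..<k} (\<lambda>_. {- 2 * int k..2 * int k})"
  proof (cases "\<forall>m<k. \<lfloor>sqrt k * y m\<rfloor> \<in> {- 2 * int k..2 * int k}")
    case True
    then show ?thesis unfolding if_P[OF True] restrict_PiE_iff by blast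
  next
    case False
    then show ?thesis unfolding if_not_P[OF False] restrict_PiE_iff by simp
  qed
qed

lemma sphere_net_nonempty: "sphere_net k \<noteq> {}"
  using sphere_round_in_net by blast

lemma card_sphere_net_le:
  assumes "k > 0"
  shows "ln (card (sphere_net k)) \<le> k * ln (5 * k)"
proof -
  have "card (sphere_net k) \<le> card (PiE {..<k} (\<lambda>_. {- 2 * int k..2 * int k}))"
    unfolding sphere_net_def by (intro card_image_le finite_PiE) auto
  also have "\<dots> = (4 * k + 1) ^ k" by (simp add: card_PiE nat_add_distrib nat_mult_distrib)
  also have "\<dots> \<le> (5 * k) ^ k" using assms by (intro power_mono) auto
  finally have "real (card (sphere_net k)) \<le> real ((5 * k) ^ k)" by (simp only: of_nat_le_iff)
  moreover have "card (sphere_net k) > 0"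
    using finite_sphere_net sphere_net_nonempty by (simp add: card_gt_0_iff)
  ultimately have "ln (card (sphere_net k)) \<le> ln (real ((5 * k) ^ k))" by (intro ln_mono) auto
  also have "\<dots> = k * ln (real (5 * k))"
    unfolding of_nat_power by (subst ln_realpow) (use assms in auto)
  finally show ?thesis by simp
qed

text \<open>The grid costs \<open>1 / sqrt k\<close>, and normalizing costs
  \<open>\<bar>N / k - 1\<bar>\<close>, at most \<open>1 / sqrt k + \<bar>S - 1\<bar>\<close>;
  squaring gives \<open>8 / k + 2 * (S - 1)\<^sup>2\<close>. The generous 36 covers the exceptional
  cases in which \<open>S\<close> is far from 1 and only the crude bound \<open>2 * S + 2\<close> is
  at hand.\<close>

lemma sphere_round_error:
  fixes y :: "nat \<Rightarrow> real"
  assumes k: "k > 0"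
  defines "S \<equiv> (\<Sum>m<k. (y m)\<^sup>2) / k"
  shows "(\<Sum>m<k. (y m / sqrt k - sphere_round k y m)\<^sup>2) \<le> 8 / k + 36 * (S - 1)\<^sup>2"
proof -
  define f where "f = sphere_round k y"
  define q where "q m = \<lfloor>sqrt k * y m\<rfloor>" for m
  define Q where "Q = (S - 1)\<^sup>2"
  have Q0: "Q \<ge> 0" by (simp add: Q_def)
  have S0: "S \<ge> 0" by (simp add: S_def sum_nonneg)
  have Sk: "(\<Sum>m<k. (y m / sqrt k)\<^sup>2) = S"
    by (simp add: S_def power_divide sum_divide_distrib)
  have f1: "(\<Sum>m<k. (f m)\<^sup>2) = 1"
    unfolding f_def by (rule sphere_net_unit[OF k sphere_round_in_net])
  have crude: "(\<Sum>m<k. (y m / sqrt k - f m)\<^sup>2) \<le> 2 * S + 2"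
  proof -
    have "(\<Sum>m<k. (y m / sqrt k - f m)\<^sup>2) \<le> (\<Sum>m<k. 2 * (y m / sqrt k)\<^sup>2 + 2 * (f m)\<^sup>2)"
    proof (intro sum_mono)
      fix m
      have "0 \<le> (y m / sqrt k + f m)\<^sup>2" by simp
      then show "(y m / sqrt k - f m)\<^sup>2 \<le> 2 * (y m / sqrt k)\<^sup>2 + 2 * (f m)\<^sup>2"
        unfolding power2_sum power2_diff by linarith
    qed
    also have "\<dots> = 2 * S + 2" by (simp add: sum.distrib sum_distrib_left[symmetric] Sk f1)
    finally show ?thesis .
  qed
  show ?thesis
  proof (cases "\<forall>m<k. q m \<in> {- 2 * int k..2 * int k}")
    case False
    \<comment> \<open>One coordinate outside the grid already forces
      \<open>S \<ge> 4\<close>.\<close>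
    then obtain m where m: "m < k" and "q m > 2 * int k \<or> q m < - 2 * int k" by auto
    then have "2 * real k \<le> \<bar>sqrt k * y m\<bar>" unfolding q_def by linarith
    then have "(2 * real k)\<^sup>2 \<le> \<bar>sqrt k * y m\<bar>\<^sup>2" by (intro power_mono) auto
    then have "real k * (4 * real k) \<le> real k * (y m)\<^sup>2"
      by (simp add: power_mult_distrib) (simp add: power2_eq_square)
    then have "4 * real k \<le> (y m)\<^sup>2" using k by simp
    also have "\<dots> \<le> (\<Sum>m<k. (y m)\<^sup>2)" using m by (intro member_le_sum) auto
    finally have "4 \<le> S" using k by (simp add: S_def field_simps)
    then have "3 * (S - 1) \<le> Q"
      unfolding Q_def power2_eq_square by (intro mult_right_mono) auto
    then have "2 * S + 2 \<le> 36 * Q" using \<open>4 \<le> S\<close> by simp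
    moreover have "8 / real k \<ge> 0" by simp
    ultimately show ?thesis using crude unfolding f_def Q_def[symmetric] by linarith
  next
    case True
    then have f: "f = normalize_vec k (\<lambda>m\<in>{..<k}. q m)"
      by (simp add: f_def sphere_round_def q_def[abs_def])
    show ?thesis
    proof (cases "\<forall>m<k. q m = 0")
      case True
      \<comment> \<open>If all floors vanish then \<open>S \<le> 1 / k\<close>, which is far from 1
        unless \<open>k = 1\<close>; in that case the term \<open>8 / k\<close> is enough.\<close>
      have "(y m)\<^sup>2 \<le> 1 / k" if "m < k" for m
      proof -
        have "0 \<le> sqrt k * y m" "sqrt k * y m \<le> 1" using True that unfolding q_def by (auto simp: floor_eq_iff)
        then have "(sqrt k * y m)\<^sup>2 \<le> 1\<^sup>2" by (intro power_mono) auto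
        then show ?thesis using k by (simp add: power_mult_distrib field_simps)
      qed
      then have "(\<Sum>m<k. (y m)\<^sup>2) \<le> (\<Sum>m<k. 1 / k)" by (intro sum_mono) auto
      then have "S \<le> 1 / k" using k by (simp add: S_def divide_right_mono)
      show ?thesis
      proof (cases "k = 1")
        case True
        then have "2 * S + 2 \<le> 8 / k" using \<open>S \<le> 1 / k\<close> by simp
        then show ?thesis using crude Q0 unfolding f_def Q_def[symmetric] by linarith
      next
        case False
        then have "1 / real k \<le> 1 / 2" using k by (intro divide_left_mono) auto
        with \<open>S \<le> 1 / k\<close> have S2: "S \<le> 1 / 2" by simp
        then have "(1 / 2)\<^sup>2 \<le> (1 - S)\<^sup>2" by (intro power_mono) auto
        moreover have "(1 - S)\<^sup>2 = Q" unfolding Q_def by (rule power2_commute)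
        ultimately have "1 / 4 \<le> Q" by (simp add: power_divide)
        then have "2 * S + 2 \<le> 36 * Q" using S2 by linarith
        moreover have "8 / real k \<ge> 0" by simp
        ultimately show ?thesis using crude unfolding f_def Q_def[symmetric] by linarith
      qed
    next
      case False
      define N where "N = L2_set (\<lambda>m. real_of_int (q m)) {..<k}"
      have N: "N > 0"
      proof -
        obtain m where "m < k" "q m \<noteq> 0" using False by blast
        then have "(\<Sum>m<k. (real_of_int (q m))\<^sup>2) > 0" by (intro sum_pos2[of _ m]) auto
        then show ?thesis by (simp add: N_def L2_set_def)
      qed
      have fq: "f m = q m / N" if "m < k" for m
      proof -
        have "f = (\<lambda>m. real_of_int ((\<lambda>m\<in>{..<k}. q m) m) /
            sqrt (\<Sum>m<k. (real_of_int ((\<lambda>m\<in>{..<k}. q m) m))\<^sup>2))"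
          unfolding f normalize_vec_def by (rule if_not_P) (use False in auto)
        then show ?thesis using that by (simp add: N_def L2_set_def)
      qed
      have d: "L2_set (\<lambda>m. y m / sqrt k - q m / k) {..<k} \<le> 1 / sqrt k"
      proof -
        have "(y m / sqrt k - q m / k)\<^sup>2 \<le> 1 / k\<^sup>2" for m
        proof -
          have e: "y m / sqrt k - q m / k = (sqrt k * y m - q m) / k"
          proof -
            have "y m / sqrt k = (sqrt k * y m) / (sqrt k * sqrt k)"
              by (rule mult_divide_mult_cancel_left[symmetric]) (use k in simp)
            then show ?thesis by (simp add: diff_divide_distrib)
          qed
          have "0 \<le> sqrt k * y m - q m" "sqrt k * y m - q m \<le> 1" unfolding q_def by linarith+
          then have "(sqrt k * y m - q m)\<^sup>2 \<le> 1\<^sup>2" by (intro power_mono)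
          then show ?thesis unfolding e power_divide using k by (simp add: divide_right_mono)
        qed
        then have "(\<Sum>m<k. (y m / sqrt k - q m / k)\<^sup>2) \<le> (\<Sum>m<k. 1 / k\<^sup>2)" by (intro sum_mono)
        also have "\<dots> = 1 / k" using k by (simp add: power2_eq_square)
        finally have "sqrt (\<Sum>m<k. (y m / sqrt k - q m / k)\<^sup>2) \<le> sqrt (1 / k)" by simp
        then show ?thesis by (simp add: L2_set_def real_sqrt_divide)
      qed
      have Nk: "L2_set (\<lambda>m. q m / k) {..<k} = N / k"
        using k L2_set_right_distrib[of "1 / k" "\<lambda>m. real_of_int (q m)" "{..<k}"] by (simp add: N_def)
      have Ls: "L2_set (\<lambda>m. y m / sqrt k) {..<k} = sqrt S" by (simp add: L2_set_def Sk)
      have "sqrt S \<le> 1 / sqrt k + N / k"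
        using L2_set_triangle_ineq[of "\<lambda>m. y m / sqrt k - q m / k" "\<lambda>m. q m / k" "{..<k}"] d by (simp add: Nk Ls)
      moreover have "N / k \<le> 1 / sqrt k + sqrt S"
      proof -
        have "L2_set (\<lambda>m. q m / k - y m / sqrt k) {..<k} = L2_set (\<lambda>m. y m / sqrt k - q m / k) {..<k}"
          unfolding L2_set_def by (simp add: power2_commute)
        then show ?thesis
          using L2_set_triangle_ineq[of "\<lambda>m. q m / k - y m / sqrt k" "\<lambda>m. y m / sqrt k" "{..<k}"] d by (simp add: Nk Ls)
      qed
      ultimately have "\<bar>N / k - 1\<bar> \<le> 1 / sqrt k + \<bar>sqrt S - 1\<bar>" by linarith
      also have "\<bar>sqrt S - 1\<bar> \<le> \<bar>S - 1\<bar>"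
      proof -
        have "S - 1 = (sqrt S - 1) * (sqrt S + 1)" using S0 by (simp add: algebra_simps)
        then have "\<bar>S - 1\<bar> = \<bar>sqrt S - 1\<bar> * (sqrt S + 1)" using S0 by (simp add: abs_mult)
        moreover have "\<bar>sqrt S - 1\<bar> * 1 \<le> \<bar>sqrt S - 1\<bar> * (sqrt S + 1)" using S0 by (intro mult_left_mono) auto
        ultimately show ?thesis by simp
      qed
      finally have c: "\<bar>N / k - 1\<bar> \<le> 1 / sqrt k + \<bar>S - 1\<bar>" by simp
      \<comment> \<open>The grid point and its normalization lie on one ray, so their distance is
        the difference of their norms.\<close>
      have "L2_set (\<lambda>m. q m / k - f m) {..<k} = \<bar>N / k - 1\<bar>"
      proof -
        have "(\<Sum>m<k. (q m / k - f m)\<^sup>2) = (\<Sum>m<k. (1 / k - 1 / N)\<^sup>2 * (real_of_int (q m))\<^sup>2)"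
          by (intro sum.cong) (auto simp: fq power_mult_distrib[symmetric] left_diff_distrib)
        also have "\<dots> = (1 / k - 1 / N)\<^sup>2 * N\<^sup>2"
          by (simp add: sum_distrib_left[symmetric] N_def L2_set_def sum_nonneg)
        also have "\<dots> = (N / k - 1)\<^sup>2"
          using N by (simp add: power_mult_distrib[symmetric] left_diff_distrib)
        finally show ?thesis by (simp add: L2_set_def)
      qed
      then have "L2_set (\<lambda>m. y m / sqrt k - f m) {..<k} \<le> 1 / sqrt k + (1 / sqrt k + \<bar>S - 1\<bar>)"
        using L2_set_triangle_ineq[of "\<lambda>m. y m / sqrt k - q m / k" "\<lambda>m. q m / k - f m" "{..<k}"] c d by simp
      then have "(L2_set (\<lambda>m. y m / sqrt k - f m) {..<k})\<^sup>2 \<le> (2 / sqrt k + \<bar>S - 1\<bar>)\<^sup>2"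
        by (intro power_mono) auto
      also have "\<dots> \<le> 2 * (2 / sqrt k)\<^sup>2 + 2 * \<bar>S - 1\<bar>\<^sup>2"
      proof -
        have "0 \<le> (2 / sqrt k - \<bar>S - 1\<bar>)\<^sup>2" by simp
        then show ?thesis unfolding power2_sum power2_diff by linarith
      qed
      also have "\<dots> \<le> 8 / k + 36 * (S - 1)\<^sup>2"
        using k by (simp add: power_divide)
      finally show ?thesis by (simp add: L2_set_def sum_nonneg f_def)
    qed
  qed
qed

text \<open>The map factors through the vector of floors, which takes values in a countable discrete
  space, where every function is measurable.\<close>

lemma sphere_round_measurable:
  assumes "m < k"
  shows "(\<lambda>y. sphere_round k y m) \<in> borel_measurable (gauss_vector {..<k})"
proof -
  define Q where "Q y = (\<lambda>m\<in>{..<k}. \<lfloor>sqrt k * y m\<rfloor>)" for y :: "nat \<Rightarrow> real"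
  define h where "h t = normalize_vec k (if \<forall>m<k. t m \<in> {- 2 * int k..2 * int k} then t else (\<lambda>m\<in>{..<k}. 0)) m" for t
  have "Q \<in> measurable (gauss_vector {..<k}) (PiM {..<k} (\<lambda>_. count_space UNIV))"
    unfolding Q_def
  proof (rule measurable_restrict)
    fix i assume i: "i \<in> {..<k}"
    have "(\<lambda>y. sqrt k * y i) \<in> borel_measurable (gauss_vector {..<k})"
      by (intro borel_measurable_times borel_measurable_const gauss_vector_component_measurable i)
    then show "(\<lambda>y. \<lfloor>sqrt k * y i\<rfloor>) \<in> measurable (gauss_vector {..<k}) (count_space UNIV)"
      by measurable
  qed
  then have Q: "Q \<in> measurable (gauss_vector {..<k}) (count_space (PiE {..<k} (\<lambda>_. UNIV)))"
    by (subst (asm) count_space_PiM_finite) auto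
  have "h \<in> borel_measurable (count_space (PiE {..<k} (\<lambda>_. UNIV)))" by simp
  from measurable_compose[OF Q this] have "(\<lambda>y. h (Q y)) \<in> borel_measurable (gauss_vector {..<k})" .
  moreover have "h (Q y) = sphere_round k y m" for y
    by (simp add: h_def Q_def sphere_round_def)
  ultimately show ?thesis by simp
qed

text \<open>The 80 is 8 + 36 * 2. The number \<delta> depends on \<open>k\<close> alone and serves
  all sizes and all matrices.\<close>

lemma sphere_net_rounding:
  assumes k: "k > 0"
  shows "\<exists>\<delta>. 0 \<le> \<delta> \<and> \<delta> \<le> 80 / k \<and> (\<forall>n M. \<exists>\<tau>\<in>PiE {..<n} (\<lambda>_. sphere_net k).
    (1 - \<delta>) * sdp n M - \<delta> * sdp n (\<lambda>i j. - M i j) \<le> trace_prod n M (gram k \<tau>))"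
proof -
  interpret V: prob_space "gauss_vector {..<k}" by (rule prob_space_gauss_vector)
  define \<delta> where "\<delta> = (\<integral>y. (\<Sum>m<k. (y m / sqrt k - sphere_round k y m)\<^sup>2) \<partial>gauss_vector {..<k})"
  have "\<delta> \<ge> 0" unfolding \<delta>_def by (intro Bochner_Integration.integral_nonneg sum_nonneg) auto
  moreover have "\<delta> \<le> 80 / k"
  proof -
    have card: "card {..<k} = k" by simp
    note conc = gauss_vector_norm_concentration[OF finite_lessThan card k]
    have int: "integrable (gauss_vector {..<k}) (\<lambda>y. 8 / k + 36 * ((\<Sum>m<k. (y m)\<^sup>2) / k - 1)\<^sup>2)"
      using conc(1) by (intro Bochner_Integration.integrable_add integrable_mult_right V.integrable_const)
    have "\<delta> \<le> (\<integral>y. 8 / k + 36 * ((\<Sum>m<k. (y m)\<^sup>2) / k - 1)\<^sup>2 \<partial>gauss_vector {..<k})"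
      unfolding \<delta>_def
    proof (rule integral_mono_AE'[OF int])
      show "AE y in gauss_vector {..<k}. (\<Sum>m<k. (y m / sqrt k - sphere_round k y m)\<^sup>2)
          \<le> 8 / k + 36 * ((\<Sum>m<k. (y m)\<^sup>2) / k - 1)\<^sup>2"
        by (intro AE_I2 sphere_round_error k)
      show "AE y in gauss_vector {..<k}. 0 \<le> 8 / k + 36 * ((\<Sum>m<k. (y m)\<^sup>2) / k - 1)\<^sup>2"
        by (intro AE_I2) simp
    qed
    also have "\<dots> = 8 / k + 36 * (2 / k)"
      using conc by (simp add: V.prob_space)
    finally show ?thesis by simp
  qed
  moreover have "\<exists>\<tau>\<in>PiE {..<n} (\<lambda>_. sphere_net k).
    (1 - \<delta>) * sdp n M - \<delta> * sdp n (\<lambda>i j. - M i j) \<le> trace_prod n M (gram k \<tau>)" for n M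
    by (rule gauss_rounding[OF k sphere_round_measurable _ finite_sphere_net sphere_round_in_net \<delta>_def])
       (use k in \<open>auto intro: sphere_net_unit sphere_round_in_net\<close>)
  ultimately show ?thesis by blast
qed

section \<open>The smoothed semidefinite program\<close>

text \<open>Families of net points with the same linear form are merged. This only lowers the
  cardinality, and it makes negating the matrix the same as negating the set.\<close>

definition net_coeffs :: "nat \<Rightarrow> nat \<Rightarrow> (nat \<times> nat \<Rightarrow> real) set" where
  "net_coeffs k n = (\<lambda>\<tau>. pair_coeff (gram k \<tau>)) ` PiE {..<n} (\<lambda>_. sphere_net k)"

abbreviation smooth_sdp :: "nat \<Rightarrow> real \<Rightarrow> nat \<Rightarrow> (nat \<times> nat \<Rightarrow> real) \<Rightarrow> real" where
  "smooth_sdp k \<beta> n \<equiv> lse \<beta> (net_coeffs k n) (upper_pairs n)"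

lemma sym_matrix_uminus: "sym_matrix (\<lambda>e. - x e) = (\<lambda>i j. - sym_matrix x i j)"
  by (simp add: sym_matrix_def fun_eq_iff)

abbreviation sdp_sum :: "nat \<Rightarrow> (nat \<times> nat \<Rightarrow> real) \<Rightarrow> real" where
  "sdp_sum n x \<equiv> sdp n (sym_matrix x) + sdp n (sym_matrix (\<lambda>e. - x e))"

abbreviation sdp_near :: "nat \<Rightarrow> real \<Rightarrow> real \<Rightarrow> real \<Rightarrow> (nat \<times> nat \<Rightarrow> real) \<Rightarrow> bool" where
  "sdp_near n u u' r x \<equiv>
     \<bar>sdp n (sym_matrix x) - u\<bar> \<le> r \<and> \<bar>sdp n (sym_matrix (\<lambda>e. - x e)) - u'\<bar> \<le> r"

lemma finite_net_coeffs: "finite (net_coeffs k n)"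
  unfolding net_coeffs_def by (intro finite_imageI finite_PiE) (auto simp: finite_sphere_net)

lemma net_coeffs_nonempty: "net_coeffs k n \<noteq> {}"
  using sphere_net_nonempty by (simp add: net_coeffs_def PiE_eq_empty_iff)

lemma ln_card_net_coeffs_le:
  assumes "k > 0"
  shows "ln (card (net_coeffs k n)) \<le> n * (k * ln (5 * k))"
proof -
  have pos: "card (sphere_net k) > 0" "card (net_coeffs k n) > 0"
    using finite_sphere_net sphere_net_nonempty finite_net_coeffs net_coeffs_nonempty
    by (auto simp: card_gt_0_iff)
  have "card (net_coeffs k n) \<le> card (PiE {..<n} (\<lambda>_. sphere_net k))"
    unfolding net_coeffs_def by (intro card_image_le finite_PiE) (auto simp: finite_sphere_net)
  also have "\<dots> = card (sphere_net k) ^ n" by (simp add: card_PiE)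
  finally have "real (card (net_coeffs k n)) \<le> real (card (sphere_net k)) ^ n"
    by (simp flip: of_nat_power)
  then have "ln (card (net_coeffs k n)) \<le> ln (real (card (sphere_net k)) ^ n)"
    using pos by (intro ln_mono) auto
  also have "\<dots> = n * ln (card (sphere_net k))" using pos by (simp add: ln_realpow)
  also have "\<dots> \<le> n * (k * ln (5 * k))"
    using card_sphere_net_le[OF assms] by (intro mult_left_mono) auto
  finally show ?thesis by simp
qed

lemma net_coeffs_elim:
  assumes "c \<in> net_coeffs k n" "k > 0"
  obtains X where "X \<in> elliptope n" "c = pair_coeff X"
proof -
  obtain \<tau> where \<tau>: "\<tau> \<in> PiE {..<n} (\<lambda>_. sphere_net k)" "c = pair_coeff (gram k \<tau>)"
    using assms by (auto simp: net_coeffs_def)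
  have "gram k \<tau> \<in> elliptope n"
    using \<tau>(1) by (intro gram_in_elliptope sphere_net_unit assms(2)) auto
  then show ?thesis using that \<tau>(2) by blast
qed

lemma net_coeffs_bound:
  "c \<in> net_coeffs k n \<Longrightarrow> k > 0 \<Longrightarrow> e \<in> upper_pairs n \<Longrightarrow> \<bar>c e\<bar> \<le> 2"
  by (elim net_coeffs_elim) (auto intro: pair_coeff_bound)

lemma net_coeffs_le_sdp:
  assumes "c \<in> net_coeffs k n" "k > 0"
  shows "(\<Sum>e\<in>upper_pairs n. c e * x e) \<le> sdp n (sym_matrix x)"
  using assms
proof (rule net_coeffs_elim)
  fix X assume X: "X \<in> elliptope n" "c = pair_coeff X"
  show ?thesis
    using sdp_upper[OF X(1), of "sym_matrix x"] trace_prod_sym_matrix_elliptope[OF X(1), of x]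
    unfolding X(2) by simp
qed

lemma sdp_le_net_coeffs:
  assumes k: "k > 0"
  shows "\<exists>\<delta>. 0 \<le> \<delta> \<and> \<delta> \<le> 80 / k \<and> (\<forall>n x. \<exists>c\<in>net_coeffs k n.
    (1 - \<delta>) * sdp n (sym_matrix x) - \<delta> * sdp n (sym_matrix (\<lambda>e. - x e)) \<le> (\<Sum>e\<in>upper_pairs n. c e * x e))"
proof -
  obtain \<delta> where \<delta>: "0 \<le> \<delta>" "\<delta> \<le> 80 / k" "\<And>n M. \<exists>\<tau>\<in>PiE {..<n} (\<lambda>_. sphere_net k).
    (1 - \<delta>) * sdp n M - \<delta> * sdp n (\<lambda>i j. - M i j) \<le> trace_prod n M (gram k \<tau>)"
    using sphere_net_rounding[OF k] by blast
  have "\<exists>c\<in>net_coeffs k n. (1 - \<delta>) * sdp n (sym_matrix x) - \<delta> * sdp n (sym_matrix (\<lambda>e. - x e))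
      \<le> (\<Sum>e\<in>upper_pairs n. c e * x e)" for n x
  proof -
    obtain \<tau> where \<tau>: "\<tau> \<in> PiE {..<n} (\<lambda>_. sphere_net k)"
      "(1 - \<delta>) * sdp n (sym_matrix x) - \<delta> * sdp n (sym_matrix (\<lambda>e. - x e)) \<le> trace_prod n (sym_matrix x) (gram k \<tau>)"
      using \<delta>(3)[of n "sym_matrix x"] unfolding sym_matrix_uminus by blast
    have "trace_prod n (sym_matrix x) (gram k \<tau>) = (\<Sum>e\<in>upper_pairs n. pair_coeff (gram k \<tau>) e * x e)"
      by (rule trace_prod_sym_matrix) (simp add: gram_def mult.commute)
    then show ?thesis using \<tau> by (auto simp: net_coeffs_def)
  qed
  with \<delta>(1,2) show ?thesis by blast
qed

text \<open>The exact loss \<delta> may be replaced by its bound because \<open>sdp_sum\<close> is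
  nonnegative.\<close>

lemma sdp_le_net_max:
  assumes k: "k > 0" and A: "\<And>c. c \<in> net_coeffs k n \<Longrightarrow> (\<Sum>e\<in>upper_pairs n. c e * x e) \<le> A"
  shows "sdp n (sym_matrix x) \<le> A + 80 / k * sdp_sum n x"
proof -
  obtain \<delta> where \<delta>: "0 \<le> \<delta>" "\<delta> \<le> 80 / k" "\<And>n x. \<exists>c\<in>net_coeffs k n.
    (1 - \<delta>) * sdp n (sym_matrix x) - \<delta> * sdp n (sym_matrix (\<lambda>e. - x e)) \<le> (\<Sum>e\<in>upper_pairs n. c e * x e)"
    using sdp_le_net_coeffs[OF k] by blast
  have "(1 - \<delta>) * sdp n (sym_matrix x) - \<delta> * sdp n (sym_matrix (\<lambda>e. - x e)) \<le> A"
    using \<delta>(3)[of n x] A by (meson order_trans)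
  moreover have "\<delta> * sdp_sum n x
     \<le> 80 / k * sdp_sum n x"
    using \<delta>(2) sdp_uminus_lower[of n "sym_matrix x"]
    by (intro mult_right_mono) (auto simp: sym_matrix_uminus)
  ultimately show ?thesis by (simp add: algebra_simps)
qed

lemma sdp_smooth_sdp_diff:
  assumes k: "k > 0" and \<beta>: "\<beta> > 0"
  shows "\<bar>sdp n (sym_matrix x) - smooth_sdp k \<beta> n x\<bar> \<le> n * (k * ln (5 * real k) / \<beta>) +
    80 / k * sdp_sum n x"
proof -
  have S: "80 / k * sdp_sum n x \<ge> 0"
    using sdp_uminus_lower[of n "sym_matrix x"] by (auto simp: sym_matrix_uminus)
  have "smooth_sdp k \<beta> n x \<le> sdp n (sym_matrix x) + ln (card (net_coeffs k n)) / \<beta>"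
    using net_coeffs_le_sdp k by (intro lse_le finite_net_coeffs net_coeffs_nonempty \<beta>)
  also have "ln (card (net_coeffs k n)) / \<beta> \<le> n * (k * ln (5 * real k)) / \<beta>"
    using ln_card_net_coeffs_le[OF k] \<beta> by (intro divide_right_mono) auto
  finally have 1: "smooth_sdp k \<beta> n x \<le> sdp n (sym_matrix x) + n * (k * ln (5 * real k) / \<beta>)" by simp
  have 2: "sdp n (sym_matrix x) \<le> smooth_sdp k \<beta> n x + 80 / k * sdp_sum n x"
    by (rule sdp_le_net_max[OF k]) (rule lse_upper[OF finite_net_coeffs _ \<beta>])
  have "ln (5 * real k) \<ge> 0" using k by simp
  then have "n * (k * ln (5 * real k) / \<beta>) \<ge> 0" using \<beta> by simp
  with 1 2 S show ?thesis by linarith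
qed

(* For k = 320 the rounding loss 80 / k is 1/4, so that it can be absorbed in the left-hand side. *)
lemma sdp_sum_le:
  assumes "\<And>c. c \<in> net_coeffs 320 n \<Longrightarrow> (\<Sum>e\<in>upper_pairs n. c e * x e) \<le> A"
    and "\<And>c. c \<in> net_coeffs 320 n \<Longrightarrow> (\<Sum>e\<in>upper_pairs n. c e * - x e) \<le> A"
  shows "sdp_sum n x \<le> 4 * A"
  using sdp_le_net_max[of 320 n x A] sdp_le_net_max[of 320 n "\<lambda>e. - x e" A] assms
  by (simp add: field_simps)

text \<open>The supremum runs over an uncountable set. Rounding exhibits it as a pointwise limit of
  maxima over finite nets, with an error \<open>80 / Suc k * S\<close> that tends to 0 for fixed
  \<open>x\<close>.\<close>

lemma sdp_sym_matrix_measurable: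
  "(\<lambda>x. sdp n (sym_matrix x)) \<in> borel_measurable (PiM (upper_pairs n) (\<lambda>_. borel))"
proof (rule borel_measurable_LIMSEQ_real)
  define u where "u k x = Max ((\<lambda>c. \<Sum>e\<in>upper_pairs n. c e * x e) ` net_coeffs (Suc k) n)" for k x
  show "u k \<in> borel_measurable (PiM (upper_pairs n) (\<lambda>_. borel))" for k
    unfolding u_def by (intro borel_measurable_Max finite_net_coeffs) measurable
  fix x
  define S where "S = sdp_sum n x"
  have le: "u k x \<le> sdp n (sym_matrix x)" for k
    unfolding u_def using finite_net_coeffs net_coeffs_nonempty
    by (subst Max_le_iff) (auto intro: net_coeffs_le_sdp)
  have ge: "sdp n (sym_matrix x) \<le> u k x + 80 / Suc k * S" for k
    unfolding S_def by (rule sdp_le_net_max) (auto simp: u_def finite_net_coeffs intro!: Max_ge)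
  have "(\<lambda>k. sdp n (sym_matrix x) - 80 / Suc k * S) \<longlonglongrightarrow> sdp n (sym_matrix x) - 80 * 0 * S"
    unfolding divide_inverse by (intro tendsto_intros LIMSEQ_inverse_real_of_nat)
  then have lim: "(\<lambda>k. sdp n (sym_matrix x) - 80 / Suc k * S) \<longlonglongrightarrow> sdp n (sym_matrix x)" by simp
  show "(\<lambda>k. u k x) \<longlonglongrightarrow> sdp n (sym_matrix x)"
  proof (rule tendsto_sandwich[OF _ _ lim tendsto_const])
    show "\<forall>\<^sub>F k in sequentially. sdp n (sym_matrix x) - 80 / Suc k * S \<le> u k x"
      using ge by (intro always_eventually allI) (simp add: algebra_simps)
    show "\<forall>\<^sub>F k in sequentially. u k x \<le> sdp n (sym_matrix x)" using le by simp
  qed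
qed

lemma lse_coord_Lipschitz:
  assumes C: "finite C" "C \<noteq> {}" and E: "finite E" and \<beta>: "\<beta> > 0"
    and b: "\<And>c e. c \<in> C \<Longrightarrow> e \<in> E \<Longrightarrow> \<bar>c e\<bar> \<le> B"
  shows "coord_Lipschitz B E (lse \<beta> C E)"
  unfolding coord_Lipschitz_def real_Lipschitz_def
  using lse_Lipschitz[OF C E _ \<beta>] b by blast

lemma lse_measurable: "lse \<beta> C E \<in> borel_measurable (PiM E (\<lambda>_. borel))"
  unfolding lse_def by measurable

lemma smooth_sdp_Lipschitz:
  "k > 0 \<Longrightarrow> \<beta> > 0 \<Longrightarrow> coord_Lipschitz 2 (upper_pairs n) (smooth_sdp k \<beta> n)"
  by (intro lse_coord_Lipschitz finite_net_coeffs net_coeffs_nonempty finite_upper_pairs)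
     (auto intro: net_coeffs_bound)

text \<open>Lets the program of the negated matrix be covered by the same results on
  \<open>lse\<close>, with all coefficients negated.\<close>

lemma lse_uminus: "lse \<beta> C E (\<lambda>e. - x e) = lse \<beta> (uminus ` C) E x"
proof -
  have "(\<Sum>c\<in>uminus ` C. exp (\<beta> * (\<Sum>e\<in>E. c e * x e))) = (\<Sum>c\<in>C. exp (\<beta> * (\<Sum>e\<in>E. - c e * x e)))"
    by (subst sum.reindex) (auto simp: inj_on_def fun_eq_iff)
  then show ?thesis by (simp add: lse_def)
qed

lemma smooth_sdp_uminus_Lipschitz:
  assumes "k > 0" "\<beta> > 0"
  shows "coord_Lipschitz 2 (upper_pairs n) (\<lambda>x. smooth_sdp k \<beta> n (\<lambda>e. - x e))"
  unfolding lse_uminus using assms finite_net_coeffs net_coeffs_nonempty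
  by (intro lse_coord_Lipschitz) (auto intro: net_coeffs_bound)

lemma smooth_sdp_uminus_measurable:
  "(\<lambda>x. smooth_sdp k \<beta> n (\<lambda>e. - x e)) \<in> borel_measurable (PiM (upper_pairs n) (\<lambda>_. borel))"
  unfolding lse_uminus by (rule lse_measurable)

(* net_coeffs 320 n has at most exp (320 * ln 1600 * n) elements. *)
definition net_const :: real where
  "net_const = 320 * ln 1600 + 3"

lemma net_const_pos: "net_const > 0"
  by (simp add: net_const_def add_pos_pos)

text \<open>The source of the a priori bound on \<open>sdp_sum\<close>: the fixed net has
  exponentially many linear forms, and each exceeds a large multiple of \<open>n\<close> with
  smaller exponential probability. The two alternatives for \<open>C\<close> serve the matrix and
  its negative.\<close>

lemma net_coeffs_max_bound:
  fixes M :: "nat \<times> nat \<Rightarrow> real measure"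
  assumes M: "real_laws M" and n: "n > 0" and v: "\<And>e. e \<in> upper_pairs n \<Longrightarrow> subexponential_law (M e) (m e) (2 / n)"
    and R: "(\<Sum>e\<in>upper_pairs n. \<bar>m e\<bar>) \<le> R * n"
    and C: "C = net_coeffs 320 n \<or> C = uminus ` net_coeffs 320 n"
  shows "measure (PiM (upper_pairs n) M)
      {x \<in> extensional (upper_pairs n). \<exists>c\<in>C. 2 * real n * (net_const + R) \<le> (\<Sum>e\<in>upper_pairs n. c e * x e)} \<le> exp (- real n)"
proof -
  interpret real_laws M by (rule M)
  define p where "p = measure (PiM (upper_pairs n) M)
      {x \<in> extensional (upper_pairs n). \<exists>c\<in>C. 2 * real n * (net_const + R) \<le> (\<Sum>e\<in>upper_pairs n. c e * x e)}"
  have fin: "finite C" "card C \<le> card (net_coeffs 320 n)"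
    using C finite_net_coeffs by (auto intro: card_image_le)
  have "p \<le> card C * exp ((\<Sum>e\<in>upper_pairs n. \<bar>m e\<bar> + 2 / n) - 2 * real n * (net_const + R) / 2)"
    unfolding p_def
  proof (intro linear_max_bound v)
    show "\<bar>c e\<bar> \<le> 2" if "c \<in> C" "e \<in> upper_pairs n" for c e
      using C that net_coeffs_bound[of _ 320 n e] by auto
  qed (use fin in auto)
  also have "(\<Sum>e\<in>upper_pairs n. \<bar>m e\<bar> + 2 / n) \<le> R * n + 2 * n"
  proof -
    have "real (card (upper_pairs n)) * (2 / n) \<le> (real n)\<^sup>2 * (2 / n)"
      by (intro mult_right_mono card_upper_pairs_le) auto
    then show ?thesis using R n by (simp add: sum.distrib power2_eq_square)
  qed
  also have "real (card C) \<le> exp (320 * ln 1600 * n)"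
  proof -
    have "card (net_coeffs 320 n) > 0"
      using finite_net_coeffs net_coeffs_nonempty by (auto simp: card_gt_0_iff)
    then have "real (card (net_coeffs 320 n)) = exp (ln (card (net_coeffs 320 n)))" by simp
    also have "\<dots> \<le> exp (n * (320 * ln (5 * 320)))"
      using ln_card_net_coeffs_le[of 320 n] by simp
    finally show ?thesis using fin(2) by (simp add: mult_ac)
  qed
  \<comment> \<open>Here the summands of \<open>net_const\<close> are spent:
    \<open>320 * ln 1600\<close> on the size of the net, 2 on the variances, and 1 on the remaining
    decay.\<close>
  also have "exp (320 * ln 1600 * real n) * exp (R * n + 2 * n - 2 * real n * (net_const + R) / 2) = exp (- real n)"
    unfolding exp_add[symmetric] by (simp add: net_const_def algebra_simps)
  finally show ?thesis by (simp add: p_def mult_right_mono mult_left_mono)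
qed

text \<open>Outside four events, \<open>sdp_sum\<close> is at most
  \<open>8 * n * (net_const + R)\<close> and both smoothed functions are within \<open>n * t\<close>
  of their means. The rest of \<open>r\<close> is then a deterministic bound on the gap between a
  program and its smoothing. The prefactor is 1 + 1 for the a priori bounds plus 2 + 2 for two-sided
  concentration.\<close>

lemma sdp_concentration:
  fixes M :: "nat \<times> nat \<Rightarrow> real measure" and t :: real
  assumes M: "real_laws M" and n: "n > 0" and v: "\<And>e. e \<in> upper_pairs n \<Longrightarrow> subexponential_law (M e) (m e) (2 / n)"
    and R: "(\<Sum>e\<in>upper_pairs n. \<bar>m e\<bar>) \<le> R * n"
    and k: "k > 0" and \<beta>: "\<beta> > 0" and t: "t > 0"
  defines "r \<equiv> n * (t + (k * ln (5 * real k) / \<beta> + 80 / k * (8 * (net_const + R))))"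
  shows "measure (PiM (upper_pairs n) M) {x \<in> extensional (upper_pairs n).
      \<not> sdp_near n (\<integral>x. smooth_sdp k \<beta> n x \<partial>PiM (upper_pairs n) M)
        (\<integral>x. smooth_sdp k \<beta> n (\<lambda>e. - x e) \<partial>PiM (upper_pairs n) M) r x}
    \<le> 6 * exp (- (n * min 1 (t\<^sup>2) / 64))"
proof -
  interpret real_laws M by (rule M)
  interpret P: prob_space "PiM (upper_pairs n) M" by (rule prob_space_PiM_real)
  let ?E = "upper_pairs n" and ?P = "PiM (upper_pairs n) M"
  define F F' where "F = smooth_sdp k \<beta> n" and "F' x = smooth_sdp k \<beta> n (\<lambda>e. - x e)" for x
  define f f' where "f = (\<integral>x. F x \<partial>?P)" and "f' = (\<integral>x. F' x \<partial>?P)"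
  have Fm [measurable]: "F \<in> borel_measurable ?P" "F' \<in> borel_measurable ?P"
    using lse_measurable smooth_sdp_uminus_measurable
    by (auto simp: F_def F'_def[abs_def] measurable_cong_sets[OF sets_PiM_real refl])
  have FL: "coord_Lipschitz 2 ?E F" "coord_Lipschitz 2 ?E F'"
    unfolding F_def F'_def[abs_def]
    using smooth_sdp_Lipschitz[OF k \<beta>] smooth_sdp_uminus_Lipschitz[OF k \<beta>] by auto
  define A where "A = 2 * real n * (net_const + R)"
  define C where "C = net_coeffs 320 n"
  have C: "finite C" using finite_net_coeffs by (simp add: C_def)
  define B1 where "B1 = {x \<in> extensional ?E. \<exists>c\<in>C. A \<le> (\<Sum>e\<in>?E. c e * x e)}"
  define B2 where "B2 = {x \<in> extensional ?E. \<exists>c\<in>uminus ` C. A \<le> (\<Sum>e\<in>?E. c e * x e)}"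
  define B3 where "B3 = {x \<in> extensional ?E. n * t \<le> \<bar>F x - f\<bar>}"
  define B4 where "B4 = {x \<in> extensional ?E. n * t \<le> \<bar>F' x - f'\<bar>}"
  have meas: "{x \<in> space ?P. \<exists>c\<in>C'. A \<le> (\<Sum>e\<in>?E. c e * x e)} \<in> sets ?P" if "finite C'" for C'
    using that by measurable
  have B: "B1 \<in> sets ?P" "B2 \<in> sets ?P" "B3 \<in> sets ?P" "B4 \<in> sets ?P"
  proof -
    show "B1 \<in> sets ?P" "B2 \<in> sets ?P" using meas[of C] meas[of "uminus ` C"] C by (auto simp: B1_def B2_def)
    have "{x \<in> space ?P. n * t \<le> \<bar>F x - f\<bar>} \<in> sets ?P" "{x \<in> space ?P. n * t \<le> \<bar>F' x - f'\<bar>} \<in> sets ?P"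
      by measurable
    then show "B3 \<in> sets ?P" "B4 \<in> sets ?P" by (auto simp: B3_def B4_def)
  qed
  define \<rho> where "\<rho> = exp (- (n * min 1 (t\<^sup>2) / 64))"
  have p12: "measure ?P B1 \<le> \<rho>" "measure ?P B2 \<le> \<rho>"
  proof -
    have "exp (- real n) \<le> \<rho>"
    proof -
      have "n * min 1 (t\<^sup>2) \<le> real n * 1" by (intro mult_left_mono) auto
      then have "n * min 1 (t\<^sup>2) / 64 \<le> n" by simp
      then show ?thesis by (simp add: \<rho>_def)
    qed
    moreover have "measure ?P B1 \<le> exp (- real n)" "measure ?P B2 \<le> exp (- real n)"
      unfolding B1_def B2_def A_def C_def using net_coeffs_max_bound[OF M n v R] by blast+
    ultimately show "measure ?P B1 \<le> \<rho>" "measure ?P B2 \<le> \<rho>" by linarith+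
  qed
  have p34: "measure ?P B3 \<le> 2 * \<rho>" "measure ?P B4 \<le> 2 * \<rho>"
  proof -
    \<comment> \<open>The exponent is at most
      \<open>16 * n * \<theta>\<^sup>2 - n * \<theta> * \<mu>\<close>, which is minimal at
      \<open>\<theta> = \<mu> / 32\<close> with value \<open>- n * \<mu>\<^sup>2 / 64\<close>.
      Capping \<open>t\<close> at 1 keeps \<open>\<theta> * 2\<close> in the admissible
      range.\<close>
    define \<mu> where "\<mu> = min 1 t"
    define \<theta> where "\<theta> = \<mu> / 32"
    have \<mu>: "0 < \<mu>" "\<mu> \<le> 1" "\<mu> \<le> t" using t by (auto simp: \<mu>_def)
    have \<theta>: "0 \<le> \<theta>" "\<bar>\<theta> * 2\<bar> \<le> 1" using \<mu> by (auto simp: \<theta>_def)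
    have "card ?E * (2 * (2 / n) * (\<theta> * 2)\<^sup>2) \<le> (real n)\<^sup>2 * (2 * (2 / n) * (\<theta> * 2)\<^sup>2)"
      by (intro mult_right_mono card_upper_pairs_le) auto
    also have "\<dots> = n * (\<mu>\<^sup>2 / 64)" using n by (simp add: \<theta>_def power2_eq_square)
    finally have 1: "card ?E * (2 * (2 / n) * (\<theta> * 2)\<^sup>2) \<le> n * (\<mu>\<^sup>2 / 64)" .
    have "n * (\<mu> * \<mu>) \<le> n * (\<mu> * t)" using \<mu> by (intro mult_left_mono) auto
    then have 2: "\<theta> * (n * t) \<ge> n * (\<mu>\<^sup>2 / 32)" by (simp add: \<theta>_def power2_eq_square mult_ac)
    have "\<mu>\<^sup>2 = min 1 (t\<^sup>2)"
      using t by (auto simp: \<mu>_def min_def power2_eq_square mult_le_one intro: order.antisym mult_left_mono)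
         (use t mult_mono[of 1 t 1 t] mult_mono[of t 1 t 1] in \<open>auto simp: not_le\<close>)
    then have "card ?E * (2 * (2 / n) * (\<theta> * 2)\<^sup>2) - \<theta> * (n * t) \<le> - (n * min 1 (t\<^sup>2) / 64)"
    proof -
      have "card ?E * (2 * (2 / n) * (\<theta> * 2)\<^sup>2) - \<theta> * (n * t) \<le> n * (\<mu>\<^sup>2 / 64) - n * (\<mu>\<^sup>2 / 32)"
        by (rule diff_mono[OF 1 2])
      also have "\<dots> = - (n * \<mu>\<^sup>2 / 64)" by simp
      finally show ?thesis unfolding \<open>\<mu>\<^sup>2 = min 1 (t\<^sup>2)\<close> .
    qed
    then have "exp (card ?E * (2 * (2 / n) * (\<theta> * 2)\<^sup>2) - \<theta> * (n * t)) \<le> \<rho>" by (simp add: \<rho>_def)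
    then show "measure ?P B3 \<le> 2 * \<rho>" "measure ?P B4 \<le> 2 * \<rho>"
      unfolding B3_def B4_def f_def f'_def
      using concentration[OF finite_upper_pairs Fm(1) FL(1) v \<theta>, of "n * t"]
        concentration[OF finite_upper_pairs Fm(2) FL(2) v \<theta>, of "n * t"] by linarith+
  qed
  have sub: "{x \<in> extensional ?E. \<not> sdp_near n f f' r x}
     \<subseteq> (B1 \<union> B2) \<union> (B3 \<union> B4)"
  proof
    fix x assume x: "x \<in> {x \<in> extensional ?E. \<not> sdp_near n f f' r x}"
    show "x \<in> (B1 \<union> B2) \<union> (B3 \<union> B4)"
    proof (rule ccontr)
      assume "x \<notin> (B1 \<union> B2) \<union> (B3 \<union> B4)"
      then have nB: "x \<notin> B1" "x \<notin> B2" "x \<notin> B3" "x \<notin> B4" and ex: "x \<in> extensional ?E" using x by auto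
      define S where "S = sdp_sum n x"
      have "S \<le> 4 * A"
        unfolding S_def
      proof (rule sdp_sum_le)
        show "(\<Sum>e\<in>?E. c e * x e) \<le> A" if "c \<in> net_coeffs 320 n" for c
          using nB(1) ex that unfolding B1_def C_def by force
        show "(\<Sum>e\<in>?E. c e * - x e) \<le> A" if "c \<in> net_coeffs 320 n" for c
          using nB(2) ex that unfolding B2_def C_def by force
      qed
      then have "80 / k * S \<le> 80 / k * (4 * A)" by (intro mult_left_mono) auto
      then have S: "80 / k * S \<le> n * (80 / k * (8 * (net_const + R)))" by (simp add: A_def algebra_simps)
      have F1: "\<bar>F x - f\<bar> < n * t" "\<bar>F' x - f'\<bar> < n * t"
        using nB(3,4) ex unfolding B3_def B4_def by force+
      have "\<bar>sdp n (sym_matrix x) - F x\<bar> \<le> n * (k * ln (5 * real k) / \<beta>) + 80 / k * S"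
        using sdp_smooth_sdp_diff[OF k \<beta>, of n x] by (simp add: F_def S_def)
      moreover have "\<bar>sdp n (sym_matrix (\<lambda>e. - x e)) - F' x\<bar> \<le> n * (k * ln (5 * real k) / \<beta>) + 80 / k * S"
        using sdp_smooth_sdp_diff[OF k \<beta>, of n "\<lambda>e. - x e"] by (simp add: F'_def S_def add.commute)
      moreover have "r = n * t + (n * (k * ln (5 * real k) / \<beta>) + n * (80 / k * (8 * (net_const + R))))"
        unfolding r_def by (simp only: distrib_left)
      ultimately have "\<bar>sdp n (sym_matrix x) - f\<bar> \<le> r" "\<bar>sdp n (sym_matrix (\<lambda>e. - x e)) - f'\<bar> \<le> r"
        using F1 S by linarith+
      with x show False by simp
    qed
  qed
  have "measure ?P {x \<in> extensional ?E. \<not> sdp_near n f f' r x}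
     \<le> measure ?P ((B1 \<union> B2) \<union> (B3 \<union> B4))"
    using B sub by (intro P.finite_measure_mono) auto
  also have "\<dots> \<le> (measure ?P B1 + measure ?P B2) + (measure ?P B3 + measure ?P B4)"
    using B by (intro order_trans[OF measure_Un_le] add_mono) (auto intro: measure_Un_le)
  also have "\<dots> \<le> 6 * \<rho>" using p12 p34 by linarith
  finally show ?thesis by (simp add: f_def f'_def F_def F'_def \<rho>_def)
qed

section \<open>Exchanging the laws of the entries\<close>

definition law_moments :: "real measure \<Rightarrow> real \<Rightarrow> real \<Rightarrow> real \<Rightarrow> bool" where
  "law_moments M m V T \<longleftrightarrow> integrable M (\<lambda>x. \<bar>x - m\<bar> ^ 3) \<and> integrable M (\<lambda>x. (x - m)\<^sup>2) \<and>
     (\<integral>x. x \<partial>M) = m \<and> (\<integral>x. (x - m)\<^sup>2 \<partial>M) = V \<and> (\<integral>x. \<bar>x - m\<bar> ^ 3 \<partial>M) \<le> T"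

text \<open>Since \<open>m\<close> is the mean, the linear term integrates to zero: the law enters
  only through its variance and its third absolute moment.\<close>

lemma (in real_law) integral_Taylor:
  assumes mom: "law_moments M m V T" and g: "integrable M g" and R: "R \<ge> 0"
    and Taylor: "\<And>h. \<bar>g (m + h) - g m - A1 * h - A2 * h\<^sup>2\<bar> \<le> R * \<bar>h\<bar> ^ 3"
  shows "\<bar>(\<integral>x. g x \<partial>M) - g m - A2 * V\<bar> \<le> R * T"
proof -
  note mom' = mom[unfolded law_moments_def]
  have i: "integrable M (\<lambda>x. g x - g m - A1 * (x - m) - A2 * (x - m)\<^sup>2)"
    using g mom' by simp
  have "(\<integral>x. g x - g m - A1 * (x - m) - A2 * (x - m)\<^sup>2 \<partial>M) = (\<integral>x. g x \<partial>M) - g m - A2 * V"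
    using g mom' by (simp add: prob_space)
  then have "\<bar>(\<integral>x. g x \<partial>M) - g m - A2 * V\<bar> \<le> (\<integral>x. \<bar>g x - g m - A1 * (x - m) - A2 * (x - m)\<^sup>2\<bar> \<partial>M)"
    using integral_abs_bound[of M "\<lambda>x. g x - g m - A1 * (x - m) - A2 * (x - m)\<^sup>2"] by simp
  also have "\<dots> \<le> (\<integral>x. R * \<bar>x - m\<bar> ^ 3 \<partial>M)"
  proof (rule integral_mono)
    show "integrable M (\<lambda>x. \<bar>g x - g m - A1 * (x - m) - A2 * (x - m)\<^sup>2\<bar>)" using i by (rule integrable_abs)
    show "integrable M (\<lambda>x. R * \<bar>x - m\<bar> ^ 3)" using mom' by simp
    show "\<bar>g x - g m - A1 * (x - m) - A2 * (x - m)\<^sup>2\<bar> \<le> R * \<bar>x - m\<bar> ^ 3" for x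
      using Taylor[of "x - m"] by simp
  qed
  also have "\<dots> \<le> R * T" using mom' R by (simp add: mult_left_mono)
  finally show ?thesis .
qed

text \<open>Meant for the diagonal entries, whose means disagree between the two models. There are
  only \<open>n\<close> of them, so a first-order bound suffices.\<close>

lemma (in real_law) real_Lipschitz_integral_diff_le:
  assumes g: "real_Lipschitz L g"
  shows "\<bar>(\<integral>x. g x \<partial>M) - g 0\<bar> \<le> L * (\<integral>x. \<bar>x\<bar> \<partial>M)"
proof -
  have i: "integrable M g" by (rule real_Lipschitz_integrable[OF g])
  have "(\<integral>x. g x - g 0 \<partial>M) = (\<integral>x. g x \<partial>M) - g 0" using i by (simp add: prob_space)
  then have "\<bar>(\<integral>x. g x \<partial>M) - g 0\<bar> \<le> (\<integral>x. \<bar>g x - g 0\<bar> \<partial>M)"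
    using integral_abs_bound[of M "\<lambda>x. g x - g 0"] by simp
  also have "\<dots> \<le> (\<integral>x. L * \<bar>x\<bar> \<partial>M)"
  proof (rule integral_mono)
    show "\<bar>g x - g 0\<bar> \<le> L * \<bar>x\<bar>" for x
      using g unfolding real_Lipschitz_def by (metis diff_zero)
  qed (use i in auto)
  finally show ?thesis by simp
qed

text \<open>Off the diagonal both laws have mean \<open>m\<close>, so the two expansions about
  \<open>m\<close> have equal coefficients. A pair then costs the second-order coefficient times the
  variance gap, plus two cubic remainders. On the diagonal the function is compared with its value
  at 0 under either law.\<close>

lemma lse_swap:
  fixes M N :: "nat \<times> nat \<Rightarrow> real measure"
  assumes M: "real_laws M" and N: "real_laws N"
    and C: "finite C" "C \<noteq> {}" "\<And>c e. c \<in> C \<Longrightarrow> e \<in> upper_pairs n \<Longrightarrow> \<bar>c e\<bar> \<le> 2" and \<beta>: "\<beta> > 0"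
    and offM: "\<And>i j. i < j \<Longrightarrow> j < n \<Longrightarrow> \<exists>V. \<bar>V - W\<bar> \<le> \<Delta> \<and> law_moments (M (i, j)) m V T1"
    and offN: "\<And>i j. i < j \<Longrightarrow> j < n \<Longrightarrow> law_moments (N (i, j)) m W T2"
    and diag: "\<And>i. i < n \<Longrightarrow> (\<integral>x. \<bar>x\<bar> \<partial>M (i, i)) + (\<integral>x. \<bar>x\<bar> \<partial>N (i, i)) \<le> D"
    and pos: "0 \<le> \<Delta>" "0 \<le> T1" "0 \<le> T2"
  shows "\<bar>(\<integral>x. lse \<beta> C (upper_pairs n) x \<partial>PiM (upper_pairs n) M) - (\<integral>x. lse \<beta> C (upper_pairs n) x \<partial>PiM (upper_pairs n) N)\<bar>
    \<le> (real n)\<^sup>2 * (4 * \<beta> * \<Delta> + 8 * \<beta>\<^sup>2 * (T1 + T2)) + n * (2 * D)"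
proof -
  interpret M: real_laws M by (rule M)
  interpret N: real_laws N by (rule N)
  let ?E = "upper_pairs n" and ?F = "lse \<beta> C (upper_pairs n)"
  define Q where "Q = 4 * \<beta> * \<Delta> + 8 * \<beta>\<^sup>2 * (T1 + T2)"
  have Q0: "Q \<ge> 0" using pos \<beta> by (simp add: Q_def)
  have Lip: "coord_Lipschitz 2 ?E ?F"
    unfolding coord_Lipschitz_def real_Lipschitz_def
    using lse_Lipschitz[OF C(1,2) finite_upper_pairs _ \<beta>] C(3) by blast
  have meas: "?F \<in> borel_measurable (PiM ?E (\<lambda>_. borel))"
    unfolding lse_def by measurable
  have D0: "D \<ge> 0" if "n > 0"
  proof -
    have "0 \<le> (\<integral>x. \<bar>x\<bar> \<partial>M (0, 0)) + (\<integral>x. \<bar>x\<bar> \<partial>N (0, 0))" by simp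
    then show ?thesis using diag[OF that] by linarith
  qed
  have "\<bar>(\<integral>x. ?F x \<partial>PiM ?E M) - (\<integral>x. ?F x \<partial>PiM ?E N)\<bar> \<le> (\<Sum>e\<in>?E. Q + (if fst e = snd e then 2 * D else 0))"
  proof (rule Lindeberg_swap[OF M N finite_upper_pairs Lip meas])
    fix e x assume e: "e \<in> ?E"
    obtain i j where ij: "e = (i, j)" by (cases e)
    define g where "g t = ?F (x(e := t))" for t
    have gL: "real_Lipschitz 2 g" using Lip e unfolding coord_Lipschitz_def g_def by blast
    have gi: "integrable (M e) g" "integrable (N e) g"
      using M.law.real_Lipschitz_integrable[OF gL] N.law.real_Lipschitz_integrable[OF gL] by auto
    show "\<bar>(\<integral>t. ?F (x(e := t)) \<partial>M e) - (\<integral>t. ?F (x(e := t)) \<partial>N e)\<bar> \<le> Q + (if fst e = snd e then 2 * D else 0)"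
    proof (cases "i = j")
      case True
      then have "i < n" using e ij by (simp add: upper_pairs_def)
      have "\<bar>(\<integral>t. g t \<partial>M e) - (\<integral>t. g t \<partial>N e)\<bar> \<le> 2 * ((\<integral>x. \<bar>x\<bar> \<partial>M e) + (\<integral>x. \<bar>x\<bar> \<partial>N e))"
        using M.law.real_Lipschitz_integral_diff_le[OF gL, of e] N.law.real_Lipschitz_integral_diff_le[OF gL, of e]
        by (simp add: abs_le_iff)
      also have "\<dots> \<le> 2 * D" using diag[OF \<open>i < n\<close>] True ij by simp
      finally show ?thesis using Q0 True ij by (simp add: g_def)
    next
      case False
      then have ij': "i < j" "j < n" using e ij by (auto simp: upper_pairs_def)
      obtain V where V: "\<bar>V - W\<bar> \<le> \<Delta>" "law_moments (M e) m V T1" using offM[OF ij'] ij by blast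
      have W: "law_moments (N e) m W T2" using offN[OF ij'] ij by simp
      obtain A1 A2 where A2: "\<bar>A2\<bar> \<le> \<beta> * 2\<^sup>2"
        and A: "\<And>h. \<bar>g (m + h) - g m - A1 * h - A2 * h\<^sup>2\<bar> \<le> \<beta>\<^sup>2 * 2 ^ 3 * \<bar>h\<bar> ^ 3"
        using lse_Taylor[of C "upper_pairs n" e \<beta> 2 x m, OF C(1,2) finite_upper_pairs e \<beta>] C(3) e
        unfolding g_def by blast
      have R: "\<beta>\<^sup>2 * 2 ^ 3 \<ge> 0" by simp
      have a: "\<bar>(\<integral>x. g x \<partial>M e) - g m - A2 * V\<bar> \<le> \<beta>\<^sup>2 * 2 ^ 3 * T1"
        by (rule M.law.integral_Taylor[OF V(2) gi(1) R A])
      have b: "\<bar>(\<integral>x. g x \<partial>N e) - g m - A2 * W\<bar> \<le> \<beta>\<^sup>2 * 2 ^ 3 * T2"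
        by (rule N.law.integral_Taylor[OF W gi(2) R A])
      have "\<bar>A2 * (V - W)\<bar> \<le> (\<beta> * 2\<^sup>2) * \<Delta>"
        unfolding abs_mult using A2 V(1) \<beta> by (intro mult_mono) auto
      then have c: "\<bar>A2 * V - A2 * W\<bar> \<le> 4 * \<beta> * \<Delta>" by (simp add: right_diff_distrib mult_ac)
      have "\<bar>(\<integral>t. g t \<partial>M e) - (\<integral>t. g t \<partial>N e)\<bar> \<le> Q"
        using a b c unfolding Q_def by (simp add: algebra_simps abs_le_iff)
      then show ?thesis using False ij by (simp add: g_def)
    qed
  qed
  also have "\<dots> = real (card ?E) * Q + 2 * D * real (card {e \<in> ?E. fst e = snd e})"
    by (simp add: sum.distrib sum.If_cases Int_def mult.commute)
  also have "\<dots> \<le> (real n)\<^sup>2 * Q + 2 * D * real n"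
  proof (intro add_mono mult_right_mono card_upper_pairs_le Q0)
    have "{e \<in> ?E. fst e = snd e} = (\<lambda>i. (i, i)) ` {..<n}"
      by (auto simp: upper_pairs_def)
    then have "card {e \<in> ?E. fst e = snd e} = n" by (simp add: card_image inj_on_def)
    then show "2 * D * real (card {e \<in> ?E. fst e = snd e}) \<le> 2 * D * real n" by simp
  qed
  finally show ?thesis by (simp add: Q_def mult_ac)
qed

section \<open>The two entry laws: normal, and centred and scaled Bernoulli\<close>

definition normal_law :: "real \<Rightarrow> real \<Rightarrow> real measure" where
  "normal_law m \<sigma> = density lborel (\<lambda>x. ennreal (normal_density m \<sigma> x))"

lemma distr_normal_law_shift:
  assumes \<sigma>: "\<sigma> > 0"
  shows "distr (normal_law 0 \<sigma>) borel (\<lambda>w. m + w) = normal_law m \<sigma>"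
proof -
  interpret prob_space "normal_law 0 \<sigma>" unfolding normal_law_def by (rule prob_space_normal_density[OF \<sigma>])
  have "distributed (normal_law 0 \<sigma>) lborel (\<lambda>x. x) (normal_density 0 \<sigma>)"
    by (auto simp: distributed_def normal_law_def intro!: distr_id2)
  from normal_density_affine[OF this \<sigma>, of 1 m]
  have "distr (normal_law 0 \<sigma>) lborel (\<lambda>w. m + w) = normal_law m \<sigma>"
    by (simp add: distributed_def normal_law_def)
  then show ?thesis by (simp cong: distr_cong)
qed

lemma normal_law_real_law:
  assumes \<sigma>: "\<sigma> > 0"
  shows "real_law (normal_law m \<sigma>)"
proof -
  interpret prob_space "normal_law m \<sigma>" unfolding normal_law_def by (rule prob_space_normal_density[OF \<sigma>])
  show ?thesis
  proof
    show "integrable (normal_law m \<sigma>) (\<lambda>x. x)"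
      unfolding normal_law_def using integrable_normal_moment_nz_1[OF \<sigma>, of m]
      by (subst integrable_density) auto
  qed (simp add: normal_law_def)
qed

text \<open>Completing the square: the exponential tilt turns the density into the one with mean
  \<open>m + t * \<sigma>\<^sup>2\<close>, times a constant.\<close>

lemma normal_law_subexponential:
  assumes \<sigma>: "\<sigma> > 0" and v: "\<sigma>\<^sup>2 / 2 \<le> v"
  shows "subexponential_law (normal_law m \<sigma>) m v"
  unfolding subexponential_law_def
proof (intro allI impI)
  fix t :: real
  have "(\<integral>\<^sup>+x. ennreal (exp (t * (x - m))) \<partial>normal_law m \<sigma>) =
      (\<integral>\<^sup>+x. ennreal (normal_density m \<sigma> x) * ennreal (exp (t * (x - m))) \<partial>lborel)"
    unfolding normal_law_def by (subst nn_integral_density) auto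
  also have "\<dots> = (\<integral>\<^sup>+x. ennreal (exp (\<sigma>\<^sup>2 / 2 * t\<^sup>2)) * ennreal (normal_density (m + t * \<sigma>\<^sup>2) \<sigma> x) \<partial>lborel)"
  proof (rule nn_integral_cong)
    fix x
    have "- (x - m)\<^sup>2 / (2 * \<sigma>\<^sup>2) + t * (x - m) = \<sigma>\<^sup>2 / 2 * t\<^sup>2 + - (x - (m + t * \<sigma>\<^sup>2))\<^sup>2 / (2 * \<sigma>\<^sup>2)"
      using \<sigma> by (simp add: field_simps power2_eq_square)
    then have "normal_density m \<sigma> x * exp (t * (x - m)) = exp (\<sigma>\<^sup>2 / 2 * t\<^sup>2) * normal_density (m + t * \<sigma>\<^sup>2) \<sigma> x"
      by (simp add: normal_density_def exp_add[symmetric] mult.assoc mult.left_commute)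
    then show "ennreal (normal_density m \<sigma> x) * ennreal (exp (t * (x - m))) =
      ennreal (exp (\<sigma>\<^sup>2 / 2 * t\<^sup>2)) * ennreal (normal_density (m + t * \<sigma>\<^sup>2) \<sigma> x)"
      by (simp add: ennreal_mult[symmetric])
  qed
  also have "\<dots> = ennreal (exp (\<sigma>\<^sup>2 / 2 * t\<^sup>2))"
    using \<sigma> by (simp add: nn_integral_cmult nn_integral_eq_integral)
  also have "\<dots> \<le> ennreal (exp (v * t\<^sup>2))"
    using mult_right_mono[OF v, of "t\<^sup>2"] by (intro ennreal_leI) simp
  finally show "(\<integral>\<^sup>+x. ennreal (exp (t * (x - m))) \<partial>normal_law m \<sigma>) \<le> ennreal (exp (v * t\<^sup>2))" .
qed

lemma normal_law_moments:
  assumes \<sigma>: "\<sigma> > 0"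
  shows "law_moments (normal_law m \<sigma>) m (\<sigma>\<^sup>2) (2 * \<sigma> ^ 3)"
proof -
  have "(\<integral>x. normal_density m \<sigma> x * \<bar>x - m\<bar> ^ 3 \<partial>lborel) = 2 * \<sigma> ^ 3 * sqrt (2 / pi)"
    using integral_normal_moment_abs_odd[OF \<sigma>, of m 1] by (simp add: numeral_3_eq_3)
  also have "\<dots> \<le> 2 * \<sigma> ^ 3 * 1"
    using \<sigma> pi_gt3 by (intro mult_left_mono) auto
  finally have 3: "(\<integral>x. normal_density m \<sigma> x * \<bar>x - m\<bar> ^ 3 \<partial>lborel) \<le> 2 * \<sigma> ^ 3" by simp
  have 2: "(\<integral>x. normal_density m \<sigma> x * (x - m)\<^sup>2 \<partial>lborel) = \<sigma>\<^sup>2"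
    using integral_normal_moment_even[OF \<sigma>, of m 1] by (simp add: fact_numeral)
  have int: "integrable (normal_law m \<sigma>) f \<longleftrightarrow> integrable lborel (\<lambda>x. normal_density m \<sigma> x * f x)"
    "(\<integral>x. f x \<partial>normal_law m \<sigma>) = (\<integral>x. normal_density m \<sigma> x * f x \<partial>lborel)"
    if "f \<in> borel_measurable borel" for f :: "real \<Rightarrow> real"
    unfolding normal_law_def using that by (subst integrable_density integral_density; simp)+
  show ?thesis
    unfolding law_moments_def
    using 2 3 integrable_normal_moment_abs[OF \<sigma>, of m 3] integrable_normal_moment[OF \<sigma>, of m 2]
      integral_normal_moment_nz_1[OF \<sigma>, of m]
    by (simp add: int)
qed

text \<open>By the inequality of means, \<open>\<bar>x - m\<bar> \<le> \<sigma> / 2 + (x -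
  m)\<^sup>2 / (2 * \<sigma>)\<close>, so knowing the variance is enough.\<close>

lemma normal_law_abs_le:
  assumes \<sigma>: "\<sigma> > 0"
  shows "(\<integral>x. \<bar>x\<bar> \<partial>normal_law m \<sigma>) \<le> \<bar>m\<bar> + \<sigma>"
proof -
  interpret real_law "normal_law m \<sigma>" by (rule normal_law_real_law[OF \<sigma>])
  note mom = normal_law_moments[OF \<sigma>, of m, unfolded law_moments_def]
  have "(\<integral>x. \<bar>x\<bar> \<partial>normal_law m \<sigma>) \<le> (\<integral>x. \<bar>m\<bar> + (\<sigma> / 2 + (x - m)\<^sup>2 / (2 * \<sigma>)) \<partial>normal_law m \<sigma>)"
  proof (rule integral_mono)
    show "integrable (normal_law m \<sigma>) (\<lambda>x. \<bar>m\<bar> + (\<sigma> / 2 + (x - m)\<^sup>2 / (2 * \<sigma>)))"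
      using mom by (intro Bochner_Integration.integrable_add integrable_const integrable_divide_zero) auto
    fix x
    have "2 * (\<sigma> * \<bar>x - m\<bar>) \<le> \<sigma>\<^sup>2 + (x - m)\<^sup>2"
      using sum_squares_bound[of \<sigma> "\<bar>x - m\<bar>"] by (simp add: mult.assoc)
    then have "\<bar>x - m\<bar> \<le> \<sigma> / 2 + (x - m)\<^sup>2 / (2 * \<sigma>)"
      using \<sigma> by (simp add: field_simps power2_eq_square)
    then show "\<bar>x\<bar> \<le> \<bar>m\<bar> + (\<sigma> / 2 + (x - m)\<^sup>2 / (2 * \<sigma>))" by linarith
  qed simp
  also have "\<dots> = \<bar>m\<bar> + (\<sigma> / 2 + \<sigma>\<^sup>2 / (2 * \<sigma>))"
    using mom by (simp add: prob_space)
  also have "\<dots> = \<bar>m\<bar> + \<sigma>" using \<sigma> by (simp add: power2_eq_square)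
  finally show ?thesis .
qed

text \<open>For negative \<open>u\<close> the product \<open>(1 + u + u\<^sup>2) * (1 - u)\<close>
  is \<open>1 - u ^ 3\<close>, hence at least 1, and \<open>1 - u \<le> exp (- u)\<close>.\<close>

lemma exp_le_quadratic:
  fixes u :: real
  assumes "\<bar>u\<bar> \<le> 1"
  shows "exp u \<le> 1 + u + u\<^sup>2"
proof (cases "u \<ge> 0")
  case True
  then show ?thesis using exp_bound[of u] assms by simp
next
  case False
  have "u * u\<^sup>2 \<le> 0" using False by (intro mult_nonpos_nonneg) auto
  then have "1 \<le> (1 + u + u\<^sup>2) * (1 - u)" by (simp add: algebra_simps power2_eq_square)
  moreover have "1 - u \<le> exp (- u)" using exp_ge_add_one_self[of "- u"] by simp
  moreover have "1 + u + u\<^sup>2 \<ge> 0" using assms by (simp add: abs_le_iff add_nonneg_nonneg)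
  ultimately have "1 \<le> (1 + u + u\<^sup>2) * exp (- u)" using mult_left_mono order_trans by blast
  then show ?thesis by (simp add: exp_minus field_simps)
qed

text \<open>In use, \<open>s\<close> is the product of the signs of the two endpoints and
  \<open>r\<close> is the centring \<open>d / n\<close>.\<close>

definition edge_law :: "real \<Rightarrow> real \<Rightarrow> real \<Rightarrow> real \<Rightarrow> real measure" where
  "edge_law p s r d = distr (measure_pmf (bernoulli_pmf p)) borel (\<lambda>b. s * (of_bool b - r) / sqrt d)"

lemma
  assumes p: "0 \<le> p" "p \<le> 1"
  shows integral_edge_law: "\<And>f :: real \<Rightarrow> real. f \<in> borel_measurable borel \<Longrightarrow>
      (\<integral>x. f x \<partial>edge_law p s r d) = p * f (s * (1 - r) / sqrt d) + (1 - p) * f (s * (0 - r) / sqrt d)"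
    and integrable_edge_law: "\<And>f :: real \<Rightarrow> real. f \<in> borel_measurable borel \<Longrightarrow> integrable (edge_law p s r d) f"
    and nn_integral_edge_law: "\<And>f :: real \<Rightarrow> real. f \<in> borel_measurable borel \<Longrightarrow> (\<And>x. f x \<ge> 0) \<Longrightarrow>
      (\<integral>\<^sup>+x. ennreal (f x) \<partial>edge_law p s r d) =
        ennreal (p * f (s * (1 - r) / sqrt d) + (1 - p) * f (s * (0 - r) / sqrt d))"
  unfolding edge_law_def using p
  by (simp_all add: integral_distr integrable_distr_eq nn_integral_distr integrable_measure_pmf_finite
      ennreal_plus ennreal_mult mult.commute)

lemma edge_law_real_law:
  assumes p: "0 \<le> p" "p \<le> 1"
  shows "real_law (edge_law p s r d)"
proof -
  interpret prob_space "edge_law p s r d" unfolding edge_law_def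
    by (intro prob_space.prob_space_distr measure_pmf.prob_space_axioms) simp
  show ?thesis
    by unfold_locales (use integrable_edge_law[OF p, of "\<lambda>x. x"] in \<open>auto simp: edge_law_def\<close>)
qed

text \<open>\<open>exp_le_quadratic\<close> is applied at both atoms, where the exponent has size at
  most 1 because \<open>\<bar>t\<bar> \<le> 1\<close> and \<open>d \<ge> 1\<close>. The linear terms
  cancel, and the quadratic ones add up to \<open>p * (1 - p) * t\<^sup>2 / d\<close>.\<close>

lemma edge_law_subexponential:
  assumes p: "0 \<le> p" "p \<le> 1" and d: "d \<ge> 1" and s: "\<bar>s\<bar> = 1" and v: "p / d \<le> v"
  shows "subexponential_law (edge_law p s r d) (s * (p - r) / sqrt d) v"
  unfolding subexponential_law_def
proof (intro allI impI)
  fix t :: real assume t: "\<bar>t\<bar> \<le> 1"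
  define w where "w = t * s / sqrt d"
  have s2: "s\<^sup>2 = 1" using s by (metis power2_abs one_power2)
  have w: "\<bar>w\<bar> \<le> 1" "w\<^sup>2 = t\<^sup>2 / d"
  proof -
    have "1 \<le> sqrt d" using d by simp
    then have "\<bar>t\<bar> / sqrt d \<le> 1 / 1" using t by (intro frac_le) auto
    then show "\<bar>w\<bar> \<le> 1" using s d by (simp add: w_def abs_mult)
    show "w\<^sup>2 = t\<^sup>2 / d" using d s2 by (simp add: w_def power_divide power_mult_distrib)
  qed
  have e: "t * (s * (x - r) / sqrt d - s * (p - r) / sqrt d) = w * (x - p)" for x
    by (simp add: w_def diff_divide_distrib[symmetric] algebra_simps)
  have b: "\<bar>w * (1 - p)\<bar> \<le> 1" "\<bar>w * (0 - p)\<bar> \<le> 1"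
    using w(1) p unfolding abs_mult by (intro mult_le_one; simp)+
  have "(\<integral>\<^sup>+x. ennreal (exp (t * (x - s * (p - r) / sqrt d))) \<partial>edge_law p s r d) =
      ennreal (p * exp (w * (1 - p)) + (1 - p) * exp (w * (0 - p)))"
    by (subst nn_integral_edge_law[OF p]) (auto simp only: e[symmetric] intro: borel_measurable_exp, measurable)
  also have "\<dots> \<le> ennreal (exp (v * t\<^sup>2))"
  proof (rule ennreal_leI)
    have "p * exp (w * (1 - p)) + (1 - p) * exp (w * (0 - p)) \<le>
        p * (1 + w * (1 - p) + (w * (1 - p))\<^sup>2) + (1 - p) * (1 + w * (0 - p) + (w * (0 - p))\<^sup>2)"
      using b p by (intro add_mono mult_left_mono exp_le_quadratic) auto
    also have "\<dots> = 1 + (p * (1 - p)) * w\<^sup>2" by (simp add: power2_eq_square algebra_simps)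
    also have "\<dots> \<le> 1 + p * w\<^sup>2" using p by (intro add_left_mono mult_right_mono) (auto simp: mult_left_le)
    also have "\<dots> \<le> 1 + v * t\<^sup>2"
      using mult_right_mono[OF v, of "t\<^sup>2"] by (simp add: w)
    also have "\<dots> \<le> exp (v * t\<^sup>2)" by (rule exp_ge_add_one_self)
    finally show "p * exp (w * (1 - p)) + (1 - p) * exp (w * (0 - p)) \<le> exp (v * t\<^sup>2)" .
  qed
  finally show "(\<integral>\<^sup>+x. ennreal (exp (t * (x - s * (p - r) / sqrt d))) \<partial>edge_law p s r d) \<le> ennreal (exp (v * t\<^sup>2))" .
qed

text \<open>The bound on the third absolute moment is \<open>p / d\<close>, the order of the
  variance for small \<open>p\<close>, times the jump \<open>1 / sqrt d\<close>. This is the origin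
  of the factor \<open>1 / sqrt d\<close> in the cost of exchanging the laws.\<close>

lemma edge_law_moments:
  assumes p: "0 \<le> p" "p \<le> 1" and d: "d > 0" and s: "\<bar>s\<bar> = 1"
  shows "law_moments (edge_law p s r d) (s * (p - r) / sqrt d) (p * (1 - p) / d) (p / (d * sqrt d))"
proof -
  have s2: "s\<^sup>2 = 1" using s by (metis power2_abs one_power2)
  have e: "s * (x - r) / sqrt d - s * (p - r) / sqrt d = s * (x - p) / sqrt d" for x
    by (simp add: diff_divide_distrib[symmetric] algebra_simps)
  have d3: "sqrt d ^ 3 = d * sqrt d" using d by (simp add: power3_eq_cube)
  have c: "\<bar>s * (x - p) / sqrt d\<bar> ^ 3 = \<bar>x - p\<bar> ^ 3 / (d * sqrt d)" for x
    using d s by (simp add: abs_mult power_divide d3)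
  have q: "(s * (x - p) / sqrt d)\<^sup>2 = (x - p)\<^sup>2 / d" for x
    using d s2 by (simp add: power_divide power_mult_distrib)
  have "p * (\<bar>1 - p\<bar> ^ 3) + (1 - p) * (\<bar>0 - p\<bar> ^ 3) \<le> p * (1 - p) + (1 - p) * (p * p)"
  proof (intro add_mono mult_left_mono)
    show "\<bar>1 - p\<bar> ^ 3 \<le> 1 - p" using p power_decreasing[of 1 3 "1 - p"] by simp
    show "\<bar>0 - p\<bar> ^ 3 \<le> p * p" using p power_decreasing[of 2 3 p] by (simp add: power2_eq_square)
  qed (use p in auto)
  also have "\<dots> = p * ((1 - p) * (1 + p))" by (simp add: algebra_simps)
  also have "\<dots> \<le> p * 1" using p by (intro mult_left_mono) (auto simp: algebra_simps)
  finally have 3: "p * (\<bar>1 - p\<bar> ^ 3 / (d * sqrt d)) + (1 - p) * (\<bar>0 - p\<bar> ^ 3 / (d * sqrt d)) \<le> p / (d * sqrt d)"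
    using d by (simp add: add_divide_distrib[symmetric] divide_right_mono)
  have 2: "p * ((1 - p)\<^sup>2 / d) + (1 - p) * ((0 - p)\<^sup>2 / d) = p * (1 - p) / d"
    using d by (simp add: field_simps power2_eq_square)
  have 1: "p * (s * (1 - r) / sqrt d) + (1 - p) * (s * (0 - r) / sqrt d) = s * (p - r) / sqrt d"
    by (simp add: field_simps add_divide_distrib[symmetric])
  show ?thesis
    unfolding law_moments_def
  proof (intro conjI)
    show "integrable (edge_law p s r d) (\<lambda>x. \<bar>x - s * (p - r) / sqrt d\<bar> ^ 3)"
      "integrable (edge_law p s r d) (\<lambda>x. (x - s * (p - r) / sqrt d)\<^sup>2)"
      by (intro integrable_edge_law[OF p]; measurable)+
    have "(\<integral>x. x \<partial>edge_law p s r d) = p * (s * (1 - r) / sqrt d) + (1 - p) * (s * (0 - r) / sqrt d)"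
      by (rule integral_edge_law[OF p]) measurable
    with 1 show "(\<integral>x. x \<partial>edge_law p s r d) = s * (p - r) / sqrt d" by (simp only:)
    have "(\<integral>x. (x - s * (p - r) / sqrt d)\<^sup>2 \<partial>edge_law p s r d) =
        p * (s * (1 - r) / sqrt d - s * (p - r) / sqrt d)\<^sup>2 + (1 - p) * (s * (0 - r) / sqrt d - s * (p - r) / sqrt d)\<^sup>2"
      by (rule integral_edge_law[OF p]) measurable
    with 2 show "(\<integral>x. (x - s * (p - r) / sqrt d)\<^sup>2 \<partial>edge_law p s r d) = p * (1 - p) / d"
      by (simp only: e q)
    have "(\<integral>x. \<bar>x - s * (p - r) / sqrt d\<bar> ^ 3 \<partial>edge_law p s r d) =
        p * \<bar>s * (1 - r) / sqrt d - s * (p - r) / sqrt d\<bar> ^ 3 + (1 - p) * \<bar>s * (0 - r) / sqrt d - s * (p - r) / sqrt d\<bar> ^ 3"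
      by (rule integral_edge_law[OF p]) measurable
    with 3 show "(\<integral>x. \<bar>x - s * (p - r) / sqrt d\<bar> ^ 3 \<partial>edge_law p s r d) \<le> p / (d * sqrt d)"
      by (simp only: e c)
  qed
qed

section \<open>Stochastic block model and spiked GOE\<close>

text \<open>The bridge from the discrete product defining the graph to a product of real laws;
  comparison on boxes is enough.\<close>

lemma distr_Pi_pmf:
  fixes h :: "'e \<Rightarrow> 'b \<Rightarrow> real"
  assumes A: "finite A"
  shows "distr (measure_pmf (Pi_pmf A dflt q)) (PiM A (\<lambda>_. borel)) (\<lambda>g. \<lambda>e\<in>A. h e (g e)) =
    PiM A (\<lambda>e. distr (measure_pmf (q e)) borel (h e))"
proof -
  define M where "M e = distr (measure_pmf (q e)) borel (h e)" for e
  have M: "prob_space (M e)" for e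
    unfolding M_def by (intro prob_space.prob_space_distr measure_pmf.prob_space_axioms) simp
  interpret product_sigma_finite M
    by (intro product_sigma_finite.intro prob_space_imp_sigma_finite M)
  have "distr (measure_pmf (Pi_pmf A dflt q)) (PiM A (\<lambda>_. borel)) (\<lambda>g. \<lambda>e\<in>A. h e (g e)) = PiM A M"
  proof (rule PiM_eqI[OF A])
    show "sets (distr (measure_pmf (Pi_pmf A dflt q)) (PiM A (\<lambda>_. borel)) (\<lambda>g. \<lambda>e\<in>A. h e (g e))) = sets (PiM A M)"
      unfolding sets_distr by (rule sets_PiM_cong) (auto simp: M_def)
    fix B assume B: "\<And>e. e \<in> A \<Longrightarrow> B e \<in> sets (M e)"
    then have B': "\<And>e. e \<in> A \<Longrightarrow> B e \<in> sets borel" by (simp add: M_def)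
    have "emeasure (distr (measure_pmf (Pi_pmf A dflt q)) (PiM A (\<lambda>_. borel)) (\<lambda>g. \<lambda>e\<in>A. h e (g e))) (PiE A B) =
        emeasure (measure_pmf (Pi_pmf A dflt q)) ((\<lambda>g. \<lambda>e\<in>A. h e (g e)) -` PiE A B)"
      using A B' by (subst emeasure_distr) (auto intro!: sets_PiM_I_finite simp: space_PiM)
    also have "(\<lambda>g. \<lambda>e\<in>A. h e (g e)) -` PiE A B = Pi A (\<lambda>e. h e -` B e)"
      by (auto simp: PiE_iff Pi_iff)
    also have "emeasure (measure_pmf (Pi_pmf A dflt q)) (Pi A (\<lambda>e. h e -` B e)) =
        (\<Prod>e\<in>A. emeasure (measure_pmf (q e)) (h e -` B e))"
      unfolding measure_pmf.emeasure_eq_measure measure_Pi_pmf_Pi[OF A] by (simp add: prod_ennreal)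
    also have "\<dots> = (\<Prod>e\<in>A. emeasure (M e) (B e))"
      using B' by (intro prod.cong refl) (simp add: M_def emeasure_distr)
    finally show "emeasure (distr (measure_pmf (Pi_pmf A dflt q)) (PiM A (\<lambda>_. borel)) (\<lambda>g. \<lambda>e\<in>A. h e (g e))) (PiE A B)
        = (\<Prod>e\<in>A. emeasure (M e) (B e))" .
  qed
  then show ?thesis by (simp add: M_def[abs_def])
qed

lemma law_moments_mono: "law_moments M m V T \<Longrightarrow> T \<le> T' \<Longrightarrow> law_moments M m V T'"
  by (auto simp: law_moments_def)

lemma sdp_sym_matrix_cong:
  "(\<And>e. e \<in> upper_pairs n \<Longrightarrow> x e = y e) \<Longrightarrow> sdp n (sym_matrix x) = sdp n (sym_matrix y)"
  by (rule sdp_cong) (auto simp: sym_matrix_def upper_pairs_def min_def max_def)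

definition goe_law :: "real \<Rightarrow> nat \<Rightarrow> nat \<times> nat \<Rightarrow> real measure" where
  "goe_law l n e = normal_law (l / n) (sqrt (if fst e = snd e then 2 / n else 1 / n))"

definition side :: "nat set \<Rightarrow> nat \<Rightarrow> real" where
  "side S i = (if i \<in> S then 1 else - 1)"

lemma side_square [simp]: "side S i * side S i = 1"
  by (simp add: side_def)

text \<open>The bound \<open>2 * d \<le> n\<close> makes \<open>a / n\<close> and
  \<open>b / n\<close> probabilities, since nonnegative \<open>a\<close> and \<open>b\<close> have
  sum \<open>2 * d\<close>.\<close>

locale planted =
  fixes a b d l :: real and n :: nat
  assumes ab: "0 \<le> a" "0 \<le> b" and d: "d = avg_degree a b" and l: "l = snr a b" and l0: "0 \<le> l"
    and d1: "1 \<le> d" and n2d: "2 * d \<le> n"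
begin

lemma n_pos: "n > 0" "real n > 0" "real n \<ge> 1"
  using d1 n2d by auto

lemma sqrt_d: "1 \<le> sqrt d" "sqrt d > 0" "sqrt d * sqrt d = d" "sqrt d \<le> d"
proof -
  show "1 \<le> sqrt d" "sqrt d > 0" "sqrt d * sqrt d = d" using d1 by auto
  then have "1 * sqrt d \<le> sqrt d * sqrt d" by (intro mult_right_mono) auto
  then show "sqrt d \<le> d" using \<open>sqrt d * sqrt d = d\<close> by simp
qed

lemma ab_eq: "a = d + l * sqrt d" "b = d - l * sqrt d"
proof -
  have "2 * (a + b) = 4 * d" by (simp add: d avg_degree_def)
  then have "sqrt (2 * (a + b)) = 2 * sqrt d" by (simp add: real_sqrt_mult)
  then have "l * sqrt d = (a - b) / 2" using sqrt_d by (simp add: l snr_def)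
  then show "a = d + l * sqrt d" "b = d - l * sqrt d" by (auto simp: d avg_degree_def field_simps)
qed

(* The probability 0 on the diagonal makes the constant diagonal entries - d / n fit into the same
   product law as the others. *)
definition edge_prob :: "nat set \<Rightarrow> nat \<times> nat \<Rightarrow> real" where
  "edge_prob S = (\<lambda>(i, j). if i < j then (if i \<in> S \<longleftrightarrow> j \<in> S then a / n else b / n) else 0)"

definition graph_entry :: "nat set \<Rightarrow> nat \<times> nat \<Rightarrow> bool \<Rightarrow> real" where
  "graph_entry S e z = side S (fst e) * side S (snd e) * (of_bool z - d / n) / sqrt d"

definition graph_law :: "nat set \<Rightarrow> nat \<times> nat \<Rightarrow> real measure" where
  "graph_law S e = edge_law (edge_prob S e) (side S (fst e) * side S (snd e)) (d / n) d"

definition graph_mean :: "nat set \<Rightarrow> nat \<times> nat \<Rightarrow> real" where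
  "graph_mean S e = side S (fst e) * side S (snd e) * (edge_prob S e - d / n) / sqrt d"

lemma edge_prob_bounds: "0 \<le> edge_prob S e" "edge_prob S e \<le> 2 * d / n" "edge_prob S e \<le> 1"
proof -
  have "a \<le> 2 * d" "b \<le> 2 * d" using ab by (auto simp: d avg_degree_def)
  then have "a / n \<le> 2 * d / n" "b / n \<le> 2 * d / n" by (auto intro: divide_right_mono)
  moreover have "2 * d / n \<ge> 0" using d1 by simp
  ultimately show *: "edge_prob S e \<le> 2 * d / n" by (auto simp: edge_prob_def split: prod.splits)
  have "2 * d / n \<le> 1" using n2d n_pos by simp
  with * show "edge_prob S e \<le> 1" by simp
  show "0 \<le> edge_prob S e" using ab by (auto simp: edge_prob_def split: prod.splits)
qed

lemma side_abs: "\<bar>side S i * side S j\<bar> = 1"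
  by (simp add: side_def)

lemma graph_real_laws: "real_laws (graph_law S)"
  unfolding real_laws_def graph_law_def using edge_law_real_law edge_prob_bounds by blast

lemma graph_subexponential: "subexponential_law (graph_law S e) (graph_mean S e) (2 / n)"
  unfolding graph_law_def graph_mean_def
proof (rule edge_law_subexponential)
  have "edge_prob S e / d \<le> (2 * d / n) / d"
    using edge_prob_bounds d1 by (intro divide_right_mono) auto
  then show "edge_prob S e / d \<le> 2 / n" using d1 by simp
qed (use edge_prob_bounds d1 side_abs in auto)

text \<open>Inside a part the centred and scaled mean is \<open>l / n\<close>; across the parts it
  is \<open>- (l / n)\<close>, and the sign product is -1. After the flip the mean no longer depends
  on \<open>S\<close> and equals that of the spiked GOE entry.\<close>

lemma graph_mean_offdiag:
  assumes "i < j"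
  shows "graph_mean S (i, j) = l / n"
proof -
  have 1: "(a / n - d / n) / sqrt d = l / n" "(b / n - d / n) / sqrt d = - (l / n)"
    using sqrt_d by (simp_all add: ab_eq add_divide_distrib diff_divide_distrib)
  have 2: "graph_mean S (i, j) = side S i * side S j * ((edge_prob S (i, j) - d / n) / sqrt d)"
    by (simp add: graph_mean_def)
  show ?thesis
  proof (cases "i \<in> S \<longleftrightarrow> j \<in> S")
    case True
    then have "side S i * side S j = 1" "edge_prob S (i, j) = a / n"
      using assms by (auto simp: side_def edge_prob_def)
    then show ?thesis unfolding 2 by (simp only: 1 mult_1)
  next
    case False
    then have "side S i * side S j = - 1" "edge_prob S (i, j) = b / n"
      using assms by (auto simp: side_def edge_prob_def)
    then show ?thesis unfolding 2 by (simp only: 1)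
  qed
qed

text \<open>The 1 in \<open>l + 1\<close> is for the diagonal, where each mean has size
  \<open>sqrt d / n\<close>, at most 1.\<close>

lemma graph_mean_sum: "(\<Sum>e\<in>upper_pairs n. \<bar>graph_mean S e\<bar>) \<le> (l + 1) * n"
proof -
  have "(\<Sum>e\<in>upper_pairs n. \<bar>graph_mean S e\<bar>) \<le> (\<Sum>e\<in>upper_pairs n. l / n + (if fst e = snd e then 1 else 0))"
  proof (rule sum_mono)
    fix e assume "e \<in> upper_pairs n"
    then obtain i j where e: "e = (i, j)" "i \<le> j" by (auto simp: upper_pairs_def)
    show "\<bar>graph_mean S e\<bar> \<le> l / n + (if fst e = snd e then 1 else 0)"
    proof (cases "i = j")
      case True
      have "\<bar>graph_mean S e\<bar> = d / sqrt d / n"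
        using e True d1 by (simp add: graph_mean_def edge_prob_def)
      also have "d / sqrt d = sqrt d" using d1 by (simp add: real_div_sqrt)
      also have "sqrt d / n \<le> 1" using sqrt_d n2d d1 n_pos by simp
      finally show ?thesis using True e l0 by (simp add: add_increasing)
    next
      case False
      then show ?thesis using e graph_mean_offdiag[of i j S] l0 by simp
    qed
  qed
  also have "\<dots> = card (upper_pairs n) * (l / n) + card {e \<in> upper_pairs n. fst e = snd e}"
    by (simp add: sum.distrib sum.If_cases Int_def)
  also have "\<dots> \<le> (real n)\<^sup>2 * (l / n) + n"
  proof (intro add_mono mult_right_mono card_upper_pairs_le)
    have "{e \<in> upper_pairs n. fst e = snd e} = (\<lambda>i. (i, i)) ` {..<n}"
      by (auto simp: upper_pairs_def)
    then have "card {e \<in> upper_pairs n. fst e = snd e} = n" by (simp add: card_image inj_on_def)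
    then show "real (card {e \<in> upper_pairs n. fst e = snd e}) \<le> n" by simp
  qed (use l0 in simp)
  also have "\<dots> = (l + 1) * n" using n_pos by (simp add: power2_eq_square algebra_simps)
  finally show ?thesis .
qed

text \<open>The variance is \<open>p / d - p\<^sup>2 / d\<close>. The first term differs from
  \<open>1 / n\<close> by \<open>l / (sqrt d * n)\<close> because \<open>a\<close> and
  \<open>b\<close> differ from \<open>d\<close> by \<open>l * sqrt d\<close>; the second is at most
  \<open>4 * d / n\<^sup>2\<close> and becomes negligible for large \<open>n\<close>.\<close>

lemma graph_moments:
  assumes "i < j"
  shows "\<exists>V. \<bar>V - 1 / n\<bar> \<le> l / (sqrt d * n) + 4 * d / (real n)\<^sup>2 \<and>
    law_moments (graph_law S (i, j)) (l / n) V (2 / (n * sqrt d))"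
proof (intro exI conjI)
  define p where "p = edge_prob S (i, j)"
  have p: "0 \<le> p" "p \<le> 1" "p \<le> 2 * d / n" using edge_prob_bounds by (auto simp: p_def)
  have "law_moments (graph_law S (i, j)) (graph_mean S (i, j)) (p * (1 - p) / d) (p / (d * sqrt d))"
    unfolding graph_law_def graph_mean_def p_def
    by (rule edge_law_moments) (use edge_prob_bounds d1 side_abs in auto)
  moreover have "p / (d * sqrt d) \<le> (2 * d / n) / (d * sqrt d)"
    using p d1 by (intro divide_right_mono) auto
  then have "p / (d * sqrt d) \<le> 2 / (n * sqrt d)" using d1 by simp
  ultimately show "law_moments (graph_law S (i, j)) (l / n) (p * (1 - p) / d) (2 / (n * sqrt d))"
    unfolding graph_mean_offdiag[OF assms] by (rule law_moments_mono)
  have "p / d - 1 / n = l / (sqrt d * n) \<or> p / d - 1 / n = - (l / (sqrt d * n))"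
  proof -
    have q: "l * sqrt d / d = l / sqrt d" using sqrt_d(2,3) by (metis mult_divide_mult_cancel_right less_irrefl)
    have "a / n / d - 1 / n = (l * sqrt d / d) / n" "b / n / d - 1 / n = - ((l * sqrt d / d) / n)"
      using d1 n_pos by (simp_all add: ab_eq field_simps)
    then show ?thesis using assms unfolding q by (auto simp: p_def edge_prob_def)
  qed
  then have 1: "\<bar>p / d - 1 / n\<bar> \<le> l / (sqrt d * n)" using l0 d1 by auto
  have "p\<^sup>2 \<le> (2 * d / n)\<^sup>2" using p by (intro power_mono) auto
  then have "p\<^sup>2 / d \<le> (2 * d / n)\<^sup>2 / d" using d1 by (intro divide_right_mono) auto
  then have 2: "p\<^sup>2 / d \<le> 4 * d / (real n)\<^sup>2" using d1 by (simp add: power_divide power2_eq_square)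
  have "p * (1 - p) / d = p / d - p\<^sup>2 / d" by (simp add: power2_eq_square right_diff_distrib diff_divide_distrib)
  moreover have "p\<^sup>2 / d \<ge> 0" using d1 by simp
  ultimately show "\<bar>p * (1 - p) / d - 1 / n\<bar> \<le> l / (sqrt d * n) + 4 * d / (real n)\<^sup>2"
    using 1 2 by (simp add: abs_le_iff)
qed

lemma graph_diag_abs: "(\<integral>x. \<bar>x\<bar> \<partial>graph_law S (i, i)) = sqrt d / n"
proof -
  have p: "edge_prob S (i, i) = 0" by (simp add: edge_prob_def)
  have "(\<integral>x. \<bar>x\<bar> \<partial>graph_law S (i, i)) = d / sqrt d / n"
    unfolding graph_law_def p using d1
    by (subst integral_edge_law) (auto simp: side_abs)
  also have "d / sqrt d = sqrt d" using d1 by (simp add: real_div_sqrt)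
  finally show ?thesis .
qed

abbreviation block_graph :: "nat set \<Rightarrow> (nat \<times> nat \<Rightarrow> bool) pmf" where
  "block_graph S \<equiv> Pi_pmf {(i, j). i < j \<and> j < n} False
      (\<lambda>(i, j). bernoulli_pmf (if i \<in> S \<longleftrightarrow> j \<in> S then a / n else b / n))"

lemma distr_graph:
  "distr (measure_pmf (block_graph S)) (PiM (upper_pairs n) (\<lambda>_. borel))
     (\<lambda>g. \<lambda>e\<in>upper_pairs n. graph_entry S e (g e)) = PiM (upper_pairs n) (graph_law S)"
proof -
  have b0: "bernoulli_pmf 0 = return_pmf False"
    by (rule pmf_eqI) (case_tac i; simp)
  have "block_graph S = Pi_pmf {(i, j). i < j \<and> j < n} False (\<lambda>e. bernoulli_pmf (edge_prob S e))"
    by (rule Pi_pmf_cong) (auto simp: edge_prob_def)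
  \<comment> \<open>The edge probability is 0 on the diagonal, so the added coordinates are
    constantly \<open>False\<close>, the default value of the product.\<close>
  also have "\<dots> = Pi_pmf (upper_pairs n) False (\<lambda>e. bernoulli_pmf (edge_prob S e))"
  proof (rule Pi_pmf_subset'[symmetric])
    fix e assume "e \<in> upper_pairs n - {(i, j). i < j \<and> j < n}"
    then have "edge_prob S e = 0" by (auto simp: upper_pairs_def edge_prob_def split: if_splits)
    then show "bernoulli_pmf (edge_prob S e) = return_pmf False" by (simp add: b0)
  next
    show "{(i, j). i < j \<and> j < n} \<subseteq> upper_pairs n" by (auto simp: upper_pairs_def)
  qed simp
  finally have eq: "block_graph S = Pi_pmf (upper_pairs n) False (\<lambda>e. bernoulli_pmf (edge_prob S e))" .
  have law: "graph_law S = (\<lambda>e. distr (measure_pmf (bernoulli_pmf (edge_prob S e))) borel (graph_entry S e))"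
    by (simp add: fun_eq_iff graph_law_def edge_law_def graph_entry_def[abs_def])
  show ?thesis unfolding eq law by (rule distr_Pi_pmf) simp
qed

lemma goe_sigma_pos: "sqrt (if fst e = snd (e :: nat \<times> nat) then 2 / n else 1 / n) > 0"
  using n_pos by simp

lemma goe_real_laws: "real_laws (goe_law l n)"
  unfolding real_laws_def goe_law_def using normal_law_real_law[OF goe_sigma_pos] by blast

lemma goe_subexponential: "subexponential_law (goe_law l n e) (l / n) (2 / n)"
  unfolding goe_law_def
  by (rule normal_law_subexponential[OF goe_sigma_pos]) (auto intro: divide_right_mono)

lemma goe_mean_sum: "(\<Sum>e\<in>upper_pairs n. \<bar>l / n\<bar>) \<le> (l + 1) * n"
proof -
  have "real (card (upper_pairs n)) * (l / n) \<le> (real n)\<^sup>2 * (l / n)"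
    using l0 by (intro mult_right_mono card_upper_pairs_le) auto
  also have "\<dots> \<le> (l + 1) * n" using n_pos by (simp add: power2_eq_square algebra_simps)
  finally show ?thesis using l0 by simp
qed

lemma distr_goe:
  "distr (goe n) (PiM (upper_pairs n) (\<lambda>_. borel)) (\<lambda>w. \<lambda>e\<in>upper_pairs n. l / n + w e)
   = PiM (upper_pairs n) (goe_law l n)"
proof -
  define \<sigma> where "\<sigma> e = sqrt (if fst e = snd (e :: nat \<times> nat) then 2 / n else 1 / n)" for e
  have \<sigma>: "\<sigma> e > 0" for e using goe_sigma_pos by (simp add: \<sigma>_def)
  have goe: "goe n = PiM (upper_pairs n) (\<lambda>e. normal_law 0 (\<sigma> e))"
    by (simp add: goe_def upper_pairs_def normal_law_def \<sigma>_def case_prod_unfold)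
  have law: "goe_law l n e = normal_law (l / n) (\<sigma> e)" for e
    by (simp add: goe_law_def \<sigma>_def)
  have sets: "sets (goe_law l n e) = sets borel" for e
    by (simp add: law normal_law_def)
  have 1: "distr (PiM (upper_pairs n) (\<lambda>e. normal_law 0 (\<sigma> e))) (PiM (upper_pairs n) (goe_law l n))
      (compose (upper_pairs n) (\<lambda>w. l / n + w)) =
    PiM (upper_pairs n) (\<lambda>e. distr (normal_law 0 (\<sigma> e)) (goe_law l n e) (\<lambda>w. l / n + w))"
  proof (rule distr_PiM_finite_prob_space')
    show "prob_space (normal_law 0 (\<sigma> e))" "prob_space (goe_law l n e)" for e
      unfolding law using normal_law_real_law[OF \<sigma>] by (simp_all add: real_law_def)
    show "(\<lambda>w. l / n + w) \<in> measurable (normal_law 0 (\<sigma> e)) (goe_law l n e)" for e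
      unfolding measurable_cong_sets[OF refl sets] by (simp add: normal_law_def)
  qed simp
  have 2: "distr (normal_law 0 (\<sigma> e)) (goe_law l n e) (\<lambda>w. l / n + w) = goe_law l n e" for e
  proof -
    have "distr (normal_law 0 (\<sigma> e)) (goe_law l n e) (\<lambda>w. l / n + w) = distr (normal_law 0 (\<sigma> e)) borel (\<lambda>w. l / n + w)"
      by (rule distr_cong) (auto simp: sets)
    then show ?thesis by (simp add: distr_normal_law_shift[OF \<sigma>] law)
  qed
  have "distr (PiM (upper_pairs n) (\<lambda>e. normal_law 0 (\<sigma> e))) (PiM (upper_pairs n) (goe_law l n))
      (compose (upper_pairs n) (\<lambda>w. l / n + w)) =
    distr (goe n) (PiM (upper_pairs n) (\<lambda>_. borel)) (\<lambda>w. \<lambda>e\<in>upper_pairs n. l / n + w e)"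
    unfolding goe by (rule distr_cong) (auto simp: compose_def intro!: sets_PiM_cong sets)
  with 1 show ?thesis by (simp only: 2)
qed

text \<open>The bound of \<open>lse_swap\<close> with the variance gap, the third moments and the
  diagonal moments of the two models inserted.\<close>

definition swap_error :: "real \<Rightarrow> real" where
  "swap_error \<beta> = (real n)\<^sup>2 * (4 * \<beta> * (l / (sqrt d * n) + 4 * d / (real n)\<^sup>2) +
     8 * \<beta>\<^sup>2 * (2 / (n * sqrt d) + 2 * sqrt (1 / n) ^ 3)) + n * (2 * (sqrt d / n + (l / n + sqrt (2 / n))))"

text \<open>Neither the bound nor the GOE side involves \<open>S\<close>; this is what allows the
  random partition to be averaged out later.\<close>

lemma smooth_sdp_swap:
  assumes \<beta>: "\<beta> > 0" and C: "finite C" "C \<noteq> {}" "\<And>c e. c \<in> C \<Longrightarrow> e \<in> upper_pairs n \<Longrightarrow> \<bar>c e\<bar> \<le> 2"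
  shows "\<bar>(\<integral>x. lse \<beta> C (upper_pairs n) x \<partial>PiM (upper_pairs n) (graph_law S)) -
    (\<integral>x. lse \<beta> C (upper_pairs n) x \<partial>PiM (upper_pairs n) (goe_law l n))\<bar> \<le> swap_error \<beta>"
  unfolding swap_error_def
proof (rule lse_swap[OF graph_real_laws goe_real_laws C(1,2), where W = "1 / n" and m = "l / n"])
  fix i j :: nat assume "i < j" "j < n"
  then show "law_moments (goe_law l n (i, j)) (l / n) (1 / n) (2 * sqrt (1 / n) ^ 3)"
    using normal_law_moments[of "sqrt (1 / n)" "l / n"] n_pos by (simp add: goe_law_def)
  show "\<exists>V. \<bar>V - 1 / n\<bar> \<le> l / (sqrt d * n) + 4 * d / (real n)\<^sup>2 \<and>
    law_moments (graph_law S (i, j)) (l / n) V (2 / (n * sqrt d))"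
    by (rule graph_moments) fact
next
  fix i
  show "(\<integral>x. \<bar>x\<bar> \<partial>graph_law S (i, i)) + (\<integral>x. \<bar>x\<bar> \<partial>goe_law l n (i, i)) \<le> sqrt d / n + (l / n + sqrt (2 / n))"
    using normal_law_abs_le[of "sqrt (2 / n)" "l / n"] n_pos l0
    by (simp add: graph_diag_abs goe_law_def)
qed (use l0 d1 \<beta> C(3) in auto)

end

section \<open>Both programs near a common centre, and the choice of parameters\<close>

abbreviation sdp_close ::
    "nat \<Rightarrow> real \<Rightarrow> real \<Rightarrow> real \<Rightarrow> (nat \<times> nat \<Rightarrow> bool) \<Rightarrow> (nat \<times> nat \<Rightarrow> real) \<Rightarrow> bool" where
  "sdp_close n d l c g w \<equiv>
     \<bar>sdp n (centered_adjacency n d g) / (real n * sqrt d) - sdp n (spiked_goe n l w) / real n\<bar> \<le> c \<and>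
     \<bar>sdp n (\<lambda>i j. - centered_adjacency n d g i j) / (real n * sqrt d)
       - sdp n (\<lambda>i j. - spiked_goe n l w i j) / real n\<bar> \<le> c"

context planted begin

text \<open>The sign flip by the partition leaves the value unchanged and the positive scaling
  factors out, so the graph program becomes a function of entries that are independent given
  \<open>S\<close>.\<close>

lemma sdp_centered_adjacency:
  fixes S g
  defines "x \<equiv> \<lambda>e\<in>upper_pairs n. graph_entry S e (g e)"
  shows "sdp n (centered_adjacency n d g) / sqrt d = sdp n (sym_matrix x)"
    and "sdp n (\<lambda>i j. - centered_adjacency n d g i j) / sqrt d = sdp n (sym_matrix (\<lambda>e. - x e))"
proof -
  have entry: "sym_matrix x i j = side S i * side S j * (1 / sqrt d * centered_adjacency n d g i j)"
    if "i < n" "j < n" for i j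
  proof -
    have "(min i j, max i j) \<in> upper_pairs n" using that by (auto simp: upper_pairs_def)
    moreover have "side S (min i j) * side S (max i j) = side S i * side S j"
      by (simp add: min_def max_def mult.commute)
    ultimately show ?thesis
      by (simp add: x_def sym_matrix_def graph_entry_def centered_adjacency_def adjacency_def)
  qed
  have "sdp n (sym_matrix x) = sdp n (\<lambda>i j. side S i * side S j * (1 / sqrt d * centered_adjacency n d g i j))"
    by (rule sdp_cong) (rule entry)
  also have "\<dots> = 1 / sqrt d * sdp n (centered_adjacency n d g)"
    using d1 by (simp only: sdp_sign_flip side_square) (subst sdp_scale, auto)
  finally show "sdp n (centered_adjacency n d g) / sqrt d = sdp n (sym_matrix x)" by simp
  have "sdp n (sym_matrix (\<lambda>e. - x e)) =
      sdp n (\<lambda>i j. side S i * side S j * (1 / sqrt d * - centered_adjacency n d g i j))"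
    unfolding sym_matrix_uminus by (rule sdp_cong) (simp add: entry)
  also have "\<dots> = 1 / sqrt d * sdp n (\<lambda>i j. - centered_adjacency n d g i j)"
    using d1 by (simp only: sdp_sign_flip side_square) (subst sdp_scale, auto)
  finally show "sdp n (\<lambda>i j. - centered_adjacency n d g i j) / sqrt d = sdp n (sym_matrix (\<lambda>e. - x e))" by simp
qed

text \<open>The common centre of both programs, taken on the GOE side so that it does not depend on
  the partition.\<close>

definition smooth_mean :: "nat \<Rightarrow> real \<Rightarrow> real" where
  "smooth_mean k \<beta> = (\<integral>x. smooth_sdp k \<beta> n x \<partial>PiM (upper_pairs n) (goe_law l n))"

definition smooth_mean_uminus :: "nat \<Rightarrow> real \<Rightarrow> real" where
  "smooth_mean_uminus k \<beta> = (\<integral>x. smooth_sdp k \<beta> n (\<lambda>e. - x e) \<partial>PiM (upper_pairs n) (goe_law l n))"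

definition radius :: "nat \<Rightarrow> real \<Rightarrow> real \<Rightarrow> real" where
  "radius k \<beta> t = n * (t + (k * ln (5 * real k) / \<beta> + 80 / k * (8 * (net_const + (l + 1)))))"

abbreviation graph_near :: "nat \<Rightarrow> real \<Rightarrow> real \<Rightarrow> (nat \<times> nat \<Rightarrow> bool) \<Rightarrow> bool" where
  "graph_near k \<beta> r g \<equiv>
     \<bar>sdp n (centered_adjacency n d g) / sqrt d - smooth_mean k \<beta>\<bar> \<le> r \<and>
     \<bar>sdp n (\<lambda>i j. - centered_adjacency n d g i j) / sqrt d - smooth_mean_uminus k \<beta>\<bar> \<le> r"

abbreviation goe_near :: "nat \<Rightarrow> real \<Rightarrow> real \<Rightarrow> (nat \<times> nat \<Rightarrow> real) \<Rightarrow> bool" where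
  "goe_near k \<beta> r w \<equiv>
     \<bar>sdp n (spiked_goe n l w) - smooth_mean k \<beta>\<bar> \<le> r \<and>
     \<bar>sdp n (\<lambda>i j. - spiked_goe n l w i j) - smooth_mean_uminus k \<beta>\<bar> \<le> r"

lemma sdp_sym_matrix_uminus_measurable:
  "(\<lambda>x. sdp n (sym_matrix (\<lambda>e. - x e))) \<in> borel_measurable (PiM (upper_pairs n) (\<lambda>_. borel))"
proof -
  have "(\<lambda>x. \<lambda>e\<in>upper_pairs n. - x e) \<in> measurable (PiM (upper_pairs n) (\<lambda>_. borel)) (PiM (upper_pairs n) (\<lambda>_. borel :: real measure))"
    by measurable
  from measurable_compose[OF this sdp_sym_matrix_measurable]
  have "(\<lambda>x. sdp n (sym_matrix (\<lambda>e\<in>upper_pairs n. - x e))) \<in> borel_measurable (PiM (upper_pairs n) (\<lambda>_. borel :: real measure))" .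
  moreover have "sdp n (sym_matrix (\<lambda>e\<in>upper_pairs n. - x e)) = sdp n (sym_matrix (\<lambda>e. - x e))" for x
    by (rule sdp_sym_matrix_cong) simp
  ultimately show ?thesis by simp
qed

lemma sdp_far_measurable:
  "{x \<in> extensional (upper_pairs n). \<not> sdp_near n u u' r x}
    \<in> sets (PiM (upper_pairs n) (\<lambda>_. borel))"
proof -
  note [measurable] = sdp_sym_matrix_measurable sdp_sym_matrix_uminus_measurable
  have "{x \<in> space (PiM (upper_pairs n) (\<lambda>_. borel)). \<not> sdp_near n u u' r x}
    \<in> sets (PiM (upper_pairs n) (\<lambda>_. borel :: real measure))" by measurable
  then show ?thesis by (simp add: space_PiM PiE_def)
qed

text \<open>Concentration holds about the mean under the graph law; \<open>smooth_sdp_swap\<close>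
  moves the centre to the GOE mean, at the price of \<open>swap_error\<close> in the radius.\<close>

lemma block_graph_far:
  fixes t :: real
  assumes k: "k > 0" and \<beta>: "\<beta> > 0" and t: "t > 0"
  defines "r \<equiv> radius k \<beta> t + swap_error \<beta>"
  shows "measure_pmf.prob (block_graph S) {g.
      \<not> graph_near k \<beta> r g}
    \<le> 6 * exp (- (n * min 1 (t\<^sup>2) / 64))"
proof -
  let ?E = "upper_pairs n"
  define u where "u = (\<integral>x. smooth_sdp k \<beta> n x \<partial>PiM ?E (graph_law S))"
  define u' where "u' = (\<integral>x. smooth_sdp k \<beta> n (\<lambda>e. - x e) \<partial>PiM ?E (graph_law S))"
  have "\<bar>u - smooth_mean k \<beta>\<bar> \<le> swap_error \<beta>"
    unfolding u_def smooth_mean_def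
    by (intro smooth_sdp_swap \<beta> finite_net_coeffs net_coeffs_nonempty) (rule net_coeffs_bound[OF _ k])
  moreover have "\<bar>u' - smooth_mean_uminus k \<beta>\<bar> \<le> swap_error \<beta>"
    unfolding u'_def smooth_mean_uminus_def lse_uminus
    by (intro smooth_sdp_swap \<beta>) (use finite_net_coeffs net_coeffs_nonempty net_coeffs_bound k in auto)
  ultimately have uu: "\<bar>u - smooth_mean k \<beta>\<bar> \<le> swap_error \<beta>" "\<bar>u' - smooth_mean_uminus k \<beta>\<bar> \<le> swap_error \<beta>" .
  define B where "B = {x \<in> extensional ?E. \<not> sdp_near n u u' (radius k \<beta> t) x}"
  define X where "X g = (\<lambda>e\<in>?E. graph_entry S e (g e))" for g
  have "measure_pmf.prob (block_graph S) {g.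
      \<not> graph_near k \<beta> r g}
     \<le> measure_pmf.prob (block_graph S) (X -` B)"
  proof (rule measure_pmf.finite_measure_mono)
    show "{g. \<not> graph_near k \<beta> r g} \<subseteq> X -` B"
    proof
      fix g assume g: "g \<in> {g. \<not> graph_near k \<beta> r g}"
      have s: "sdp n (centered_adjacency n d g) / sqrt d = sdp n (sym_matrix (X g))"
        "sdp n (\<lambda>i j. - centered_adjacency n d g i j) / sqrt d = sdp n (sym_matrix (\<lambda>e. - X g e))"
        unfolding X_def by (rule sdp_centered_adjacency)+
      have far: "\<not> sdp_near n (smooth_mean k \<beta>) (smooth_mean_uminus k \<beta>) r (X g)"
        using g by (simp only: mem_Collect_eq s not_False_eq_True)
      have "\<not> sdp_near n u u' (radius k \<beta> t) (X g)"
        using far uu unfolding r_def by linarith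
      then show "g \<in> X -` B" by (simp add: B_def X_def)
    qed
  qed simp
  also have "\<dots> = measure (distr (measure_pmf (block_graph S)) (PiM ?E (\<lambda>_. borel)) X) B"
    unfolding B_def by (subst measure_distr) (use sdp_far_measurable in \<open>auto simp: X_def space_PiM\<close>)
  also have "\<dots> = measure (PiM ?E (graph_law S)) B"
    unfolding X_def distr_graph ..
  also have "\<dots> \<le> 6 * exp (- (n * min 1 (t\<^sup>2) / 64))"
    unfolding B_def u_def u'_def radius_def
    by (rule sdp_concentration[OF graph_real_laws n_pos(1) graph_subexponential graph_mean_sum k \<beta> t])
  finally show ?thesis .
qed

text \<open>The bound of \<open>block_graph_far\<close> is uniform in \<open>S\<close>, hence
  survives mixing over the random partition.\<close>

lemma sbm_far:
  fixes t :: real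
  assumes "k > 0" "\<beta> > 0" "t > 0"
  defines "r \<equiv> radius k \<beta> t + swap_error \<beta>"
  shows "measure_pmf.prob (sbm n (a / n) (b / n)) {g.
      \<not> graph_near k \<beta> r g}
    \<le> 6 * exp (- (n * min 1 (t\<^sup>2) / 64))"
proof -
  define A where "A = {g. \<not> graph_near k \<beta> r g}"
  define Q where "Q = pmf_of_set {S. S \<subseteq> {..<n} \<and> card S = n div 2}"
  have "emeasure (measure_pmf (sbm n (a / n) (b / n))) A =
      (\<integral>\<^sup>+S. emeasure (measure_pmf (block_graph S)) A \<partial>measure_pmf Q)"
    by (simp add: sbm_def Q_def)
  also have "\<dots> \<le> (\<integral>\<^sup>+S. ennreal (6 * exp (- (real n * min 1 (t\<^sup>2) / 64))) \<partial>measure_pmf Q)"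
    using block_graph_far[OF assms(1-3)]
    by (intro nn_integral_mono) (simp add: measure_pmf.emeasure_eq_measure A_def r_def)
  also have "\<dots> = ennreal (6 * exp (- (real n * min 1 (t\<^sup>2) / 64)))"
    by (simp add: measure_pmf.emeasure_space_1[simplified])
  finally show ?thesis by (simp add: measure_pmf.emeasure_eq_measure A_def)
qed

lemma shift_measurable:
  "(\<lambda>w. \<lambda>e\<in>upper_pairs n. l / n + w e) \<in> measurable (goe n) (PiM (upper_pairs n) (\<lambda>_. borel))"
proof -
  have "sets (goe n) = sets (PiM (upper_pairs n) (\<lambda>_. borel))"
    unfolding goe_def upper_pairs_def by (rule sets_PiM_cong) auto
  then show ?thesis
    by (subst measurable_cong_sets[OF _ refl]) measurable
qed

lemma sdp_spiked_goe:
  fixes w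
  defines "x \<equiv> \<lambda>e\<in>upper_pairs n. l / n + w e"
  shows "sdp n (spiked_goe n l w) = sdp n (sym_matrix x)"
    and "sdp n (\<lambda>i j. - spiked_goe n l w i j) = sdp n (sym_matrix (\<lambda>e. - x e))"
proof -
  have entry: "spiked_goe n l w i j = sym_matrix x i j" if "i < n" "j < n" for i j
    using that by (auto simp: x_def sym_matrix_def spiked_goe_def upper_pairs_def min_def max_def)
  show "sdp n (spiked_goe n l w) = sdp n (sym_matrix x)"
    by (rule sdp_cong) (rule entry)
  show "sdp n (\<lambda>i j. - spiked_goe n l w i j) = sdp n (sym_matrix (\<lambda>e. - x e))"
    unfolding sym_matrix_uminus by (rule sdp_cong) (simp add: entry)
qed

lemma sdp_spiked_goe_measurable:
  "(\<lambda>w. sdp n (spiked_goe n l w)) \<in> borel_measurable (goe n)"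
  "(\<lambda>w. sdp n (\<lambda>i j. - spiked_goe n l w i j)) \<in> borel_measurable (goe n)"
  unfolding sdp_spiked_goe
  by (rule measurable_compose[OF shift_measurable sdp_sym_matrix_measurable],
      rule measurable_compose[OF shift_measurable sdp_sym_matrix_uminus_measurable])

lemma goe_far:
  fixes t :: real
  assumes k: "k > 0" and \<beta>: "\<beta> > 0" and t: "t > 0"
  defines "r \<equiv> radius k \<beta> t"
  shows "measure (goe n) {w \<in> space (goe n).
      \<not> goe_near k \<beta> r w}
    \<le> 6 * exp (- (n * min 1 (t\<^sup>2) / 64))"
proof -
  let ?E = "upper_pairs n"
  define B where "B = {x \<in> extensional ?E. \<not> sdp_near n (smooth_mean k \<beta>) (smooth_mean_uminus k \<beta>) (radius k \<beta> t) x}"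
  define X where "X w = (\<lambda>e\<in>?E. l / n + w e)" for w
  have "{w \<in> space (goe n). \<not> goe_near k \<beta> r w} = X -` B \<inter> space (goe n)"
    unfolding sdp_spiked_goe by (auto simp: B_def X_def r_def)
  also have "measure (goe n) \<dots> = measure (distr (goe n) (PiM ?E (\<lambda>_. borel)) X) B"
    unfolding B_def X_def by (rule measure_distr[symmetric]) (rule shift_measurable, rule sdp_far_measurable)
  also have "\<dots> = measure (PiM ?E (goe_law l n)) B"
    unfolding X_def distr_goe ..
  also have "\<dots> \<le> 6 * exp (- (n * min 1 (t\<^sup>2) / 64))"
    unfolding B_def radius_def smooth_mean_def smooth_mean_uminus_def
    by (rule sdp_concentration[where m = "\<lambda>_. l / n" and R = "l + 1"])
       (rule goe_real_laws n_pos goe_subexponential goe_mean_sum k \<beta> t)+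
  finally show ?thesis .
qed

text \<open>Only the marginals enter: each matrix misses the common centre on an event of its own
  law, and a union bound joins the two events, with 6 + 6 = 12. The triangle inequality through the
  centre explains the two radii in the hypothesis on \<open>c\<close>.\<close>

lemma coupling_close:
  fixes t c :: real
  assumes P: "P \<in> couplings (measure_pmf (sbm n (a / n) (b / n))) (goe n)"
    and k: "k > 0" and \<beta>: "\<beta> > 0" and t: "t > 0"
    and c: "2 * radius k \<beta> t + swap_error \<beta> \<le> n * c"
  shows "measure P {(g, w) \<in> space P.
      sdp_close n d l c g w}
    \<ge> 1 - 12 * exp (- (n * min 1 (t\<^sup>2) / 64))"
proof -
  let ?M = "measure_pmf (sbm n (a / n) (b / n))"
  interpret P: prob_space P using P by (simp add: couplings_def)
  have sets_P: "sets P = sets (?M \<Otimes>\<^sub>M goe n)" and fst: "distr P ?M fst = ?M" and snd: "distr P (goe n) snd = goe n"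
    using P by (auto simp: couplings_def)
  have fst_m: "fst \<in> measurable P ?M" and [measurable]: "snd \<in> measurable P (goe n)"
    unfolding measurable_cong_sets[OF sets_P refl] by (rule measurable_fst, rule measurable_snd)
  have space_P: "space P = UNIV \<times> space (goe n)"
    using sets_eq_imp_space_eq[OF sets_P] by (simp add: space_pair_measure)
  define p where "p = exp (- (n * min 1 (t\<^sup>2) / 64))"
  define Bg where "Bg = {g. \<not> graph_near k \<beta> (radius k \<beta> t + swap_error \<beta>) g}"
  define Bw where "Bw = {w \<in> space (goe n). \<not> goe_near k \<beta> (radius k \<beta> t) w}"
  define G where "G = {(g, w) \<in> space P.
      sdp_close n d l c g w}"
  note [measurable] = sdp_spiked_goe_measurable
  have Bw [measurable]: "Bw \<in> sets (goe n)" unfolding Bw_def by measurable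
  have mg: "(\<lambda>z. h (fst z)) \<in> borel_measurable P" for h :: "_ \<Rightarrow> real"
    by (rule measurable_compose[OF fst_m]) simp
  have mw: "(\<lambda>z. h (snd z)) \<in> borel_measurable P" if "h \<in> borel_measurable (goe n)" for h :: "_ \<Rightarrow> real"
    by (rule measurable_compose[OF _ that]) measurable
  note [measurable] = mg[of "\<lambda>g. sdp n (centered_adjacency n d g)"]
    mg[of "\<lambda>g. sdp n (\<lambda>i j. - centered_adjacency n d g i j)"]
    mw[OF sdp_spiked_goe_measurable(1)] mw[OF sdp_spiked_goe_measurable(2)]
  have "G = {z \<in> space P.
      \<bar>sdp n (centered_adjacency n d (fst z)) / (n * sqrt d) - sdp n (spiked_goe n l (snd z)) / n\<bar> \<le> c \<and>
      \<bar>sdp n (\<lambda>i j. - centered_adjacency n d (fst z) i j) / (n * sqrt d) - sdp n (\<lambda>i j. - spiked_goe n l (snd z) i j) / n\<bar> \<le> c}"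
    by (auto simp: G_def)
  also have "\<dots> \<in> sets P" by measurable
  finally have G: "G \<in> sets P" .
  have mBg: "fst -` Bg \<inter> space P \<in> sets P" by (rule measurable_sets[OF fst_m]) simp
  have mBw: "snd -` Bw \<inter> space P \<in> sets P" by (rule measurable_sets[of snd P "goe n"]) auto
  have close: "\<bar>x / (n * sqrt d) - y / n\<bar> \<le> c"
    if "\<bar>x / sqrt d - u\<bar> \<le> radius k \<beta> t + swap_error \<beta>" "\<bar>y - u\<bar> \<le> radius k \<beta> t" for x y u
  proof -
    have "\<bar>x / sqrt d - y\<bar> \<le> n * c" using that c by linarith
    then have "\<bar>x / sqrt d - y\<bar> / n \<le> c" using n_pos by (simp add: field_simps)
    moreover have "x / (n * sqrt d) - y / n = (x / sqrt d - y) / n"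
      by (simp add: diff_divide_distrib mult.commute)
    ultimately show ?thesis using n_pos by simp
  qed
  have "space P - G \<subseteq> (fst -` Bg \<inter> space P) \<union> (snd -` Bw \<inter> space P)"
  proof
    fix z assume z: "z \<in> space P - G"
    obtain g w where gw: "z = (g, w)" by (cases z)
    show "z \<in> (fst -` Bg \<inter> space P) \<union> (snd -` Bw \<inter> space P)"
    proof (rule ccontr)
      assume "z \<notin> (fst -` Bg \<inter> space P) \<union> (snd -` Bw \<inter> space P)"
      then have "g \<notin> Bg" "w \<notin> Bw" "w \<in> space (goe n)" using z gw space_P by auto
      then have "z \<in> G"
        using z gw close unfolding G_def Bg_def Bw_def by blast
      then show False using z by blast
    qed
  qed
  then have "P.prob (space P - G) \<le> P.prob ((fst -` Bg \<inter> space P) \<union> (snd -` Bw \<inter> space P))"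
    using mBg mBw by (intro P.finite_measure_mono) auto
  also have "\<dots> \<le> P.prob (fst -` Bg \<inter> space P) + P.prob (snd -` Bw \<inter> space P)"
    by (rule measure_Un_le[OF mBg mBw])
  also have "P.prob (fst -` Bg \<inter> space P) = measure (distr P ?M fst) Bg"
    by (rule measure_distr[symmetric, OF fst_m]) simp
  also have "\<dots> \<le> 6 * p"
    unfolding fst Bg_def p_def by (rule sbm_far[OF k \<beta> t])
  also have "P.prob (snd -` Bw \<inter> space P) = measure (distr P (goe n) snd) Bw"
    by (rule measure_distr[symmetric]) auto
  also have "\<dots> \<le> 6 * p"
    unfolding snd Bw_def p_def by (rule goe_far[OF k \<beta> t])
  finally have "P.prob (space P - G) \<le> 12 * p" by simp
  then show ?thesis using P.prob_compl[OF G] by (simp add: G_def p_def)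
qed

text \<open>Separates the two terms per vertex that survive as \<open>n\<close> grows with
  \<open>d\<close> and \<beta> fixed from those carrying \<open>1 / n\<close> or
  \<open>sqrt (1 / n)\<close>, which a large \<open>n\<close> absorbs.\<close>

lemma swap_error_eq:
  "swap_error \<beta> = n * (4 * l * (\<beta> / sqrt d) + 16 * (\<beta>\<^sup>2 / sqrt d) +
    ((16 * \<beta> * d + 2 * sqrt d + 2 * l) * (1 / n) + (16 * \<beta>\<^sup>2 + 2 * sqrt 2) * sqrt (1 / n)))"
proof -
  \<comment> \<open>With \<open>u\<close> in place of \<open>sqrt (1 / n)\<close>, and
    \<open>u / N\<close> in place of its cube, the claim becomes an identity of rational
    expressions.\<close>
  have alg: "N\<^sup>2 * (4 * \<beta> * (l / (q * N) + 4 * d / N\<^sup>2) + 8 * \<beta>\<^sup>2 * (2 / (N * q) + 2 * (u / N))) +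
      N * (2 * (q / N + (l / N + r * u))) =
    N * (4 * l * (\<beta> / q) + 16 * (\<beta>\<^sup>2 / q) + ((16 * \<beta> * d + 2 * q + 2 * l) * (1 / N) + (16 * \<beta>\<^sup>2 + 2 * r) * u))"
    if "N > 0" "q > 0" for N q u r :: real
  proof -
    have "N\<^sup>2 * (4 * \<beta> * (l / (q * N))) = N * (4 * l * (\<beta> / q))" "N\<^sup>2 * (4 * \<beta> * (4 * d / N\<^sup>2)) = 16 * \<beta> * d"
      "N\<^sup>2 * (8 * \<beta>\<^sup>2 * (2 / (N * q))) = N * (16 * (\<beta>\<^sup>2 / q))"
      "N\<^sup>2 * (8 * \<beta>\<^sup>2 * (2 * (u / N))) = N * (16 * \<beta>\<^sup>2 * u)"
      "N * (2 * (q / N)) = 2 * q" "N * (2 * (l / N)) = 2 * l" "N * ((16 * \<beta> * d + 2 * q + 2 * l) * (1 / N)) = 16 * \<beta> * d + 2 * q + 2 * l"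
      using that by (simp_all add: power2_eq_square)
    then show ?thesis unfolding distrib_left distrib_right by simp
  qed
  define u where "u = sqrt (1 / n)"
  have u: "sqrt (2 / n) = sqrt 2 * u" "u ^ 3 = u / n"
    by (simp_all add: u_def power3_eq_cube real_sqrt_divide)
  show ?thesis
    unfolding swap_error_def u_def[symmetric] u by (rule alg[OF n_pos(2) sqrt_d(2)])
qed

end

text \<open>Every error per vertex is at most a multiple of \<epsilon> or of
  \<open>t = ln d * \<epsilon>\<close>. The bound \<open>ln d \<ge> ln d\<^sub>0\<close> converts
  \<epsilon> into \<open>t / ln d\<^sub>0\<close>, whence the denominator in \<open>C\<close>. The
  deviation allowed in the concentration bound is \<open>sdp_error d\<close> itself, which puts its
  square into the rate.\<close>

lemma planted_coupling_close:
  fixes d\<^sub>0 a b d l :: real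
  assumes d0: "d\<^sub>0 > 1" and ab: "a \<ge> 0" "b \<ge> 0" and d: "d = avg_degree a b" and l: "l = snr a b" "l \<ge> 0"
    and dd: "d \<ge> d\<^sub>0"
    and C: "C = 64 + (4 * ln 10 + 1280 * (net_const + (l + 1)) + 4 * l + 17) / ln d\<^sub>0"
  shows "\<exists>n\<^sub>0 :: nat. \<forall>n\<ge>n\<^sub>0. even n \<longrightarrow>
         (\<forall>P \<in> couplings (measure_pmf (sbm n (a / real n) (b / real n))) (goe n).
            measure P {(g, w) \<in> space P.
              sdp_close n d l (C * sdp_error d) g w}
            \<ge> 1 - C * exp (- (real n * min 1 ((sdp_error d)\<^sup>2) / C)))"
proof -
  have d1: "d > 1" using d0 dd by simp
  define \<epsilon> where "\<epsilon> = d powr (- (1 / 10))"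
  define \<beta> where "\<beta> = d powr (1 / 5)"
  define t where "t = sdp_error d"
  define k where "k = nat \<lceil>d powr (1 / 10)\<rceil>"
  have \<epsilon>: "\<epsilon> > 0" using d1 by (simp add: \<epsilon>_def)
  have \<beta>: "\<beta> > 0" using d1 by (simp add: \<beta>_def)
  have t_eq: "t = ln d * \<epsilon>"
    unfolding t_def sdp_error_def \<epsilon>_def powr_minus by (rule divide_inverse)
  have t: "t > 0" using d1 \<epsilon> by (simp add: t_eq)
  have ld0: "ln d\<^sub>0 > 0" using d0 by simp
  have \<epsilon>t: "\<epsilon> \<le> t / ln d\<^sub>0"
  proof -
    have "ln d\<^sub>0 \<le> ln d" using d0 dd by simp
    then have "ln d\<^sub>0 * \<epsilon> \<le> t" unfolding t_eq using \<epsilon> by (intro mult_right_mono) auto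
    then show ?thesis using ld0 by (simp add: field_simps)
  qed
  define w where "w = d powr (1 / 10)"
  have w: "w \<ge> 1" "w * \<epsilon> = 1"
    using d1 by (simp_all add: w_def \<epsilon>_def ge_one_powr_ge_zero powr_add[symmetric])
  \<comment> \<open>Rounding up to an integer at most doubles, because
    \<open>w \<ge> 1\<close>.\<close>
  have kw: "w \<le> real k" "real k \<le> 2 * w" and k: "k > 0"
  proof -
    have "real k = of_int \<lceil>w\<rceil>" using w by (simp add: k_def w_def)
    then show "w \<le> real k" "real k \<le> 2 * w" using w by linarith+
    then show "k > 0" using w by (cases k) auto
  qed
  have k_le: "1 / real k \<le> \<epsilon>"
  proof -
    have "1 / real k \<le> 1 / w" using kw w by (intro divide_left_mono) auto
    also have "1 / w = \<epsilon>" using w by (simp add: field_simps)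
    finally show ?thesis .
  qed
  have k_\<beta>: "real k / \<beta> \<le> 2 * \<epsilon>"
  proof -
    have "real k / \<beta> \<le> 2 * w / \<beta>" using kw \<beta> by (intro divide_right_mono) auto
    also have "w / \<beta> = \<epsilon>" using d1 by (simp add: w_def \<beta>_def \<epsilon>_def powr_diff[symmetric])
    then have "2 * w / \<beta> = 2 * \<epsilon>" by simp
    finally show ?thesis .
  qed
  have ln_k: "0 \<le> ln (5 * real k)" "ln (5 * real k) \<le> ln 10 + ln d / 10"
  proof -
    show "0 \<le> ln (5 * real k)" using kw w by simp
    have "ln (5 * real k) \<le> ln (10 * w)" using kw w by (intro ln_mono) auto
    also have "\<dots> = ln 10 + ln d / 10" using w d1 by (simp add: ln_mult w_def ln_powr)
    finally show "ln (5 * real k) \<le> ln 10 + ln d / 10" .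
  qed
  define K where "K = net_const + (l + 1)"
  have K: "K > 0" using net_const_pos l by (simp add: K_def)
  have \<eta>: "k * ln (5 * real k) / \<beta> + 80 / k * (8 * K) \<le> 2 * \<epsilon> * ln 10 + t / 5 + 640 * K * \<epsilon>"
  proof -
    \<comment> \<open>The logarithm in the final error enters here through the size of the net,
      whose logarithm per vertex and dimension grows like \<open>ln d / 10\<close>.\<close>
    have "real k / \<beta> * ln (5 * real k) \<le> 2 * \<epsilon> * (ln 10 + ln d / 10)"
      using k_\<beta> ln_k \<epsilon> by (intro mult_mono) auto
    also have "\<dots> = 2 * \<epsilon> * ln 10 + t / 5" by (simp add: t_eq algebra_simps)
    finally have "k * ln (5 * real k) / \<beta> \<le> 2 * \<epsilon> * ln 10 + t / 5" by simp
    moreover have "640 * K * (1 / real k) \<le> 640 * K * \<epsilon>" using k_le K by (intro mult_left_mono) auto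
    then have "80 / k * (8 * K) \<le> 640 * K * \<epsilon>" by simp
    ultimately show ?thesis by linarith
  qed
  have \<beta>1: "\<beta> / sqrt d \<le> \<epsilon>" "\<beta>\<^sup>2 / sqrt d = \<epsilon>"
  proof -
    have s: "sqrt d = d powr (1 / 2)" using d1 by (simp add: powr_half_sqrt)
    have "\<beta> / sqrt d = d powr (1 / 5 - 1 / 2)" unfolding \<beta>_def s by (rule powr_diff[symmetric])
    also have "\<dots> \<le> d powr (- (1 / 10))" using d1 by (intro powr_mono) auto
    finally show "\<beta> / sqrt d \<le> \<epsilon>" by (simp add: \<epsilon>_def)
    have "\<beta>\<^sup>2 = d powr (2 / 5)" using d1 by (simp add: \<beta>_def power2_eq_square powr_add[symmetric])
    then show "\<beta>\<^sup>2 / sqrt d = \<epsilon>" unfolding s by (simp add: \<epsilon>_def powr_diff[symmetric])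
  qed
  define K1 where "K1 = 16 * \<beta> * d + 2 * sqrt d + 2 * l"
  define K2 where "K2 = 16 * \<beta>\<^sup>2 + 2 * sqrt 2"
  have "(\<lambda>n. K1 * inverse (real n) + K2 * sqrt (inverse (real n))) \<longlonglongrightarrow> K1 * 0 + K2 * sqrt 0"
    by (intro tendsto_intros lim_inverse_n)
  then have "eventually (\<lambda>n. K1 * inverse (real n) + K2 * sqrt (inverse (real n)) < \<epsilon>) sequentially"
    using \<epsilon> by (intro order_tendstoD(2)) auto
  then obtain n\<^sub>1 where n1: "\<And>n. n \<ge> n\<^sub>1 \<Longrightarrow> K1 * inverse (real n) + K2 * sqrt (inverse (real n)) < \<epsilon>"
    unfolding eventually_sequentially by blast
  \<comment> \<open>The value 64 covers the rate, the prefactor 12 and the coefficient 12/5 of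
    \<open>t\<close> below.\<close>
  have C64: "C \<ge> 64"
    unfolding C using ld0 l net_const_pos by (simp add: add_nonneg_nonneg)
  show ?thesis
  proof (intro exI allI impI ballI)
    fix n P
    assume n: "max n\<^sub>1 (nat \<lceil>2 * d\<rceil>) \<le> n" and P: "P \<in> couplings (measure_pmf (sbm n (a / real n) (b / real n))) (goe n)"
    have "2 * d \<le> n" using n by linarith
    then interpret planted a b d l n
      using ab d l d1 by unfold_locales auto
    have s1: "4 * l * (\<beta> / sqrt d) \<le> 4 * l * \<epsilon>" using \<beta>1 l0 by (intro mult_left_mono) auto
    have s2: "16 * (\<beta>\<^sup>2 / sqrt d) \<le> 16 * \<epsilon>" using \<beta>1 by simp
    have s3: "(16 * \<beta> * d + 2 * sqrt d + 2 * l) * (1 / n) + (16 * \<beta>\<^sup>2 + 2 * sqrt 2) * sqrt (1 / n) \<le> \<epsilon>"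
      using n1[of n] n by (simp add: K1_def K2_def inverse_eq_divide)
    have "swap_error \<beta> \<le> n * (4 * l * \<epsilon> + 16 * \<epsilon> + \<epsilon>)"
      unfolding swap_error_eq by (rule mult_left_mono[OF add_mono[OF add_mono[OF s1 s2] s3]]) simp
    moreover have "radius k \<beta> t \<le> n * (t + (2 * \<epsilon> * ln 10 + t / 5 + 640 * K * \<epsilon>))"
      unfolding radius_def using \<eta> by (intro mult_left_mono) (auto simp: K_def)
    ultimately have "2 * radius k \<beta> t + swap_error \<beta> \<le>
        2 * (n * (t + (2 * \<epsilon> * ln 10 + t / 5 + 640 * K * \<epsilon>))) + n * (4 * l * \<epsilon> + 16 * \<epsilon> + \<epsilon>)" by linarith
    \<comment> \<open>The 12/5 is twice 1 + 1/5. In 17, the 16 comes from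
      \<open>\<beta>\<^sup>2 / sqrt d\<close> and the 1 from the terms that vanish as
      \<open>n\<close> grows.\<close>
    also have "\<dots> = n * (12 / 5 * t + (4 * ln 10 + 1280 * K + 4 * l + 17) * \<epsilon>)" by (simp add: algebra_simps)
    also have "\<dots> \<le> n * (64 * t + (4 * ln 10 + 1280 * K + 4 * l + 17) * (t / ln d\<^sub>0))"
      using t \<epsilon>t K l0 by (intro mult_left_mono add_mono) auto
    also have "\<dots> = n * (C * t)" unfolding C K_def by (simp add: algebra_simps add_divide_distrib)
    finally have c: "2 * radius k \<beta> t + swap_error \<beta> \<le> n * (C * t)" .
    have "1 - C * exp (- (real n * min 1 (t\<^sup>2) / C)) \<le> 1 - 12 * exp (- (n * min 1 (t\<^sup>2) / 64))"
    proof -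
      have "n * min 1 (t\<^sup>2) / C \<le> n * min 1 (t\<^sup>2) / 64" using C64 by (intro divide_left_mono) auto
      then have "12 * exp (- (n * min 1 (t\<^sup>2) / 64)) \<le> C * exp (- (n * min 1 (t\<^sup>2) / C))"
        using C64 by (intro mult_mono) auto
      then show ?thesis by simp
    qed
    also note coupling_close[OF P k \<beta> t c]
    finally show "1 - C * exp (- (real n * min 1 ((sdp_error d)\<^sup>2) / C)) \<le>
      measure P {(g, w) \<in> space P.
              sdp_close n d l (C * sdp_error d) g w}"
      by (simp only: t_def)
  qed
qed

text \<open>The bound \<open>d\<^sub>0\<close> is fixed before \<open>C\<close> because
  \<open>sdp_error d\<close> tends to 0 as \<open>d\<close> decreases to 1, whereas the bounds of
  order d^(-1/10) obtained for the rounding, smoothing and exchange losses do not.\<close>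

theorem theoremA4:
  fixes d\<^sub>0 :: real
  assumes "d\<^sub>0 > 1"
  shows "\<exists>C :: real \<Rightarrow> real.
    (\<forall>l\<ge>0. C l > 0) \<and>
    (\<forall>lmax\<ge>0. bdd_above (C ` {0..lmax})) \<and>
    (\<forall>a b d l :: real.
       a \<ge> 0 \<and> b \<ge> 0 \<and> d = avg_degree a b \<and> l = snr a b \<and> l \<ge> 0 \<and> d \<ge> d\<^sub>0 \<longrightarrow>
       (\<exists>n\<^sub>0 :: nat. \<forall>n\<ge>n\<^sub>0. even n \<longrightarrow>
         (\<forall>P \<in> couplings (measure_pmf (sbm n (a / real n) (b / real n))) (goe n).
            measure P {(g, w) \<in> space P.
              \<bar>sdp n (centered_adjacency n d g) / (real n * sqrt d)
                 - sdp n (spiked_goe n l w) / real n\<bar> \<le> C l * sdp_error d \<and>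
              \<bar>sdp n (\<lambda>i j. - centered_adjacency n d g i j) / (real n * sqrt d)
                 - sdp n (\<lambda>i j. - spiked_goe n l w i j) / real n\<bar> \<le> C l * sdp_error d}
            \<ge> 1 - C l * exp (- (real n * min 1 ((sdp_error d)\<^sup>2) / C l)))))"
proof -
  \<comment> \<open>Affine and increasing in \<open>l\<close>, so that on an interval it is bounded
    by its value at the right end.\<close>
  define C where "C l = 64 + (4 * ln 10 + 1280 * (net_const + (l + 1)) + 4 * l + 17) / ln d\<^sub>0" for l
  have ld0: "ln d\<^sub>0 > 0" using assms by simp
  show ?thesis
  proof (intro exI[of _ C] conjI allI impI)
    show "C l > 0" if "l \<ge> 0" for l
    proof -
      have "(4 * ln 10 + 1280 * (net_const + (l + 1)) + 4 * l + 17) / ln d\<^sub>0 \<ge> 0"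
        using that ld0 net_const_pos by (intro divide_nonneg_pos add_nonneg_nonneg) auto
      then show ?thesis by (simp add: C_def)
    qed
    show "bdd_above (C ` {0..lmax})" for lmax
    proof (rule bdd_aboveI2)
      fix l assume "l \<in> {0..lmax}"
      then show "C l \<le> C lmax"
        unfolding C_def using ld0 by (intro add_left_mono divide_right_mono) auto
    qed
    fix a b d l :: real
    assume h: "a \<ge> 0 \<and> b \<ge> 0 \<and> d = avg_degree a b \<and> l = snr a b \<and> l \<ge> 0 \<and> d \<ge> d\<^sub>0"
    show "\<exists>n\<^sub>0 :: nat. \<forall>n\<ge>n\<^sub>0. even n \<longrightarrow>
         (\<forall>P \<in> couplings (measure_pmf (sbm n (a / real n) (b / real n))) (goe n).
            measure P {(g, w) \<in> space P.
              sdp_close n d l (C l * sdp_error d) g w}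
            \<ge> 1 - C l * exp (- (real n * min 1 ((sdp_error d)\<^sup>2) / C l)))"
      by (rule planted_coupling_close[OF assms _ _ _ _ _ _ C_def]) (use h in blast)+
  qed
qed

end
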